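(* Let $d \ge 2$ and let $X \subset \mathbb{P}^2_\mathbb{Q} \times \mathbb{P}^2_\mathbb{Q}$ be given by $a_0x_0^d + a_1x_1^d + a_2x_2^d = 0$, with $\pi: X \to \mathbb{P}^2_\mathbb{Q}$ the projection to $(a_0:a_1:a_2)$. Then $$N_{\mathrm{loc}}(\pi,B) \ll \frac{B^3}{(\log B)^{3(1-\delta(d))}},$$ where $\delta$ is the multiplicative function with $\delta(p^m) = 1 - \frac{p^{2m}-1}{p^{2m-1}(p^2-1)}$ for every prime $p$ and positive integer $m$.
   Context: $N_{\mathrm{loc}}(\pi,B) = \#\{a \in \mathbb{P}^2(\mathbb{Q}) : a \in \pi(X(\mathbf{A}_\mathbb{Q})), H(a) \le B\}$, where $\mathbf{A}_\mathbb{Q}$ is the adèle ring and $H$ the standard height $H(a) = \prod_v \max_i |a_i|_v$. *)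

theory Defs
  imports
    "HOL-Analysis.Finite_Cartesian_Product"
    "HOL-Library.Landau_Symbols"
    "HOL-Algebra.Chinese_Remainder"
    "HOL-Algebra.Algebraic_Closure_Type"
begin

hide_const (open) Divisibility.prime

section \<open>The adele ring of the rationals\<close>

definition padic_abs :: "nat \<Rightarrow> rat \<Rightarrow> real" where
  "padic_abs p q =
     (if q = 0 then 0
      else real p powi (int (multiplicity (int p) (snd (quotient_of q)))
                        - int (multiplicity (int p) (fst (quotient_of q)))))"

text \<open>The field of \<open>p\<close>-adic numbers is the completion of the rationals for the \<open>p\<close>-adic absolute
  value: Cauchy sequences modulo null sequences.\<close>

definition padic_cauchy :: "nat \<Rightarrow> (nat \<Rightarrow> rat) ring" where
  "padic_cauchy p =
     \<lparr>carrier = {x. \<forall>e>0. \<exists>N. \<forall>m\<ge>N. \<forall>n\<ge>N. padic_abs p (x m - x n) < e},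
      monoid.mult = (\<lambda>x y n. x n * y n), one = (\<lambda>_. 1),
      ring.zero = (\<lambda>_. 0), add = (\<lambda>x y n. x n + y n)\<rparr>"

definition padic_null :: "nat \<Rightarrow> (nat \<Rightarrow> rat) set" where
  "padic_null p = {x. (\<lambda>n. padic_abs p (x n)) \<longlonglongrightarrow> 0}"

definition padic_field :: "nat \<Rightarrow> (nat \<Rightarrow> rat) set ring" where
  "padic_field p = padic_cauchy p Quot padic_null p"

definition padic_of_rat :: "nat \<Rightarrow> rat \<Rightarrow> (nat \<Rightarrow> rat) set" where
  "padic_of_rat p q = padic_null p +>\<^bsub>padic_cauchy p\<^esub> (\<lambda>_. q)"

text \<open>The closed unit ball. The absolute value is discrete, so a \<open>p\<close>-adic number has absolute value
  at most \<open>1\<close> iff it is represented by a sequence all of whose terms have absolute value at most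
  \<open>1\<close>.\<close>

definition padic_integers :: "nat \<Rightarrow> (nat \<Rightarrow> rat) set set" where
  "padic_integers p =
     {\<xi> \<in> carrier (padic_field p). \<exists>x\<in>\<xi>. \<forall>n. padic_abs p (x n) \<le> 1}"

text \<open>The restricted product of the \<open>p\<close>-adic fields; the functions are \<open>undefined\<close> off the primes.\<close>

definition finite_adeles :: "(nat \<Rightarrow> (nat \<Rightarrow> rat) set) ring" where
  "finite_adeles =
     \<lparr>carrier = {f \<in> (\<Pi>\<^sub>E p\<in>{p. prime p}. carrier (padic_field p)).
                  finite {p. prime p \<and> f p \<notin> padic_integers p}},
      monoid.mult = (\<lambda>f g. \<lambda>p\<in>{p. prime p}. f p \<otimes>\<^bsub>padic_field p\<^esub> g p),
      one = (\<lambda>p\<in>{p. prime p}. \<one>\<^bsub>padic_field p\<^esub>),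
      ring.zero = (\<lambda>p\<in>{p. prime p}. \<zero>\<^bsub>padic_field p\<^esub>),
      add = (\<lambda>f g. \<lambda>p\<in>{p. prime p}. f p \<oplus>\<^bsub>padic_field p\<^esub> g p)\<rparr>"

definition adeles :: "(real \<times> (nat \<Rightarrow> (nat \<Rightarrow> rat) set)) ring" where
  "adeles = RDirProd (ring_of_type_algebra :: real ring) finite_adeles"

definition adele_of_rat :: "rat \<Rightarrow> real \<times> (nat \<Rightarrow> (nat \<Rightarrow> rat) set)" where
  "adele_of_rat q = (of_rat q, \<lambda>p\<in>{p. prime p}. padic_of_rat p q)"


section \<open>Points of the projective plane and of \<open>X\<close>\<close>

text \<open>Over a ring all of whose invertible modules are free, such as the rationals or their adele
  ring, the points of the projective plane are the triples generating the unit ideal, up to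
  multiplication by units. Over a field these are the nonzero triples up to scaling.\<close>

definition unimodular :: "('a, 'b) ring_scheme \<Rightarrow> ('a ^ 3) set" where
  "unimodular R =
     {x. (\<forall>i. x $ i \<in> carrier R) \<and>
         (\<exists>c :: 'a ^ 3. (\<forall>i. c $ i \<in> carrier R) \<and>
            (\<Oplus>\<^bsub>R\<^esub>i\<in>UNIV. c $ i \<otimes>\<^bsub>R\<^esub> x $ i) = \<one>\<^bsub>R\<^esub>)}"

definition proj_class :: "('a, 'b) ring_scheme \<Rightarrow> 'a ^ 3 \<Rightarrow> ('a ^ 3) set" where
  "proj_class R x = {(\<chi> i. u \<otimes>\<^bsub>R\<^esub> x $ i) | u. u \<in> Units R}"

definition proj_plane :: "('a, 'b) ring_scheme \<Rightarrow> ('a ^ 3) set set" where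
  "proj_plane R = proj_class R ` unimodular R"

text \<open>The map on points induced by a ring homomorphism \<open>h\<close> to \<open>S\<close>: the classes on the right-hand
  side all coincide.\<close>

definition proj_map :: "('b, 'c) ring_scheme \<Rightarrow> ('a \<Rightarrow> 'b) \<Rightarrow> ('a ^ 3) set \<Rightarrow> ('b ^ 3) set" where
  "proj_map S h P = (\<Union>a\<in>P. proj_class S (\<chi> i. h (a $ i)))"

definition X_points :: "nat \<Rightarrow> ('a, 'b) ring_scheme \<Rightarrow> (('a ^ 3) set \<times> ('a ^ 3) set) set" where
  "X_points d R =
     {(proj_class R a, proj_class R x) | a x. a \<in> unimodular R \<and> x \<in> unimodular R \<and>
        (\<Oplus>\<^bsub>R\<^esub>i\<in>UNIV. a $ i \<otimes>\<^bsub>R\<^esub> (x $ i [^]\<^bsub>R\<^esub> d)) = \<zero>\<^bsub>R\<^esub>}"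


section \<open>Heights and the counting function\<close>

abbreviation rats :: "rat ring" where
  "rats \<equiv> ring_of_type_algebra"

text \<open>The product over the primes is finite, as almost all factors are \<open>1\<close> for \<open>a \<noteq> 0\<close>.\<close>

definition height_triple :: "rat ^ 3 \<Rightarrow> real" where
  "height_triple a =
     (MAX i. real_of_rat \<bar>a $ i\<bar>) *
     (\<Prod>p | prime p \<and> (MAX i. padic_abs p (a $ i)) \<noteq> 1. MAX i. padic_abs p (a $ i))"

text \<open>The choice of representative is immaterial by the product formula.\<close>

definition height :: "(rat ^ 3) set \<Rightarrow> real" where
  "height P = height_triple (SOME a. a \<in> P)"

definition N_loc :: "nat \<Rightarrow> real \<Rightarrow> nat" where
  "N_loc d B =
     card {P \<in> proj_plane rats.
             proj_map adeles adele_of_rat P \<in> fst ` X_points d adeles \<and> height P \<le> B}"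


section \<open>The function \<open>\<delta>\<close>\<close>

definition delta :: "nat \<Rightarrow> real" where
  "delta n =
     (\<Prod>p\<in>prime_factors n. let m = multiplicity p n in
        1 - (real p ^ (2 * m) - 1) / (real p ^ (2 * m - 1) * (real p ^ 2 - 1)))"

lemma delta_one: "delta 1 = 1"
  by (simp add: delta_def)

lemma delta_mult:
  assumes "coprime m n" "m > 0" "n > 0"
  shows "delta (m * n) = delta m * delta n"
proof -
  have pf: "prime_factors (m * n) = prime_factors m \<union> prime_factors n"
    using assms by (simp add: prime_factors_product)
  have disj: "prime_factors m \<inter> prime_factors n = {}"
    using assms(1) by (auto simp: prime_factors_dvd coprime_common_divisor_nat
        dest: coprime_common_divisor not_prime_unit)
  have 1: "multiplicity p (m * n) = multiplicity p m" if "p \<in> prime_factors m" for p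
  proof -
    have "p \<notin> prime_factors n" "prime p" using that disj by auto
    then have "\<not> p dvd n" using assms by (auto simp: prime_factors_dvd)
    then show ?thesis using assms \<open>prime p\<close>
      by (simp add: prime_elem_multiplicity_mult_distrib not_dvd_imp_multiplicity_0)
  qed
  have 2: "multiplicity p (m * n) = multiplicity p n" if "p \<in> prime_factors n" for p
  proof -
    have "p \<notin> prime_factors m" "prime p" using that disj by auto
    then have "\<not> p dvd m" using assms by (auto simp: prime_factors_dvd)
    then show ?thesis using assms \<open>prime p\<close>
      by (simp add: prime_elem_multiplicity_mult_distrib not_dvd_imp_multiplicity_0)
  qed
  show ?thesis
    unfolding delta_def pf using disj
    by (subst prod.union_disjoint) (auto simp: 1 2 Let_def)
qed

lemma delta_prime_power:
  assumes "prime p" "m > 0"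
  shows "delta (p ^ m) = 1 - (real p ^ (2 * m) - 1) / (real p ^ (2 * m - 1) * (real p ^ 2 - 1))"
  using assms by (simp add: delta_def prime_factorization_prime_power Let_def)

end

theory Submission
  imports Defs "HOL-Number_Theory.Number_Theory" "HOL-Real_Asymp.Real_Asymp" "HOL-Analysis.Analysis"
begin

text \<open>A counted point has a primitive integer representative \<open>(a\<^sub>0, a\<^sub>1, a\<^sub>2)\<close> with \<open>\<bar>a\<^sub>i\<bar> \<le> B\<close> such that
  \<open>a\<^sub>0x\<^sub>0^d + a\<^sub>1x\<^sub>1^d + a\<^sub>2x\<^sub>2^d\<close> has a primitive zero modulo \<open>p^2\<close> for every prime \<open>p\<close>. This fails when \<open>p\<close> divides
  exactly one coefficient, to exactly the first power, and minus the quotient of the other two is not a \<open>d\<close>-th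
  power modulo \<open>p\<close>; such triples have density about \<open>(3/p)(1 - 1/gcd(d, p - 1))\<close> modulo \<open>p^2\<close>. A
  sieve of Selberg type therefore bounds the number of triples by \<open>B^3\<close> times the exponential of minus the sum of these
  densities over the primes up to a small power of \<open>B\<close>. Finally \<open>delta d\<close> is the mean of \<open>1/gcd(d, a - 1)\<close>
  over the units \<open>a\<close> modulo \<open>d\<close>, so Mertens' theorem in arithmetic progressions evaluates the sum
  as \<open>3(1 - delta d) log log B + O(1)\<close>.\<close>

section \<open>Chebyshev and Mertens estimates\<close>

text \<open>An upper bound allows information to be lost in one direction throughout: adelic points
  are weakened to solubility modulo \<open>p^2\<close>, and prime sums are bounded only from below.
  The modulus \<open>p^2\<close> is forced, because exact divisibility of a coefficient by
  \<open>p\<close> is invisible modulo \<open>p\<close>. The hard input for primes in progressions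
  is that L(1, chi) is nonzero, obtained by elementary means. The sieve uses orthogonal functions.
  Let \<open>test p\<close> be -1 on the bad classes and a constant elsewhere, chosen so that the
  mean is zero. Let F be the sum of products of tests over sets of primes with product at most R. On
  the sifted triples F has a constant value G, while orthogonality bounds the sum of F^2 over a box
  of side M by M^3 * G plus an error. Hence there are at most about M^3 / G such triples. Finally G
  is at least half of the full Euler product once the sifting primes stay below a small fixed power
  of R, and R in turn is a small power of M. This costs only a constant factor, since ln ln changes
  by a bounded amount when B is replaced by a power of B.\<close>

lemma sum_divisors_swap:
  fixes f :: "nat \<Rightarrow> nat \<Rightarrow> 'a::comm_monoid_add"
  shows "(\<Sum>n=1..N. \<Sum>m | m dvd n. f m (n div m)) = (\<Sum>m=1..N. \<Sum>k=1..N div m. f m k)"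
proof -
  have fin: "finite {m. m dvd n}" if "n \<in> {1..N}" for n
    using that by (intro finite_divisors_nat) auto
  have "(\<Sum>n=1..N. \<Sum>m | m dvd n. f m (n div m)) = (\<Sum>(n,m)\<in>(SIGMA n:{1..N}. {m. m dvd n}). f m (n div m))"
    using fin by (subst sum.Sigma) auto
  also have "\<dots> = (\<Sum>(m,k)\<in>(SIGMA m:{1..N}. {1..N div m}). f m k)"
  proof (rule sum.reindex_bij_witness[where i="\<lambda>(m,k). (m*k, m)" and j="\<lambda>(n,m). (m, n div m)"], goal_cases)
    case (1 a) then show ?case by auto
  next
    case (2 a)
    then obtain n m where nm: "a = (n,m)" "1 \<le> n" "n \<le> N" "m dvd n" by auto
    then have "m \<le> n" "m > 0" using dvd_imp_le by (auto intro!: Nat.gr0I)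
    moreover have "n div m \<ge> 1" using \<open>m \<le> n\<close> \<open>m > 0\<close> by (simp add: div_greater_zero_iff Suc_le_eq)
    ultimately show ?case using nm by (auto intro: div_le_mono)
  next
    case (3 b) then show ?case by auto
  next
    case (4 b)
    then obtain m k where mk: "b = (m,k)" "1 \<le> m" "m \<le> N" "1 \<le> k" "k \<le> N div m" by auto
    then have "m * k \<le> N" using times_div_less_eq_dividend[of m N] mult_le_mono2[of k "N div m" m] by linarith
    then show ?case using mk by auto
  next
    case (5 a) then show ?case by auto
  qed
  also have "\<dots> = (\<Sum>m=1..N. \<Sum>k=1..N div m. f m k)"
    by (subst sum.Sigma) auto
  finally show ?thesis .
qed

lemma real_div_bounds:
  shows "real (N div m) \<le> real N / real m" "real N / real m < real (N div m) + 1"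
  using floor_correct[of "real N / real m"] by (simp_all add: floor_divide_of_nat_eq)

text \<open>Legendre's formula, the bridge between Stirling-type bounds for the factorial and
  weighted sums over primes.\<close>

lemma ln_fact_mangoldt: "ln (fact N) = (\<Sum>m=1..N. mangoldt m * real (N div m))"
proof -
  have "ln (fact N :: real) = (\<Sum>n=1..N. ln (real n))"
    by (induction N) (auto simp: ln_mult)
  also have "\<dots> = (\<Sum>n=1..N. \<Sum>m | m dvd n. mangoldt m)"
    by (intro sum.cong refl) (simp add: mangoldt_sum)
  also have "\<dots> = (\<Sum>m=1..N. mangoldt m * real (N div m))"
    by (subst sum_divisors_swap[of "\<lambda>m _. mangoldt m"]) (simp add: mult.commute)
  finally show ?thesis .
qed

lemma ln_fact_le: "ln (fact N) \<le> real N * ln (real N)"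
proof (cases "N = 0")
  case False
  have "fact N \<le> real N ^ N" using fact_le_power[of N, where ?'a=real] by simp
  then have "ln (fact N) \<le> ln (real N ^ N)" using False by (subst ln_le_cancel_iff) auto
  then show ?thesis using False by (simp add: ln_realpow)
qed auto

text \<open>The single term \<open>N ^ N / fact N\<close> of the exponential series at
  \<open>N\<close> is at most \<open>exp N\<close>.\<close>

lemma ln_fact_ge: "ln (fact N) \<ge> real N * ln (real N) - real N"
proof (cases "N = 0")
  case False
  have s: "(\<lambda>n. real N ^ n / fact n) sums exp (real N)"
    using exp_converges[of "real N"] by (simp add: scaleR_conv_of_real field_simps)
  have "real N ^ N / fact N = (\<Sum>n\<in>{N}. real N ^ n / fact n)" by simp
  also have "\<dots> \<le> exp (real N)"
    using sum_le_suminf[OF sums_summable[OF s], of "{N}"] sums_unique[OF s] by auto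
  finally have "ln (real N ^ N / fact N) \<le> ln (exp (real N))"
    using False by (subst ln_le_cancel_iff) auto
  then show ?thesis using False by (simp add: ln_div ln_realpow)
qed auto

definition chebyshev_psi :: "nat \<Rightarrow> real" where
  "chebyshev_psi N = (\<Sum>n=1..N. mangoldt n)"

text \<open>Chebyshev's argument with \<open>h = N div 2\<close>. By Legendre's formula,
  \<open>ln (fact N) - 2 * ln (fact h)\<close> weights each \<open>mangoldt m\<close> by
  \<open>N div m - 2 * (h div m)\<close>, which is nonnegative and at least 1 for
  \<open>h < m \<le> N\<close>. The logarithm is small because the central binomial coefficient is
  at most \<open>2 ^ (2 * h)\<close>.\<close>

lemma chebyshev_psi_half: "chebyshev_psi N \<le> chebyshev_psi (N div 2) + 2 * real N"
proof (cases "N = 0")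
  case False
  define h where "h = N div 2"
  have fl: "real (N div m) - 2 * real (h div m) \<ge> (if m > h then 1 else 0)" if "m \<in> {1..N}" for m
  proof -
    have "2 * (h div m) \<le> N div m"
    proof -
      have "m * (2 * (h div m)) \<le> 2 * h" using times_div_less_eq_dividend[of m h] by (simp add: mult.left_commute)
      also have "\<dots> \<le> N" unfolding h_def by simp
      finally show ?thesis using that by (simp add: less_eq_div_iff_mult_less_eq mult.commute)
    qed
    then have 1: "2 * real (h div m) \<le> real (N div m)" by linarith
    moreover have "h div m = 0" if "m > h" using that by simp
    moreover have "N div m \<ge> 1" using that by (simp add: div_greater_zero_iff Suc_le_eq)
    ultimately show ?thesis by auto
  qed
  have "chebyshev_psi N - chebyshev_psi h = (\<Sum>m=1..N. mangoldt m * (if m > h then 1 else 0))"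
  proof -
    have U: "{1..N} = {1..h} \<union> {h<..N}" unfolding h_def by auto
    have "chebyshev_psi N = chebyshev_psi h + (\<Sum>n\<in>{h<..N}. mangoldt n)"
      unfolding chebyshev_psi_def by (subst U, rule sum.union_disjoint) auto
    moreover have "(\<Sum>m=1..N. mangoldt m * (if m > h then 1 else 0)) = (\<Sum>n\<in>{h<..N}. mangoldt n :: real)"
      by (rule sum.mono_neutral_cong_right) auto
    ultimately show ?thesis by simp
  qed
  also have "\<dots> \<le> (\<Sum>m=1..N. mangoldt m * (real (N div m) - 2 * real (h div m)))"
    by (intro sum_mono mult_left_mono fl mangoldt_nonneg)
  also have "\<dots> = (\<Sum>m=1..N. mangoldt m * real (N div m)) - 2 * (\<Sum>m=1..N. mangoldt m * real (h div m))"
    by (simp add: algebra_simps sum_subtractf sum_distrib_left)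
  also have "(\<Sum>m=1..N. mangoldt m * real (h div m)) = (\<Sum>m=1..h. mangoldt m * real (h div m))"
    by (rule sum.mono_neutral_right) (auto simp: h_def)
  also have "(\<Sum>m=1..N. mangoldt m * real (N div m)) - 2 * (\<Sum>m=1..h. mangoldt m * real (h div m))
     = ln (fact N) - 2 * ln (fact h)" by (simp add: ln_fact_mangoldt)
  also have "\<dots> \<le> 2 * real N"
  proof -
    have "ln (fact (2*h)) - 2 * ln (fact h) \<le> real N"
    proof -
      have "fact (2*h) = (fact h * fact h * real (2*h choose h))"
        using arg_cong[OF binomial_fact_lemma[of h "2*h"], of real] by (simp del: of_nat_numeral)
      then have "ln (fact (2*h)) = 2 * ln (fact h) + ln (real (2*h choose h))"
        by (simp add: ln_mult)
      moreover have "ln (real (2*h choose h)) \<le> ln (2 ^ (2*h))"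
        using binomial_le_pow2[of "2*h" h] by (subst ln_le_cancel_iff) (auto simp flip: of_nat_le_iff)
      moreover have "ln (2 ^ (2*h) :: real) \<le> real (2*h)"
      proof -
        have "ln (2::real) \<le> 1" using ln_le_minus_one[of "2::real"] by simp
        then have "real (2*h) * ln 2 \<le> real (2*h) * 1" by (intro mult_left_mono) auto
        then show ?thesis by (simp add: ln_realpow)
      qed
      moreover have "real (2 * h) \<le> real N" unfolding h_def by simp
      ultimately show ?thesis by linarith
    qed
    \<comment> \<open>For odd \<open>N\<close> there is one extra factor \<open>N\<close>, and
      \<open>ln N \<le> N\<close> accounts for the second \<open>N\<close> in the bound.\<close>
    moreover have "ln (fact N :: real) \<le> ln (fact (2*h)) + real N"
    proof (cases "even N")
      case True then have "N = 2*h" by (simp add: h_def)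
      then show ?thesis by simp
    next
      case odd: False then have "N = Suc (2*h)" by (simp add: h_def)
      then have "fact N = real N * fact (2*h)" by simp
      then have "ln (fact N) = ln (real N) + ln (fact (2*h))" using False by (simp add: ln_mult)
      moreover have "ln (real N) \<le> real N" using ln_le_minus_one[of "real N"] False by simp
      ultimately show ?thesis by simp
    qed
    ultimately show ?thesis by simp
  qed
  finally show ?thesis by (simp add: h_def)
qed (simp add: chebyshev_psi_def)

lemma chebyshev_psi_le: "chebyshev_psi N \<le> 4 * real N"
proof (induction N rule: less_induct)
  case (less N)
  show ?case
  proof (cases "N = 0")
    case False
    then have "chebyshev_psi (N div 2) \<le> 4 * real (N div 2)" by (intro less) auto
    moreover have "2 * real (N div 2) \<le> real N" by linarith
    ultimately show ?thesis using chebyshev_psi_half[of N] by linarith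
  qed (simp add: chebyshev_psi_def)
qed

text \<open>Removing the integer parts from Legendre's formula costs at most one
  \<open>mangoldt n\<close> per term, in total \<open>chebyshev_psi N\<close>, which is of order
  \<open>N\<close> and disappears after division by \<open>N\<close>.\<close>

lemma sum_mangoldt_over_le:
  assumes "N \<ge> 1" shows "(\<Sum>n=1..N. mangoldt n / real n) \<le> ln (real N) + 4"
proof -
  have "real N * (\<Sum>n=1..N. mangoldt n / real n) = (\<Sum>n=1..N. mangoldt n * (real N / real n))"
    by (simp add: sum_distrib_left mult_ac)
  also have "\<dots> \<le> (\<Sum>n=1..N. mangoldt n * (real (N div n) + 1))"
    by (intro sum_mono mult_left_mono mangoldt_nonneg) (rule less_imp_le[OF real_div_bounds(2)])
  also have "\<dots> = ln (fact N) + chebyshev_psi N"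
    by (simp add: ln_fact_mangoldt chebyshev_psi_def algebra_simps sum.distrib)
  also have "\<dots> \<le> real N * (ln (real N) + 4)"
    using ln_fact_le[of N] chebyshev_psi_le[of N] by (simp add: algebra_simps)
  finally show ?thesis using assms by simp
qed

lemma sum_mangoldt_over_ge:
  assumes "N \<ge> 1" shows "(\<Sum>n=1..N. mangoldt n / real n) \<ge> ln (real N) - 1"
proof -
  have "real N * (ln (real N) - 1) \<le> ln (fact N)"
    using ln_fact_ge[of N] by (simp add: algebra_simps)
  also have "\<dots> \<le> (\<Sum>n=1..N. mangoldt n * (real N / real n))"
    unfolding ln_fact_mangoldt
    by (intro sum_mono mult_left_mono mangoldt_nonneg) (rule real_div_bounds(1))
  also have "\<dots> = real N * (\<Sum>n=1..N. mangoldt n / real n)"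
    by (simp add: sum_distrib_left mult_ac)
  finally show ?thesis using assms by simp
qed

text \<open>Only proper prime powers contribute. For fixed \<open>p\<close> the geometric series
  over exponents from 2 on is at most \<open>2 / p^2\<close>, and
  \<open>ln p \<le> 2 * sqrt p\<close> leaves the convergent series with terms
  \<open>4 * p powr (-3/2)\<close>.\<close>

lemma sum_mangoldt_nonprime_bounded:
  "\<exists>C. \<forall>N. (\<Sum>n\<in>{n\<in>{1..N}. \<not> prime n}. mangoldt n / real n) \<le> C"
proof -
  have summ: "summable (\<lambda>n::nat. 4 * real n powr (-3/2))"
    by (intro summable_mult) (subst summable_real_powr_iff, simp)
  show ?thesis
  proof (intro exI allI)
    fix N :: nat
    let ?A = "{n\<in>{1..N}. \<not> prime n \<and> primepow n}"
    let ?B = "{2..N} \<times> {2..N}"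
    have inj: "?A \<subseteq> (\<lambda>(p,k). p ^ k) ` {(p,k). (p,k) \<in> ?B \<and> prime p}"
    proof
      fix n assume n: "n \<in> ?A"
      then obtain p k where pk: "prime p" "k > 0" "n = p ^ k" by (auto simp: primepow_def)
      with n have "k \<noteq> 1" by auto
      have "p \<ge> 2" using pk prime_ge_2_nat by auto
      have "k < 2 ^ k" by (rule less_exp)
      also have "2 ^ k \<le> p ^ k" using \<open>p \<ge> 2\<close> by (intro power_mono) auto
      finally have "k \<le> N" using n pk by auto
      moreover have "p \<le> N" using n pk \<open>p \<ge> 2\<close> self_le_power[of p k] by auto
      ultimately show "n \<in> (\<lambda>(p,k). p ^ k) ` {(p,k). (p,k) \<in> ?B \<and> prime p}"
        using pk \<open>k \<noteq> 1\<close> \<open>p \<ge> 2\<close> by (intro image_eqI[of _ _ "(p,k)"]) auto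
    qed
    have fin: "finite {(p,k). (p,k) \<in> ?B \<and> prime p}"
      by (rule finite_subset[of _ ?B]) auto
    have "(\<Sum>n\<in>{n\<in>{1..N}. \<not> prime n}. mangoldt n / real n) = (\<Sum>n\<in>?A. mangoldt n / real n)"
      by (rule sum.mono_neutral_right) (auto simp: mangoldt_def)
    also have "\<dots> \<le> (\<Sum>n\<in>(\<lambda>(p,k). p ^ k) ` {(p,k). (p,k) \<in> ?B \<and> prime p}. mangoldt n / real n)"
      by (rule sum_mono2) (use inj fin in \<open>auto intro!: divide_nonneg_nonneg mangoldt_nonneg\<close>)
    also have "\<dots> \<le> (\<Sum>(p,k)\<in>{(p,k). (p,k) \<in> ?B \<and> prime p}. mangoldt (p^k) / real (p^k))"
      by (rule order_trans[OF sum_image_le[OF fin]]) (auto simp: case_prod_unfold intro!: divide_nonneg_nonneg mangoldt_nonneg)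
    also have "\<dots> = (\<Sum>(p,k)\<in>{(p,k). (p,k) \<in> ?B \<and> prime p}. ln (real p) / real p ^ k)"
      by (intro sum.cong) auto
    also have "\<dots> \<le> (\<Sum>(p,k)\<in>?B. ln (real p) / real p ^ k)"
      by (rule sum_mono2) auto
    also have "\<dots> = (\<Sum>p=2..N. \<Sum>k=2..N. ln (real p) / real p ^ k)"
      by (simp add: sum.cartesian_product)
    also have "\<dots> \<le> (\<Sum>p=2..N. 4 * real p powr (-3/2))"
    proof (rule sum_mono)
      fix p assume p: "p \<in> {2..N}"
      let ?x = "1 / real p"
      have x: "0 < ?x" "?x \<le> 1/2" using p by (auto simp: field_simps)
      have s: "(\<lambda>k. ?x^2 * ?x ^ k) sums (?x^2 * (1 / (1 - ?x)))"
        using p by (intro sums_mult geometric_sums) auto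
      have "(\<Sum>k=2..N. ?x ^ k) \<le> (\<Sum>k=2..<2+N. ?x ^ k)"
        by (rule sum_mono2) auto
      also have "\<dots> = (\<Sum>k<N. ?x^2 * ?x ^ k)"
      proof (rule sum.reindex_bij_witness[of _ "\<lambda>k. k + 2" "\<lambda>k. k - 2"], goal_cases)
        case (5 a)
        then have "2 + (a - 2) = a" by auto
        then show ?case using power_add[of ?x 2 "a - 2"] by (simp only:)
      qed auto
      also have "\<dots> \<le> ?x^2 * (1 / (1 - ?x))"
        using sum_le_suminf[OF sums_summable[OF s], of "{..<N}"] sums_unique[OF s] x by auto
      also have "\<dots> \<le> ?x^2 * 2" using x by (intro mult_left_mono) (auto simp: field_simps)
      finally have g: "(\<Sum>k=2..N. ?x ^ k) \<le> 2 * ?x^2" by simp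
      have "ln (real p) = 2 * ln (sqrt (real p))" using p by (simp add: ln_sqrt)
      also have "\<dots> \<le> 2 * sqrt (real p)" using ln_le_minus_one[of "sqrt (real p)"] p by simp
      finally have l: "ln (real p) \<le> 2 * sqrt (real p)" .
      have "(\<Sum>k=2..N. ln (real p) / real p ^ k) = ln (real p) * (\<Sum>k=2..N. ?x ^ k)"
        by (simp add: sum_distrib_left power_one_over)
      also have "\<dots> \<le> (2 * sqrt (real p)) * (2 * ?x^2)"
        using l g p by (intro mult_mono) (auto intro!: sum_nonneg)
      also have "\<dots> = 4 * real p powr (-3/2)"
      proof -
        have "real p powr (-3/2) = real p powr (1/2) * real p powr (-2)"
          by (simp flip: powr_add)
        also have "\<dots> = sqrt (real p) * ?x^2"
          using p by (simp add: powr_half_sqrt powr_minus powr_numeral field_simps)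
        finally show ?thesis by simp
      qed
      finally show "(\<Sum>k=2..N. ln (real p) / real p ^ k) \<le> 4 * real p powr (-3/2)" .
    qed
    also have "\<dots> \<le> (\<Sum>n. 4 * real n powr (-3/2))"
      by (rule sum_le_suminf[OF summ]) auto
    finally show "(\<Sum>n\<in>{n\<in>{1..N}. \<not> prime n}. mangoldt n / real n) \<le> (\<Sum>n. 4 * real n powr (-3/2))" .
  qed
qed

section \<open>Dirichlet characters\<close>

text \<open>A character of the unit group modulo \<open>q\<close>, encoded as a function on the
  naturals extended by zero. The last clause fixes the support and at the same time rules out the
  zero function.\<close>

definition dchar :: "nat \<Rightarrow> (nat \<Rightarrow> complex) \<Rightarrow> bool" where
  "dchar q \<xi> \<longleftrightarrow> (\<forall>a b. \<xi> (a * b) = \<xi> a * \<xi> b) \<and> (\<forall>a b. [a = b] (mod q) \<longrightarrow> \<xi> a = \<xi> b) \<and>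
     (\<forall>a. \<xi> a \<noteq> 0 \<longleftrightarrow> coprime a q)"

definition principal_dchar :: "nat \<Rightarrow> nat \<Rightarrow> complex" where
  "principal_dchar q a = (if coprime a q then 1 else 0)"

lemma dchar_mult: "dchar q \<xi> \<Longrightarrow> \<xi> (a * b) = \<xi> a * \<xi> b"
  and dchar_cong: "dchar q \<xi> \<Longrightarrow> [a = b] (mod q) \<Longrightarrow> \<xi> a = \<xi> b"
  and dchar_eq_0_iff: "dchar q \<xi> \<Longrightarrow> \<xi> a = 0 \<longleftrightarrow> \<not> coprime a q"
  by (auto simp: dchar_def)

lemma dchar_1: assumes "dchar q \<xi>" shows "\<xi> 1 = 1"
proof -
  have "\<xi> 1 * \<xi> 1 = \<xi> 1" using dchar_mult[OF assms, of 1 1] by simp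
  moreover have "\<xi> 1 \<noteq> 0" using assms by (simp add: dchar_def)
  ultimately show ?thesis by simp
qed

lemma dchar_power: assumes "dchar q \<xi>" shows "\<xi> (a ^ k) = \<xi> a ^ k"
  by (induction k) (use dchar_1[OF assms] dchar_mult[OF assms] in auto)

lemma dchar_power_totient: assumes "dchar q \<xi>" "coprime a q" shows "\<xi> a ^ totient q = 1"
  using dchar_cong[OF assms(1) euler_theorem[OF assms(2)]] dchar_1[OF assms(1)]
  by (simp add: dchar_power[OF assms(1)])

lemma norm_dchar: assumes "dchar q \<xi>" "coprime a q" "q > 0" shows "norm (\<xi> a) = 1"
proof -
  have "norm (\<xi> a) ^ totient q = 1" using dchar_power_totient[OF assms(1,2)] by (metis norm_one norm_power)
  then show ?thesis using assms(3) by (metis norm_ge_zero power_eq_1_iff totient_gt_0_iff less_irrefl real_norm_def abs_of_nonneg)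
qed

lemma norm_dchar_le: assumes "dchar q \<xi>" "q > 0" shows "norm (\<xi> a) \<le> 1"
proof (cases "coprime a q")
  case True
  then show ?thesis using norm_dchar[OF assms(1) True assms(2)] by simp
next
  case False
  then have "\<xi> a = 0" using dchar_eq_0_iff[OF assms(1)] by blast
  then show ?thesis by simp
qed

lemma dchar_principal: "dchar q (principal_dchar q)"
  unfolding dchar_def principal_dchar_def by (auto simp: cong_imp_coprime dest: cong_imp_coprime cong_sym)

lemma dchar_times: "dchar q \<xi> \<Longrightarrow> dchar q \<psi> \<Longrightarrow> dchar q (\<lambda>a. \<xi> a * \<psi> a)"
  unfolding dchar_def by (auto simp: mult_ac)

lemma dchar_cnj: "dchar q \<xi> \<Longrightarrow> dchar q (\<lambda>a. cnj (\<xi> a))"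
  unfolding dchar_def by auto

lemma dchar_cnj_times: assumes "dchar q \<xi>" "coprime a q" "q > 0" shows "cnj (\<xi> a) * \<xi> a = 1"
  using norm_dchar[OF assms] complex_norm_square[of "\<xi> a"] by (simp add: mult.commute)

text \<open>A character is determined by its values below \<open>q\<close>, and each value is zero
  or a root of unity of order dividing \<open>totient q\<close>.\<close>

lemma finite_dchars: assumes "q > 0" shows "finite {\<xi>. dchar q \<xi>}"
proof -
  let ?R = "insert 0 {z::complex. z ^ totient q = 1}"
  have "finite {z::complex. z ^ totient q = 1}"
    using assms by (intro finite_roots_unity) (simp add: Suc_le_eq totient_gt_0_iff)
  then have "finite (PiE {..<q} (\<lambda>_. ?R))" by (intro finite_PiE) auto
  moreover have "(\<lambda>\<xi>. restrict \<xi> {..<q}) ` {\<xi>. dchar q \<xi>} \<subseteq> PiE {..<q} (\<lambda>_. ?R)"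
  proof
    fix g assume "g \<in> (\<lambda>\<xi>. restrict \<xi> {..<q}) ` {\<xi>. dchar q \<xi>}"
    then obtain \<xi> where \<xi>: "dchar q \<xi>" "g = restrict \<xi> {..<q}" by auto
    have "\<xi> a \<in> ?R" for a
      using dchar_power_totient[OF \<xi>(1), of a] dchar_eq_0_iff[OF \<xi>(1), of a] by auto
    then show "g \<in> PiE {..<q} (\<lambda>_. ?R)" unfolding \<xi>(2) by (subst restrict_PiE_iff) blast
  qed
  moreover have "inj_on (\<lambda>\<xi>. restrict \<xi> {..<q}) {\<xi>. dchar q \<xi>}"
  proof (rule inj_onI, rule ext)
    fix \<xi> \<psi> a assume *: "\<xi> \<in> {\<xi>. dchar q \<xi>}" "\<psi> \<in> {\<xi>. dchar q \<xi>}" "restrict \<xi> {..<q} = restrict \<psi> {..<q}"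
    have "\<xi> (a mod q) = \<psi> (a mod q)" using fun_cong[OF *(3), of "a mod q"] assms by simp
    moreover have "\<xi> a = \<xi> (a mod q)" "\<psi> a = \<psi> (a mod q)" using * by (auto intro!: dchar_cong)
    ultimately show "\<xi> a = \<psi> a" by simp
  qed
  ultimately show ?thesis using finite_imageD finite_subset by blast
qed

section \<open>Existence of characters through simultaneous eigenfunctions of translations\<close>

definition unit_class_function :: "nat \<Rightarrow> (nat \<Rightarrow> complex) \<Rightarrow> bool" where
  "unit_class_function q f \<longleftrightarrow> (\<forall>a b. [a = b] (mod q) \<longrightarrow> f a = f b) \<and> (\<forall>a. f a \<noteq> 0 \<longrightarrow> coprime a q)"

text \<open>For \<open>w ^ m = 1\<close> and \<open>h ^ m\<close> congruent to \<open>1\<close> this is, up to the factor \<open>m\<close>, the projection onto the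
  functions with \<open>f (h * x) = f x / w\<close>. Characters arise as simultaneous eigenfunctions of all translations.\<close>

definition eigen_proj :: "nat \<Rightarrow> nat \<Rightarrow> complex \<Rightarrow> (nat \<Rightarrow> complex) \<Rightarrow> nat \<Rightarrow> complex" where
  "eigen_proj m h w f x = (\<Sum>k<m. w ^ k * f (h ^ k * x))"

lemma eigen_proj_class:
  assumes "unit_class_function q f" shows "unit_class_function q (eigen_proj m h w f)"
  unfolding unit_class_function_def
proof (intro conjI allI impI)
  fix a b assume "[a = b] (mod q)"
  then have "f (h ^ k * a) = f (h ^ k * b)" for k
    using assms unfolding unit_class_function_def by (blast intro: cong_mult cong_refl)
  then show "eigen_proj m h w f a = eigen_proj m h w f b" by (simp add: eigen_proj_def)
next
  fix a assume "eigen_proj m h w f a \<noteq> 0"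
  then obtain k where "f (h ^ k * a) \<noteq> 0" unfolding eigen_proj_def by (elim sum.not_neutral_contains_not_neutral) auto
  then show "coprime a q" using assms unfolding unit_class_function_def by (metis coprime_mult_left_iff)
qed

text \<open>Translating by \<open>h\<close> and multiplying by \<open>w\<close> shifts the summation
  index by one, and the sum is cyclic because its term at \<open>m\<close> equals its term at
  0.\<close>

lemma eigen_proj_eigen:
  assumes "unit_class_function q f" "[h ^ m = 1] (mod q)" "w ^ m = 1"
  shows "w * eigen_proj m h w f (h * x) = eigen_proj m h w f x"
proof -
  let ?u = "\<lambda>k. w ^ k * f (h ^ k * x)"
  have "f (h ^ m * x) = f (1 * x)"
    using assms(1,2) unfolding unit_class_function_def by (blast intro: cong_mult cong_refl)
  then have um: "?u m = ?u 0" using assms(3) by simp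
  have "w * eigen_proj m h w f (h * x) = (\<Sum>k<m. ?u (Suc k))"
    unfolding eigen_proj_def sum_distrib_left by (intro sum.cong) (auto simp: mult_ac)
  also have "\<dots> = (\<Sum>k<m. ?u k)"
    using sum.lessThan_Suc_shift[of ?u m] um by simp
  finally show ?thesis by (simp add: eigen_proj_def)
qed

text \<open>Summed over all \<open>m\<close>-th roots of unity, the coefficient of each term with
  \<open>k \<noteq> 0\<close> is a vanishing geometric sum. Consequently, where \<open>f\<close> is
  nonzero some projection of it is nonzero.\<close>

lemma eigen_proj_decompose:
  assumes "m > 0"
  defines "w \<equiv> (\<lambda>j. exp (2 * of_real pi * \<i> * of_nat j / of_nat m) :: complex)"
  shows "(\<Sum>j<m. eigen_proj m h (w j) f x) = of_nat m * f x"
proof -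
  have wp: "w j ^ k = w k ^ j" for j k
    unfolding w_def by (simp flip: exp_of_nat_mult add: mult_ac)
  have "(\<Sum>j<m. eigen_proj m h (w j) f x) = (\<Sum>k<m. (\<Sum>j<m. w k ^ j) * f (h ^ k * x))"
    unfolding eigen_proj_def by (subst sum.swap) (simp add: sum_distrib_right wp)
  also have "\<dots> = (\<Sum>k\<in>{0}. (\<Sum>j<m. w k ^ j) * f (h ^ k * x))"
  proof (rule sum.mono_neutral_right)
    show "\<forall>k\<in>{..<m} - {0}. (\<Sum>j<m. w k ^ j) * f (h ^ k * x) = 0"
    proof
      fix k assume k: "k \<in> {..<m} - {0}"
      then have "\<not> m dvd k" by (auto dest: dvd_imp_le)
      then have "w k \<noteq> 1" unfolding w_def using complex_root_unity_eq_1[of m k] assms(1) by simp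
      moreover have "w k ^ m = 1" unfolding w_def using complex_root_unity[of m k] assms(1) by simp
      ultimately show "(\<Sum>j<m. w k ^ j) * f (h ^ k * x) = 0"
        using geometric_sum[of "w k" m] by simp
    qed
  qed (use assms in auto)
  also have "\<dots> = of_nat m * f x" by (simp add: w_def)
  finally show ?thesis .
qed

text \<open>One translation is treated at a time: some projection of the current function is
  nonzero, and since translations commute it keeps every eigenvalue obtained before. The last clause
  carries along eigenvalues that were already prescribed for \<open>f0\<close>.\<close>

lemma simultaneous_eigenfunction:
  assumes "q > 0" "finite H" "\<forall>h\<in>H. coprime h q" "unit_class_function q f0" "f0 a0 \<noteq> 0"
  shows "\<exists>f. unit_class_function q f \<and> (\<exists>a. f a \<noteq> 0) \<and> (\<forall>h\<in>H. \<exists>l. \<forall>x. f (h * x) = l * f x) \<and>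
    (\<forall>g l. (\<forall>x. f0 (g * x) = l * f0 x) \<longrightarrow> (\<forall>x. f (g * x) = l * f x))"
  using assms(2,3)
proof (induction H rule: finite_induct)
  case empty
  show ?case using assms(4,5) by (intro exI[of _ f0]) auto
next
  case (insert h H)
  then obtain f where f: "unit_class_function q f" "\<exists>a. f a \<noteq> 0" "\<forall>h\<in>H. \<exists>l. \<forall>x. f (h * x) = l * f x"
    "\<forall>g l. (\<forall>x. f0 (g * x) = l * f0 x) \<longrightarrow> (\<forall>x. f (g * x) = l * f x)" by auto
  obtain a where a: "f a \<noteq> 0" using f(2) by auto
  define m where "m = totient q"
  have m: "m > 0" using assms(1) by (simp add: m_def totient_gt_0_iff)
  have hm: "[h ^ m = 1] (mod q)" unfolding m_def using insert by (intro euler_theorem) auto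
  define w where "w j = (exp (2 * of_real pi * \<i> * of_nat j / of_nat m) :: complex)" for j
  have "(\<Sum>j<m. eigen_proj m h (w j) f a) \<noteq> 0"
    using eigen_proj_decompose[OF m, of h f a] a m by (simp add: w_def)
  then obtain j where j: "eigen_proj m h (w j) f a \<noteq> 0" by (meson sum.neutral)
  have wj: "w j ^ m = 1" unfolding w_def using complex_root_unity[of m j] m by simp
  then have w0: "w j \<noteq> 0" using m by (metis power_0_left zero_neq_one less_irrefl)
  let ?f = "eigen_proj m h (w j) f"
  have keep: "\<forall>x. ?f (g * x) = l * ?f x" if "\<forall>x. f (g * x) = l * f x" for g l
  proof
    fix x
    have "f (h ^ k * (g * x)) = l * f (h ^ k * x)" for k
      using that by (metis mult.left_commute)
    then show "?f (g * x) = l * ?f x"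
      unfolding eigen_proj_def by (simp add: sum_distrib_left mult_ac)
  qed
  have "\<forall>x. ?f (h * x) = inverse (w j) * ?f x"
    using eigen_proj_eigen[OF f(1) hm wj] w0 by (simp add: field_simps)
  then show ?case
    using eigen_proj_class[OF f(1)] j keep f(3,4) by (intro exI[of _ ?f]) (metis insert_iff)
qed

text \<open>The indicator of the class of 1 is first projected so that translation by
  \<open>g\<close> has eigenvalue \<open>inverse w\<close>, where \<open>w\<close> is a primitive
  root of unity of order \<open>ord q g\<close>. A simultaneous eigenfunction refining it, divided
  by its value at 1, is multiplicative and takes the value \<open>inverse w \<noteq> 1\<close> at
  \<open>g\<close>.\<close>

lemma dchar_separates:
  assumes "q > 0" "coprime g q" "\<not> [g = 1] (mod q)"
  shows "\<exists>\<xi>. dchar q \<xi> \<and> \<xi> g \<noteq> 1"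
proof -
  define m where "m = ord q g"
  have "ord q g \<noteq> 0" using assms(2) ord_eq_0[of q g] by (auto simp: coprime_commute)
  then have m0: "m > 0" unfolding m_def by simp
  have m1: "m \<noteq> 1" unfolding m_def using assms ord[of g q] by fastforce
  have gm: "[g ^ m = 1] (mod q)" unfolding m_def by (rule ord)
  define w where "w = (exp (2 * of_real pi * \<i> * of_nat 1 / of_nat m) :: complex)"
  have wm: "w ^ m = 1" unfolding w_def using complex_root_unity[of m 1] m0 by simp
  have w1: "w \<noteq> 1" unfolding w_def using complex_root_unity_eq_1[of m 1] m0 m1 by simp
  have w0: "w \<noteq> 0" unfolding w_def by simp
  define e where "e x = (if [x = 1] (mod q) then 1 else 0 :: complex)" for x
  have e: "unit_class_function q e"
    unfolding unit_class_function_def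
  proof (intro conjI allI impI)
    fix a b assume "[a = b] (mod q)"
    then have "[a = 1] (mod q) \<longleftrightarrow> [b = 1] (mod q)" by (blast intro: cong_trans cong_sym)
    then show "e a = e b" by (simp only: e_def)
  next
    fix a assume "e a \<noteq> 0"
    then have "[1 = a] (mod q)" by (auto simp: e_def cong_sym split: if_splits)
    then show "coprime a q" by (rule cong_imp_coprime) simp
  qed
  let ?f0 = "eigen_proj m g w e"
  \<comment> \<open>Minimality of the order leaves only the term \<open>k = 0\<close> at the point
    1, so the projection is not the zero function.\<close>
  have "e (g ^ k) = 0" if "k \<in> {..<m} - {0}" for k
    using that ord_minimal[of k q g] unfolding e_def m_def by auto
  then have "?f0 1 = (\<Sum>k\<in>{0}. w ^ k * e (g ^ k * 1))"
    unfolding eigen_proj_def using m0 by (intro sum.mono_neutral_right) auto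
  then have f01: "?f0 1 \<noteq> 0" by (simp add: e_def)
  have f0g: "\<forall>x. ?f0 (g * x) = inverse w * ?f0 x"
    using eigen_proj_eigen[OF e gm wm] w0 by (simp add: field_simps)
  obtain f a where f: "unit_class_function q f" "f a \<noteq> 0"
    "\<forall>h\<in>{h. h < q \<and> coprime h q}. \<exists>l. \<forall>x. f (h * x) = l * f x" "\<forall>x. f (g * x) = inverse w * f x"
  proof -
    have "finite {h. h < q \<and> coprime h q}" "\<forall>h\<in>{h. h < q \<and> coprime h q}. coprime h q" by auto
    from simultaneous_eigenfunction[where H="{h. h < q \<and> coprime h q}", OF assms(1) this eigen_proj_class[OF e] f01]
    obtain f where F: "unit_class_function q f" "\<exists>a. f a \<noteq> 0"
      "\<forall>h\<in>{h. h < q \<and> coprime h q}. \<exists>l. \<forall>x. f (h * x) = l * f x"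
      "\<forall>h l. (\<forall>x. ?f0 (h * x) = l * ?f0 x) \<longrightarrow> (\<forall>x. f (h * x) = l * f x)"
      by (elim exE conjE) (rule that, assumption, rule exI, assumption+)
    from F(2) obtain a where "f a \<noteq> 0" ..
    moreover have "\<forall>x. f (g * x) = inverse w * f x" 
      using F(4)[THEN spec[of _ g], THEN spec[of _ "inverse w"]] f0g by (rule mp)
    ultimately show ?thesis using F(1,3) that by simp
  qed
  have fc: "f x = f y" if "[x = y] (mod q)" for x y using f(1) that unfolding unit_class_function_def by blast
  have eig: "\<exists>l. \<forall>x. f (h * x) = l * f x" if h: "coprime h q" for h
  proof -
    have "h mod q \<in> {h. h < q \<and> coprime h q}" using h assms(1) by simp
    then obtain l where l: "\<forall>x. f ((h mod q) * x) = l * f x" using f(3) by blast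
    have "f (h * x) = f ((h mod q) * x)" for x
      by (rule fc) (simp add: unique_euclidean_semiring_class.cong_def mod_simps)
    then show ?thesis using l by auto
  qed
  \<comment> \<open>The point \<open>a\<close> where \<open>f\<close> is nonzero is a unit, and
    \<open>f a\<close> is a multiple of \<open>f 1\<close>; hence dividing by \<open>f 1\<close> is
    legitimate.\<close>
  have ca: "coprime a q" using f(1,2) unfolding unit_class_function_def by blast
  have f1: "f 1 \<noteq> 0" using eig[OF ca] f(2) by (metis mult.right_neutral mult_zero_right)
  define \<xi> where "\<xi> x = f x / f 1" for x
  have mult: "\<xi> (x * y) = \<xi> x * \<xi> y" for x y
  proof (cases "coprime x q")
    case True
    then obtain l where l: "\<forall>x'. f (x * x') = l * f x'" using eig by blast
    then have "f (x * y) = l * f y" "f (x * 1) = l * f 1" by blast+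
    then show ?thesis using f1 by (simp add: \<xi>_def)
  next
    case False
    then have "f x = 0" "f (x * y) = 0" using f(1) unfolding unit_class_function_def by auto
    then show ?thesis by (simp add: \<xi>_def)
  qed
  have nz: "\<xi> x \<noteq> 0" if x: "coprime x q" for x
  proof -
    obtain y where "[x * y = 1] (mod q)" using cong_solve_coprime_nat[OF x] by auto
    then have "\<xi> (x * y) = \<xi> 1" unfolding \<xi>_def by (simp only: fc)
    then have "\<xi> x * \<xi> y = 1" using mult f1 by (simp add: \<xi>_def)
    then show ?thesis by auto
  qed
  have "dchar q \<xi>"
    unfolding dchar_def using mult nz fc f(1) by (auto simp: \<xi>_def unit_class_function_def)
  moreover have "\<xi> g = inverse w" using f(4) f1 by (metis \<xi>_def mult.right_neutral nonzero_mult_div_cancel_right)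
  ultimately show ?thesis using w1 by (metis inverse_1 inverse_inverse_eq)
qed

section \<open>Orthogonality relations\<close>

lemma sum_dchars_eq_0:
  assumes "q > 0" "coprime a q" "\<not> [a = 1] (mod q)"
  shows "(\<Sum>\<xi> | dchar q \<xi>. \<xi> a) = 0"
proof -
  obtain \<psi> where \<psi>: "dchar q \<psi>" "\<psi> a \<noteq> 1" using dchar_separates[OF assms] by blast
  have inv: "(\<lambda>x. cnj (\<psi> x) * (\<psi> x * \<xi> x)) = \<xi>" "(\<lambda>x. \<psi> x * (cnj (\<psi> x) * \<xi> x)) = \<xi>" if "dchar q \<xi>" for \<xi>
  proof -
    have "cnj (\<psi> x) * (\<psi> x * \<xi> x) = \<xi> x" for x
    proof (cases "coprime x q")
      case True then show ?thesis using dchar_cnj_times[OF \<psi>(1) True assms(1)] by (simp flip: mult.assoc)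
    next
      case False then have "\<xi> x = 0" using dchar_eq_0_iff[OF that] by blast
      then show ?thesis by simp
    qed
    then show "(\<lambda>x. cnj (\<psi> x) * (\<psi> x * \<xi> x)) = \<xi>" "(\<lambda>x. \<psi> x * (cnj (\<psi> x) * \<xi> x)) = \<xi>"
      by (auto simp: mult.left_commute)
  qed
  have ab: "\<psi> a * cnj (\<psi> a) = 1" using dchar_cnj_times[OF \<psi>(1) assms(2,1)] by (simp add: mult.commute)
  \<comment> \<open>Multiplication by the separating character \<open>\<psi>\<close> permutes the
    characters, with multiplication by its conjugate as inverse, and scales the sum by
    \<open>\<psi> a \<noteq> 1\<close>.\<close>
  have "(\<Sum>\<xi> | dchar q \<xi>. \<xi> a) = (\<Sum>\<xi> | dchar q \<xi>. \<psi> a * \<xi> a)"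
    by (rule sum.reindex_bij_witness[where i="\<lambda>\<xi> x. \<psi> x * \<xi> x" and j="\<lambda>\<xi> x. cnj (\<psi> x) * \<xi> x"])
       (use inv ab in \<open>auto simp: dchar_times dchar_cnj \<psi>(1) simp flip: mult.assoc\<close>)
  also have "\<dots> = \<psi> a * (\<Sum>\<xi> | dchar q \<xi>. \<xi> a)" by (simp add: sum_distrib_left)
  finally show ?thesis using \<psi>(2) by simp
qed

lemma sum_dchar_period:
  assumes "dchar q \<xi>" "q > 0" "\<xi> \<noteq> principal_dchar q"
  shows "(\<Sum>a<q. \<xi> a) = 0"
proof -
  obtain b where b: "\<xi> b \<noteq> principal_dchar q b" using assms(3) by auto
  then have cb: "coprime b q" using dchar_eq_0_iff[OF assms(1), of b] unfolding principal_dchar_def by auto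
  with b have b1: "\<xi> b \<noteq> 1" unfolding principal_dchar_def by auto
  obtain c where c: "[b * c = 1] (mod q)" using cong_solve_coprime_nat[OF cb] by auto
  have c': "[c * b = 1] (mod q)" using c by (simp add: mult.commute)
  have mm: "x * (y * a mod q) mod q = a" if "[x * y = 1] (mod q)" "a < q" for x y a
  proof -
    have "x * (y * a mod q) mod q = (x * y) * a mod q" by (simp add: mod_mult_right_eq mult.assoc)
    also have "\<dots> = 1 * a mod q" using cong_scalar_right[OF that(1), of a] by (simp add: unique_euclidean_semiring_class.cong_def)
    finally show ?thesis using that(2) by simp
  qed
  have "(\<Sum>a<q. \<xi> a) = (\<Sum>a<q. \<xi> (b * a))"
  proof (rule sum.reindex_bij_witness[where i="\<lambda>a. b * a mod q" and j="\<lambda>a. c * a mod q"], goal_cases)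
    case (5 a)
    have "[b * (c * a mod q) = a] (mod q)" using mm[OF c, of a] 5 by (simp add: unique_euclidean_semiring_class.cong_def)
    then show ?case by (rule dchar_cong[OF assms(1)])
  qed (use mm[OF c] mm[OF c'] assms(2) in auto)
  also have "\<dots> = \<xi> b * (\<Sum>a<q. \<xi> a)" by (simp add: sum_distrib_left dchar_mult[OF assms(1)])
  finally show ?thesis using b1 by simp
qed

lemma sum_principal_dchar: assumes "q > 0" shows "(\<Sum>a<q. principal_dchar q a) = of_nat (totient q)"
proof -
  have "(\<Sum>a<q. principal_dchar q a) = (\<Sum>a=1..q. principal_dchar q a)"
  proof -
    obtain r where r: "q = Suc r" using assms by (cases q) auto
    have "principal_dchar q 0 = principal_dchar q q" by (auto simp: principal_dchar_def)
    moreover have "(\<Sum>a<Suc r. principal_dchar q a) = principal_dchar q 0 + (\<Sum>a<r. principal_dchar q (Suc a))"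
      by (rule sum.lessThan_Suc_shift)
    moreover have "(\<Sum>a=1..Suc r. principal_dchar q a) = (\<Sum>a<r. principal_dchar q (Suc a)) + principal_dchar q (Suc r)"
      by (simp only: One_nat_def sum.atLeast_Suc_atMost_Suc_shift atMost_atLeast0[symmetric] comp_def)
         (simp add: lessThan_Suc_atMost[symmetric])
    ultimately show ?thesis using r by simp
  qed
  also have "\<dots> = (\<Sum>a\<in>totatives q. 1)"
    by (rule sum.mono_neutral_cong_right) (auto simp: totatives_def principal_dchar_def)
  finally show ?thesis by (simp add: totient_def)
qed

text \<open>Double counting: summing all characters over all residues leaves the class of 1 when
  residues are taken first, and the principal character when characters are taken first.\<close>

lemma card_dchars: assumes "q > 0" shows "card {\<xi>. dchar q \<xi>} = totient q"
proof -
  \<comment> \<open>The class is written \<open>1 mod q\<close> because for \<open>q = 1\<close> the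
    only residue below \<open>q\<close> is 0.\<close>
  have "(\<Sum>a<q. \<Sum>\<xi> | dchar q \<xi>. \<xi> a) = (\<Sum>a\<in>{1 mod q}. \<Sum>\<xi> | dchar q \<xi>. \<xi> a)"
  proof (rule sum.mono_neutral_right)
    show "\<forall>a\<in>{..<q} - {1 mod q}. (\<Sum>\<xi> | dchar q \<xi>. \<xi> a) = 0"
    proof
      fix a assume a: "a \<in> {..<q} - {1 mod q}"
      show "(\<Sum>\<xi> | dchar q \<xi>. \<xi> a) = 0"
      proof (cases "coprime a q")
        case True
        have "\<not> [a = 1] (mod q)" using a by (auto simp: unique_euclidean_semiring_class.cong_def simp del: One_nat_def)
        then show ?thesis using True by (intro sum_dchars_eq_0 assms)
      next
        case False then show ?thesis using dchar_eq_0_iff by (intro sum.neutral) auto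
      qed
    qed
  qed (use assms in auto)
  also have "\<dots> = (\<Sum>\<xi> | dchar q \<xi>. 1)"
  proof -
    have "\<xi> (1 mod q) = 1" if "dchar q \<xi>" for \<xi>
      using dchar_cong[OF that, of "1 mod q" 1] dchar_1[OF that]
      by (simp add: unique_euclidean_semiring_class.cong_def del: mod_less One_nat_def)
    then have "(\<Sum>\<xi> | dchar q \<xi>. \<xi> (1 mod q)) = (\<Sum>\<xi> | dchar q \<xi>. 1)"
      by (intro sum.cong refl) (simp only: mem_Collect_eq)
    then show ?thesis by (simp only: sum.insert finite.emptyI empty_iff not_False_eq_True sum.empty add_0_right)
  qed
  also have "\<dots> = of_nat (card {\<xi>. dchar q \<xi>})" by simp
  finally have 1: "(\<Sum>a<q. \<Sum>\<xi> | dchar q \<xi>. \<xi> a) = of_nat (card {\<xi>. dchar q \<xi>})" .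
  have "(\<Sum>a<q. \<Sum>\<xi> | dchar q \<xi>. \<xi> a) = (\<Sum>\<xi> | dchar q \<xi>. \<Sum>a<q. \<xi> a)" by (rule sum.swap)
  also have "\<dots> = (\<Sum>\<xi>\<in>{principal_dchar q}. \<Sum>a<q. \<xi> a)"
    using finite_dchars[OF assms] dchar_principal sum_dchar_period[OF _ assms]
    by (intro sum.mono_neutral_right) auto
  also have "\<dots> = of_nat (totient q)" using sum_principal_dchar[OF assms] by simp
  finally show ?thesis using 1 by (metis of_nat_eq_iff)
qed

lemma sum_dchars_cnj:
  assumes "q > 0" "coprime b q"
  shows "(\<Sum>\<xi> | dchar q \<xi>. cnj (\<xi> b) * \<xi> a) = (if [a = b] (mod q) then of_nat (totient q) else 0)"
proof -
  obtain c where c: "[b * c = 1] (mod q)" using cong_solve_coprime_nat[OF assms(2)] by auto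
  have cc: "coprime c q" using c by (metis cong_imp_coprime cong_sym coprime_1_left coprime_mult_left_iff)
  have cn: "cnj (\<xi> b) = \<xi> c" if x: "dchar q \<xi>" for \<xi>
  proof -
    have "\<xi> b * \<xi> c = 1" using dchar_cong[OF x c] dchar_1[OF x] dchar_mult[OF x] by simp
    moreover have "cnj (\<xi> b) * \<xi> b = 1" using dchar_cnj_times[OF x assms(2,1)] .
    ultimately show ?thesis by (metis mult.assoc mult.left_neutral mult.right_neutral)
  qed
  have "(\<Sum>\<xi> | dchar q \<xi>. cnj (\<xi> b) * \<xi> a) = (\<Sum>\<xi> | dchar q \<xi>. \<xi> (c * a))"
    by (intro sum.cong refl) (auto simp: cn dchar_mult)
  also have "\<dots> = (if [a = b] (mod q) then of_nat (totient q) else 0)"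
  proof (cases "[a = b] (mod q)")
    case True
    then have "[c * a = c * b] (mod q)" by (intro cong_mult cong_refl)
    with c have *: "[c * a = 1] (mod q)" by (metis cong_trans mult.commute)
    have "(\<Sum>\<xi> | dchar q \<xi>. \<xi> (c * a)) = (\<Sum>\<xi> | dchar q \<xi>. 1)"
    proof (intro sum.cong refl)
      fix \<xi> assume "\<xi> \<in> {\<xi>. dchar q \<xi>}"
      then have "dchar q \<xi>" by simp
      from dchar_cong[OF this *] dchar_1[OF this] show "\<xi> (c * a) = 1" by simp
    qed
    then show ?thesis using True card_dchars[OF assms(1)] by simp
  next
    case False
    show ?thesis
    proof (cases "coprime a q")
      case True
      have "\<not> [c * a = 1] (mod q)"
      proof
        assume "[c * a = 1] (mod q)"
        then have "[b * (c * a) = b * 1] (mod q)" by (intro cong_mult cong_refl)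
        moreover have "[(b * c) * a = 1 * a] (mod q)" using c by (intro cong_mult cong_refl)
        ultimately have "[a = b] (mod q)" by (metis cong_sym cong_trans mult.assoc mult.left_neutral mult.right_neutral)
        with False show False ..
      qed
      then show ?thesis using False sum_dchars_eq_0[OF assms(1), of "c * a"] cc True by simp
    next
      case nc: False
      then have "(\<Sum>\<xi> | dchar q \<xi>. \<xi> (c * a)) = 0"
        using dchar_eq_0_iff by (intro sum.neutral) auto
      then show ?thesis using False by simp
    qed
  qed
  finally show ?thesis .
qed

section \<open>Mertens' theorem in arithmetic progressions\<close>

text \<open>Complete periods cancel, so at most \<open>q\<close> terms of norm at most 1
  remain.\<close>

lemma norm_sum_dchar_le:
  assumes "dchar q \<xi>" "q > 0" "\<xi> \<noteq> principal_dchar q"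
  shows "norm (\<Sum>n<N. \<xi> n) \<le> real q"
proof (induction N rule: less_induct)
  case (less N)
  show ?case
  proof (cases "N < q")
    case True
    have "norm (\<Sum>n<N. \<xi> n) \<le> (\<Sum>n<N. 1)"
      by (intro sum_norm_le norm_dchar_le[OF assms(1,2)])
    then show ?thesis using True by simp
  next
    case False
    have "(\<Sum>n<N. \<xi> n) = (\<Sum>n<q. \<xi> n) + (\<Sum>n=q..<N. \<xi> n)"
      using False sum.atLeastLessThan_concat[of 0 q N \<xi>] by (simp add: atLeast0LessThan)
    also have "(\<Sum>n<q. \<xi> n) = 0" by (rule sum_dchar_period[OF assms])
    also have "(\<Sum>n=q..<N. \<xi> n) = (\<Sum>n<N-q. \<xi> (n + q))"
      using False sum.shift_bounds_nat_ivl[of \<xi> 0 q "N - q"] by (simp add: atLeast0LessThan)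
    also have "\<dots> = (\<Sum>n<N-q. \<xi> n)"
      by (intro sum.cong refl dchar_cong[OF assms(1)]) (simp add: unique_euclidean_semiring_class.cong_def)
    finally show ?thesis using less[of "N - q"] False assms(2) by simp
  qed
qed

text \<open>Abel summation. Partial sums starting at \<open>a\<close> are differences of two initial
  sums, which is the source of the factor 2; the differences of the decreasing weights
  telescope.\<close>

lemma norm_abel_sum_le:
  fixes f :: "nat \<Rightarrow> complex" and c :: "nat \<Rightarrow> real"
  assumes D: "\<And>N. norm (\<Sum>n<N. f n) \<le> D"
    and dec: "\<And>n. a \<le> n \<Longrightarrow> c (Suc n) \<le> c n" and nn: "\<And>n. a \<le> n \<Longrightarrow> 0 \<le> c n" and "a \<le> b"
  shows "norm (\<Sum>n=a..<b. of_real (c n) * f n) \<le> 2 * D * c a"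
proof -
  define F where "F n = (\<Sum>k<n. f k) - (\<Sum>k<a. f k)" for n
  have F: "norm (F n) \<le> 2 * D" for n
    unfolding F_def using norm_triangle_ineq4[of "\<Sum>k<n. f k" "\<Sum>k<a. f k"] D[of n] D[of a] by linarith
  have id: "(\<Sum>n=a..<b. of_real (c n) * f n) = of_real (c b) * F b + (\<Sum>n=a..<b. of_real (c n - c (Suc n)) * F (Suc n))"
    using \<open>a \<le> b\<close>
  proof (induction b rule: dec_induct)
    case base then show ?case by (simp add: F_def)
  next
    case (step n)
    then show ?case by (simp add: F_def algebra_simps)
  qed
  have "norm (\<Sum>n=a..<b. of_real (c n - c (Suc n)) * F (Suc n)) \<le> (\<Sum>n=a..<b. (c n - c (Suc n)) * (2 * D))"
    by (intro sum_norm_le) (use dec F in \<open>auto simp: norm_mult simp del: of_real_diff intro!: mult_mono\<close>)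
  also have "\<dots> = (c a - c b) * (2 * D)"
    using sum_Suc_diff'[of a b "\<lambda>n. - c n"] \<open>a \<le> b\<close> by (simp flip: sum_distrib_right)
  finally have "norm (\<Sum>n=a..<b. of_real (c n) * f n) \<le> norm (of_real (c b) * F b) + (c a - c b) * (2 * D)"
    unfolding id by (intro norm_triangle_mono order_refl)
  also have "norm (of_real (c b) * F b) \<le> c b * (2 * D)"
    using nn[OF \<open>a \<le> b\<close>] F[of b] by (auto simp: norm_mult intro!: mult_left_mono)
  finally show ?thesis by (simp add: algebra_simps)
qed

text \<open>Abel summation with weights \<open>1 / n\<close> gives Cauchy differences with an
  explicit rate, and the rate survives in the limit. The rate is essential later, where these tails
  are summed against \<open>mangoldt\<close>.\<close>

lemma L_one_exists:
  assumes "dchar q \<xi>" "q > 0" "\<xi> \<noteq> principal_dchar q"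
  shows "\<exists>L. \<forall>x. norm ((\<Sum>n=1..x. \<xi> n / of_nat n) - L) \<le> 2 * real q / (real x + 1)"
proof -
  define S where "S x = (\<Sum>n=1..x. \<xi> n / of_nat n)" for x
  have diff: "norm (S y - S x) \<le> 2 * real q / (real x + 1)" if "x \<le> y" for x y
  proof -
    have "S y - S x = (\<Sum>n=Suc x..<Suc y. of_real (1 / real n) * \<xi> n)"
      using that unfolding S_def
      by (induction y rule: dec_induct) (auto simp: field_simps)
    also have "norm \<dots> \<le> 2 * real q * (1 / real (Suc x))"
      by (rule norm_abel_sum_le[OF norm_sum_dchar_le[OF assms]]) (use that in \<open>auto simp: field_simps\<close>)
    finally show ?thesis by (simp add: add.commute)
  qed
  have "Cauchy S"
  proof (rule metric_CauchyI)
    fix e :: real assume e: "e > 0"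
    obtain M where M: "real M > 4 * real q / e" using reals_Archimedean2 by blast
    have small: "norm (S y - S x) < e" if "M \<le> x" "x \<le> y" for x y
    proof -
      have "2 * real q < e * (real x + 1)"
      proof -
        have "4 * real q < e * real M" using M e by (simp add: field_simps)
        also have "\<dots> \<le> e * (real x + 1)" using that e by (intro mult_left_mono) auto
        finally show ?thesis by linarith
      qed
      then have "2 * real q / (real x + 1) < e" by (simp add: divide_less_eq)
      with diff[OF that(2)] show ?thesis by simp
    qed
    show "\<exists>M. \<forall>m\<ge>M. \<forall>n\<ge>M. dist (S m) (S n) < e"
    proof (intro exI allI impI)
      fix m n assume "M \<le> m" "M \<le> n"
      then show "dist (S m) (S n) < e"
        using small[of m n] small[of n m] by (cases "m \<le> n") (auto simp: dist_norm norm_minus_commute)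
    qed
  qed
  then obtain L where L: "S \<longlonglongrightarrow> L" using Cauchy_convergent_iff convergent_def by blast
  have "norm (S x - L) \<le> 2 * real q / (real x + 1)" for x
  proof (rule tendsto_upperbound)
    show "(\<lambda>y. norm (S x - S y)) \<longlonglongrightarrow> norm (S x - L)" by (intro tendsto_intros L)
    show "\<forall>\<^sub>F y in sequentially. norm (S x - S y) \<le> 2 * real q / (real x + 1)"
      using eventually_ge_at_top[of x] by eventually_elim (use diff[of x] in \<open>simp add: norm_minus_commute[of "S x"]\<close>)
  qed auto
  then show ?thesis unfolding S_def by blast
qed

text \<open>Meaningful for nonprincipal characters, where the tail bound determines the limit.\<close>

definition L_one :: "nat \<Rightarrow> (nat \<Rightarrow> complex) \<Rightarrow> complex" where
  "L_one q \<xi> = (SOME L. \<forall>x. norm ((\<Sum>n=1..x. \<xi> n / of_nat n) - L) \<le> 2 * real q / (real x + 1))"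

lemma L_one_tail:
  assumes "dchar q \<xi>" "q > 0" "\<xi> \<noteq> principal_dchar q"
  shows "norm ((\<Sum>n=1..x. \<xi> n / of_nat n) - L_one q \<xi>) \<le> 2 * real q / (real x + 1)"
  using someI_ex[OF L_one_exists[OF assms]] unfolding L_one_def by blast

lemma L_one_tail_div:
  assumes "dchar q \<xi>" "q > 0" "\<xi> \<noteq> principal_dchar q" "m > 0" "N > 0"
  shows "norm ((\<Sum>n=1..N div m. \<xi> n / of_nat n) - L_one q \<xi>) \<le> 2 * real q * real m / real N"
proof -
  have "real N / real m \<le> real (N div m) + 1" using real_div_bounds(2)[of N m] by simp
  then have "2 * real q / (real (N div m) + 1) \<le> 2 * real q / (real N / real m)"
    using assms by (intro divide_left_mono) auto
  from order_trans[OF L_one_tail[OF assms(1-3)] this] show ?thesis by simp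
qed

lemma L_one_lim:
  assumes "dchar q \<xi>" "q > 0" "\<xi> \<noteq> principal_dchar q"
  shows "(\<lambda>x. \<Sum>n=1..x. \<xi> n / of_nat n) \<longlonglongrightarrow> L_one q \<xi>"
proof (rule LIM_zero_cancel, rule Lim_null_comparison)
  show "\<forall>\<^sub>F x in sequentially. norm ((\<Sum>n=1..x. \<xi> n / of_nat n) - L_one q \<xi>) \<le> 2 * real q / (real x + 1)"
    using L_one_tail[OF assms] by auto
  show "(\<lambda>x. 2 * real q / (real x + 1)) \<longlonglongrightarrow> 0" by real_asymp
qed

definition mangoldt_dchar_sum :: "(nat \<Rightarrow> complex) \<Rightarrow> nat \<Rightarrow> complex" where
  "mangoldt_dchar_sum \<xi> N = (\<Sum>n=1..N. \<xi> n * mangoldt n / of_nat n)"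

text \<open>The function ln x / x decreases only beyond e, hence the start at 3; sums with this
  weight split off the terms 1 and 2.\<close>

lemma ln_over_antimono:
  assumes "n \<ge> 3" shows "ln (real (Suc n)) / real (Suc n) \<le> ln (real n) / real n"
proof -
  have n: "real n \<ge> 3" using assms by simp
  have e: "real n * (1 + 1 / real n) = real (Suc n)" using n by (simp add: field_simps)
  have "ln (real n * (1 + 1 / real n)) = ln (real n) + ln (1 + 1 / real n)"
    by (rule ln_mult_pos) (use n in \<open>auto intro: add_pos_pos\<close>)
  then have "ln (real (Suc n)) = ln (real n) + ln (1 + 1 / real n)" unfolding e .
  moreover have "ln (1 + 1 / real n) \<le> 1 / real n"
    using n ln_add_one_self_le_self[of "1 / real n"] by simp
  ultimately have "real n * ln (real (Suc n)) \<le> real n * (ln (real n) + 1 / real n)"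
    using n by (intro mult_left_mono) auto
  moreover have "1 \<le> ln (real n)" using n exp_le ln_ge_iff[of "real n" 1] by linarith
  moreover have "real n * (ln (real n) + 1 / real n) = real n * ln (real n) + 1"
    using n by (simp add: distrib_left)
  ultimately have le: "real n * ln (real (Suc n)) \<le> real (Suc n) * ln (real n)"
    by (simp add: algebra_simps)
  have "ln (real (Suc n)) / real (Suc n) = (real n * ln (real (Suc n))) / (real n * real (Suc n))"
    using n by simp
  also have "\<dots> \<le> (real (Suc n) * ln (real n)) / (real n * real (Suc n))"
    by (intro divide_right_mono le) simp
  also have "\<dots> = ln (real n) / real n" using n by (simp del: of_nat_Suc)
  finally show ?thesis .
qed

lemma dchar_ln_sum_bounded:
  assumes "dchar q \<xi>" "q > 0" "\<xi> \<noteq> principal_dchar q"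
  shows "\<exists>C. \<forall>N. norm (\<Sum>n=1..N. \<xi> n / of_nat n * of_real (ln (real n))) \<le> C"
proof (intro exI allI)
  fix N :: nat
  let ?t = "\<lambda>n. \<xi> n / of_nat n * of_real (ln (real n))"
  let ?C = "norm (?t 1) + norm (?t 2) + 2 * real q * (ln 3 / 3)"
  show "norm (\<Sum>n=1..N. ?t n) \<le> ?C"
  proof (cases "N \<ge> 2")
    case True
    have "(\<Sum>n=1..N. ?t n) = ?t 1 + ?t 2 + (\<Sum>n=3..<Suc N. of_real (ln (real n) / real n) * \<xi> n)"
    proof -
      have U: "{1..N} = insert 1 (insert 2 {3..<Suc N})" using True by auto
      have "(\<Sum>n=1..N. ?t n) = ?t 1 + (?t 2 + (\<Sum>n=3..<Suc N. ?t n))"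
        unfolding U by (subst sum.insert, simp, simp, subst sum.insert) auto
      also have "(\<Sum>n=3..<Suc N. ?t n) = (\<Sum>n=3..<Suc N. of_real (ln (real n) / real n) * \<xi> n)"
        by (intro sum.cong refl) simp
      finally show ?thesis by (simp only: add.assoc)
    qed
    moreover have "norm (\<Sum>n=3..<Suc N. of_real (ln (real n) / real n) * \<xi> n) \<le> 2 * real q * (ln (real 3) / real 3)"
      by (rule norm_abel_sum_le[OF norm_sum_dchar_le[OF assms]]) (use True ln_over_antimono in auto)
    ultimately show ?thesis
      using norm_triangle_ineq[of "?t 1 + ?t 2" "\<Sum>n=3..<Suc N. of_real (ln (real n) / real n) * \<xi> n"]
        norm_triangle_ineq[of "?t 1" "?t 2"] by simp
  next
    case False
    then have "N = 0 \<or> N = 1" by auto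
    then show ?thesis by auto
  qed
qed

text \<open>Writing \<open>ln n\<close> as a divisor sum of \<open>mangoldt\<close> turns the
  bounded sum of \<open>\<xi> n * ln n / n\<close> into a sum over \<open>n = m * k\<close>. The
  inner sum over \<open>k\<close> is L(1) up to \<open>2 * q * m / N\<close>, and these errors add
  up to at most \<open>(2 * q / N) * chebyshev_psi N \<le> 8 * q\<close>. So L(1) times
  \<open>mangoldt_dchar_sum\<close> is bounded, and division by L(1) is possible.\<close>

lemma mangoldt_dchar_sum_bounded:
  assumes "dchar q \<xi>" "q > 0" "\<xi> \<noteq> principal_dchar q" "L_one q \<xi> \<noteq> 0"
  shows "\<exists>C. \<forall>N. norm (mangoldt_dchar_sum \<xi> N) \<le> C"
proof -
  obtain C where C: "\<And>N. norm (\<Sum>n=1..N. \<xi> n / of_nat n * of_real (ln (real n))) \<le> C"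
    using dchar_ln_sum_bounded[OF assms(1-3)] by blast
  have "norm (mangoldt_dchar_sum \<xi> N) \<le> (C + 8 * real q) / norm (L_one q \<xi>)" for N
  proof (cases "N > 0")
    case True
    let ?A = "\<lambda>m. \<Sum>k=1..N div m. \<xi> k / of_nat k"
    have "(\<Sum>n=1..N. \<xi> n / of_nat n * of_real (ln (real n)))
        = (\<Sum>n=1..N. \<Sum>m | m dvd n. \<xi> m * mangoldt m / of_nat m * (\<xi> (n div m) / of_nat (n div m)))"
    proof (intro sum.cong refl)
      fix n assume n: "n \<in> {1..N}"
      have "\<xi> n / of_nat n * of_real (ln (real n)) = (\<Sum>m | m dvd n. \<xi> n / of_nat n * mangoldt m)"
        unfolding sum_distrib_left[symmetric] using n mangoldt_sum[of n, where ?'a=complex] by simp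
      also have "\<dots> = (\<Sum>m | m dvd n. \<xi> m * mangoldt m / of_nat m * (\<xi> (n div m) / of_nat (n div m)))"
      proof (intro sum.cong refl)
        fix m assume "m \<in> {m. m dvd n}"
        then obtain k where k: "n = m * k" by auto
        with n have "m > 0" by (auto intro: Nat.gr0I)
        then show "\<xi> n / of_nat n * mangoldt m = \<xi> m * mangoldt m / of_nat m * (\<xi> (n div m) / of_nat (n div m))"
          by (simp add: k dchar_mult[OF assms(1)])
      qed
      finally show "\<xi> n / of_nat n * of_real (ln (real n)) = \<dots>" .
    qed
    also have "\<dots> = (\<Sum>m=1..N. \<Sum>k=1..N div m. \<xi> m * mangoldt m / of_nat m * (\<xi> k / of_nat k))"
      by (rule sum_divisors_swap)
    also have "\<dots> = (\<Sum>m=1..N. \<xi> m * mangoldt m / of_nat m * ?A m)"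
      by (simp add: sum_distrib_left)
    also have "\<dots> = mangoldt_dchar_sum \<xi> N * L_one q \<xi> + (\<Sum>m=1..N. \<xi> m * mangoldt m / of_nat m * (?A m - L_one q \<xi>))"
      unfolding mangoldt_dchar_sum_def sum_distrib_right sum.distrib[symmetric]
      by (intro sum.cong refl) (simp add: right_diff_distrib)
    finally have eq: "mangoldt_dchar_sum \<xi> N * L_one q \<xi> = (\<Sum>n=1..N. \<xi> n / of_nat n * of_real (ln (real n)))
       - (\<Sum>m=1..N. \<xi> m * mangoldt m / of_nat m * (?A m - L_one q \<xi>))" by simp
    have "norm (\<Sum>m=1..N. \<xi> m * mangoldt m / of_nat m * (?A m - L_one q \<xi>)) \<le> (\<Sum>m=1..N. mangoldt m * (2 * real q / real N))"
    proof (rule sum_norm_le)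
      fix m assume m: "m \<in> {1..N}"
      have "norm (\<xi> m * mangoldt m / of_nat m * (?A m - L_one q \<xi>)) = norm (\<xi> m) * (mangoldt m / real m * norm (?A m - L_one q \<xi>))"
        by (simp add: norm_mult norm_divide)
      also have "\<dots> \<le> 1 * (mangoldt m / real m * (2 * real q * real m / real N))"
        using m L_one_tail_div[OF assms(1-3), of m N] norm_dchar_le[OF assms(1,2)]
        by (intro mult_mono mangoldt_nonneg divide_nonneg_nonneg mult_nonneg_nonneg order_refl) auto
      finally show "norm (\<xi> m * mangoldt m / of_nat m * (?A m - L_one q \<xi>)) \<le> mangoldt m * (2 * real q / real N)"
        using m by simp
    qed
    also have "\<dots> = chebyshev_psi N * (2 * real q / real N)"
      unfolding chebyshev_psi_def sum_distrib_right ..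
    also have "\<dots> \<le> 4 * real N * (2 * real q / real N)"
      by (intro mult_right_mono chebyshev_psi_le) auto
    also have "\<dots> = 8 * real q" using True by simp
    finally have "norm (mangoldt_dchar_sum \<xi> N * L_one q \<xi>) \<le> C + 8 * real q"
      unfolding eq using C[of N] by (intro order_trans[OF norm_triangle_ineq4]) linarith
    then show ?thesis using assms(4) by (simp add: norm_mult field_simps)
  next
    case False
    have "C \<ge> 0" using C[of 0] by simp
    then show ?thesis using False by (simp add: mangoldt_dchar_sum_def)
  qed
  then show ?thesis by blast
qed

section \<open>The Moebius function\<close>

definition mobius :: "nat \<Rightarrow> int" where
  "mobius n = (if squarefree n then (-1) ^ card (prime_factors n) else 0)"

lemma abs_mobius_le: "\<bar>mobius n\<bar> \<le> 1"
  by (simp add: mobius_def power_abs)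

lemma sum_Pow_minus_one:
  assumes "finite A" "A \<noteq> {}" shows "(\<Sum>S\<in>Pow A. (-1) ^ card S) = (0::int)"
  using assms
proof (induction A rule: finite_ne_induct)
  case (singleton x)
  have "Pow {x} = {{}, {x}}" by auto
  then show ?case by simp
next
  case (insert x F)
  have "(\<Sum>S\<in>insert x ` Pow F. (-1) ^ card S) = (\<Sum>S\<in>Pow F. - ((-1) ^ card S) :: int)"
  proof (subst sum.reindex)
    show "inj_on (insert x) (Pow F)" using insert(3) by (auto simp: inj_on_def)
    show "sum ((\<lambda>S. (-1) ^ card S) \<circ> insert x) (Pow F) = (\<Sum>S\<in>Pow F. - ((-1) ^ card S) :: int)"
    proof (intro sum.cong refl)
      fix S assume S: "S \<in> Pow F"
      then have "finite S" "x \<notin> S" using insert finite_subset by auto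
      then show "((\<lambda>S. (-1) ^ card S) \<circ> insert x) S = - ((-1) ^ card S :: int)" by simp
    qed
  qed
  moreover have "(\<Sum>S\<in>Pow (insert x F). (-1) ^ card S) = (\<Sum>S\<in>Pow F. (-1) ^ card S) + (\<Sum>S\<in>insert x ` Pow F. (-1) ^ card S :: int)"
    unfolding Pow_insert using insert by (intro sum.union_disjoint) auto
  ultimately show ?case using insert by (simp add: sum_negf)
qed

lemma prod_primes_prime_factors:
  assumes "finite S" "\<And>p. p \<in> S \<Longrightarrow> prime (p::nat)"
  shows "prime_factors (\<Prod>S) = S" "squarefree (\<Prod>S)"
proof -
  have ne: "0 \<notin> S" using assms(2) not_prime_0 by blast
  have "prime_factors (\<Prod>S) = (\<Union>p\<in>S. prime_factors p)"
    using prime_factors_prod[OF assms(1), of "\<lambda>x. x"] ne by simp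
  also have "\<dots> = S" using assms(2) by (auto simp: prime_prime_factors)
  finally show "prime_factors (\<Prod>S) = S" .
  show "squarefree (\<Prod>S)"
    using assms by (intro squarefree_prod_coprime) (auto simp: primes_coprime squarefree_prime)
qed

text \<open>Squarefree divisors correspond to sets of prime factors, and the alternating sum over
  the subsets of a nonempty set vanishes.\<close>

lemma sum_mobius_divisors:
  assumes "n > 0" shows "(\<Sum>m | m dvd n. mobius m) = (if n = 1 then 1 else 0)"
proof -
  have fin: "finite {m. m dvd n}" using assms by simp
  have "(\<Sum>m | m dvd n. mobius m) = (\<Sum>m\<in>{m. m dvd n \<and> squarefree m}. (-1) ^ card (prime_factors m))"
    using fin by (intro sum.mono_neutral_cong_right) (auto simp: mobius_def)
  also have "\<dots> = (\<Sum>S\<in>Pow (prime_factors n). (-1) ^ card S)"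
  proof (rule sum.reindex_bij_witness[where i="\<lambda>S. \<Prod>S" and j=prime_factors], goal_cases)
    case (1 m)
    then have m: "m \<noteq> 0" "squarefree m" using assms by auto
    have "(\<Prod>p\<in>prime_factors m. p) = (\<Prod>p\<in>prime_factors m. p ^ multiplicity p m)"
      using squarefree_factorial_semiring'[OF m(1)] m(2) by (intro prod.cong) auto
    also have "\<dots> = m" using prod_prime_factors[OF m(1)] by simp
    finally show ?case .
  next
    case (2 m) then show ?case using assms by (auto simp: prime_factors_dvd intro: dvd_trans)
  next
    case (3 S)
    then have "finite S" "\<And>p. p \<in> S \<Longrightarrow> prime p" using finite_subset by auto
    then show ?case by (rule prod_primes_prime_factors)
  next
    case (4 S)
    then have S: "finite S" "\<And>p. p \<in> S \<Longrightarrow> prime p" using finite_subset by auto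
    have "\<Prod>S dvd n"
    proof -
      have "\<Prod>S dvd (\<Prod>p\<in>prime_factors n. p)" using 4 by (intro prod_dvd_prod_subset) auto
      also have "\<dots> dvd (\<Prod>p\<in>prime_factors n. p ^ multiplicity p n)"
        by (intro prod_dvd_prod dvd_power) (auto simp: prime_factors_multiplicity)
      also have "\<dots> = n" using prod_prime_factors[of n] assms by simp
      finally show ?thesis .
    qed
    then show ?case using prod_primes_prime_factors[OF S] by simp
  qed auto
  also have "\<dots> = (if n = 1 then 1 else 0)"
  proof (cases "n = 1")
    case False
    then have "prime_factors n \<noteq> {}" using assms by (simp add: prime_factorization_empty_iff)
    then show ?thesis using False sum_Pow_minus_one[of "prime_factors n"] by simp
  qed auto
  finally show ?thesis .
qed

lemma divisors_triple_swap:
  fixes f :: "nat \<Rightarrow> nat \<Rightarrow> 'a::comm_monoid_add"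
  assumes "n > 0"
  shows "(\<Sum>m | m dvd n. \<Sum>e | e dvd m. f m e) = (\<Sum>e | e dvd n. \<Sum>k | k dvd n div e. f (e * k) e)"
proof -
  have fin: "finite {m. m dvd n}" using assms by simp
  have fin2: "finite {e. e dvd m}" if "m dvd n" for m using that assms by (metis dvd_pos_nat finite_divisors_nat)
  have fin3: "finite {k. k dvd n div e}" if "e dvd n" for e
    using that assms by (intro finite_divisors_nat) (auto simp: dvd_div_eq_0_iff)
  have "(\<Sum>m | m dvd n. \<Sum>e | e dvd m. f m e) = (\<Sum>(m,e)\<in>(SIGMA m:{m. m dvd n}. {e. e dvd m}). f m e)"
    using fin fin2 by (subst sum.Sigma) auto
  also have "\<dots> = (\<Sum>(e,k)\<in>(SIGMA e:{e. e dvd n}. {k. k dvd n div e}). f (e * k) e)"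
  proof (rule sum.reindex_bij_witness[where i="\<lambda>(e,k). (e*k, e)" and j="\<lambda>(m,e). (e, m div e)"], goal_cases)
    case (1 a) then show ?case by auto
  next
    case (2 a) then show ?case by (auto intro: div_dvd_div[THEN iffD2] dvd_trans)
  next
    case (3 b) 
    then obtain e k where "b = (e,k)" "e dvd n" "k dvd n div e" by auto
    moreover then have "e > 0" using assms dvd_pos_nat by blast
    ultimately show ?case by auto
  next
    case (4 b)
    then show ?case by (auto simp: dvd_div_iff_mult mult.commute intro: ) (metis assms dvd_div_iff_mult dvd_pos_nat less_irrefl mult.commute)
  qed auto
  also have "\<dots> = (\<Sum>e | e dvd n. \<Sum>k | k dvd n div e. f (e * k) e)"
    using fin fin3 by (subst sum.Sigma) auto
  finally show ?thesis .
qed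

text \<open>Moebius inversion of \<open>ln = \<Sum> mangoldt\<close> has the logarithm at
  \<open>m\<close> and the Moebius function at \<open>n div m\<close>. Exchanging \<open>m\<close>
  with \<open>n div m\<close> and expanding \<open>ln (n div m)\<close> produces the sign; the
  leftover multiple of \<open>ln n\<close> vanishes, for \<open>n = 1\<close> because
  \<open>ln 1 = 0\<close>.\<close>

lemma sum_mobius_ln:
  assumes "n > 0" shows "(\<Sum>m | m dvd n. of_int (mobius m) * ln (real m)) = - (mangoldt n :: real)"
proof -
  have "(\<Sum>m | m dvd n. of_int (mobius (n div m)) * ln (real m)) = (\<Sum>m | m dvd n. \<Sum>e | e dvd m. of_int (mobius (n div m)) * mangoldt e)"
  proof (intro sum.cong refl)
    fix m assume "m \<in> {m. m dvd n}"
    then have "m > 0" using assms dvd_pos_nat by auto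
    then show "of_int (mobius (n div m)) * ln (real m) = (\<Sum>e | e dvd m. of_int (mobius (n div m)) * mangoldt e)"
      unfolding sum_distrib_left[symmetric] using mangoldt_sum[of m, where ?'a=real] by simp
  qed
  also have "\<dots> = (\<Sum>e | e dvd n. \<Sum>k | k dvd n div e. of_int (mobius (n div (e * k))) * mangoldt e)"
    by (rule divisors_triple_swap[OF assms])
  also have "\<dots> = (\<Sum>e | e dvd n. if e = n then mangoldt e else 0)"
  proof (intro sum.cong refl)
    fix e assume "e \<in> {e. e dvd n}"
    then have e: "e dvd n" "n div e > 0" using assms by (auto simp: dvd_imp_le div_greater_zero_iff dvd_pos_nat)
    have "(\<Sum>k | k dvd n div e. of_int (mobius (n div (e * k))) * mangoldt e) = (\<Sum>k | k dvd n div e. of_int (mobius (n div e div k))) * (mangoldt e :: real)"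
      by (simp add: sum_distrib_right div_mult2_eq)
    also have "(\<Sum>k | k dvd n div e. of_int (mobius (n div e div k))) = (\<Sum>k | k dvd n div e. of_int (mobius k) :: real)"
      by (rule sum.reindex_bij_witness[where i="\<lambda>k. n div e div k" and j="\<lambda>k. n div e div k"]) (use e in \<open>auto elim!: dvdE\<close>)
    also have "\<dots> = of_int (if n div e = 1 then 1 else 0)"
      unfolding of_int_sum[symmetric] sum_mobius_divisors[OF e(2)] ..
    also have "n div e = 1 \<longleftrightarrow> e = n" using e assms by (auto elim!: dvdE)
    finally show "(\<Sum>k | k dvd n div e. of_int (mobius (n div (e * k))) * mangoldt e) = (if e = n then mangoldt e else (0::real))"
      by simp
  qed
  also have "\<dots> = mangoldt n" using assms by (subst sum.delta) auto
  finally have 1: "(\<Sum>m | m dvd n. of_int (mobius (n div m)) * ln (real m)) = mangoldt n" .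
  have "(\<Sum>m | m dvd n. of_int (mobius m) * ln (real m)) = (\<Sum>m | m dvd n. of_int (mobius (n div m)) * ln (real (n div m)))"
    by (rule sum.reindex_bij_witness[where i="\<lambda>k. n div k" and j="\<lambda>k. n div k"]) (use assms in \<open>auto elim!: dvdE\<close>)
  also have "\<dots> = (\<Sum>m | m dvd n. of_int (mobius (n div m)) * ln (real n) - of_int (mobius (n div m)) * ln (real m))"
  proof (intro sum.cong refl)
    fix m assume "m \<in> {m. m dvd n}"
    then obtain k where k: "n = m * k" by auto
    then have "m > 0" "k > 0" using assms by auto
    then show "of_int (mobius (n div m)) * ln (real (n div m)) = of_int (mobius (n div m)) * ln (real n) - of_int (mobius (n div m)) * ln (real m)"
      by (simp add: k ln_mult algebra_simps)
  qed
  also have "\<dots> = (\<Sum>m | m dvd n. of_int (mobius (n div m))) * ln (real n) - mangoldt n"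
    using 1 by (simp add: sum_subtractf sum_distrib_right)
  also have "(\<Sum>m | m dvd n. of_int (mobius (n div m))) = (\<Sum>k | k dvd n. of_int (mobius k) :: real)"
    by (rule sum.reindex_bij_witness[where i="\<lambda>k. n div k" and j="\<lambda>k. n div k"]) (use assms in \<open>auto elim!: dvdE\<close>)
  also have "\<dots> = of_int (if n = 1 then 1 else 0)"
    unfolding of_int_sum[symmetric] sum_mobius_divisors[OF assms] ..
  finally show ?thesis by simp
qed

text \<open>If the value at \<open>1\<close> vanishes, the sum over \<open>n \<le> N\<close> of \<open>\<xi> n / n\<close> times
  \<open>\<Sum>m | m dvd n. mobius m * ln (N / m)\<close>, which is \<open>mangoldt n\<close> plus \<open>ln N\<close> at \<open>n = 1\<close>, stays bounded.\<close>

lemma mangoldt_dchar_sum_zero: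
  assumes "dchar q \<xi>" "q > 0" "\<xi> \<noteq> principal_dchar q" "L_one q \<xi> = 0" "N > 0"
  shows "norm (mangoldt_dchar_sum \<xi> N + of_real (ln (real N))) \<le> 2 * real q"
proof -
  let ?mu = "\<lambda>m. of_int (mobius m) :: complex"
  let ?A = "\<lambda>m. \<Sum>k=1..N div m. \<xi> k / of_nat k"
  let ?l = "\<lambda>m. ln (real N) - ln (real m)"
  have "mangoldt_dchar_sum \<xi> N + of_real (ln (real N)) = (\<Sum>n=1..N. \<xi> n / of_nat n * (mangoldt n + (if n = 1 then of_real (ln (real N)) else 0)))"
  proof -
    have "(\<Sum>n=1..N. \<xi> n / of_nat n * (if n = 1 then of_real (ln (real N)) else 0)) = (\<Sum>n=1..N. if n = 1 then of_real (ln (real N)) else (0 :: complex))"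
      using dchar_1[OF assms(1)] by (intro sum.cong) auto
    also have "\<dots> = of_real (ln (real N))" using assms(5) by (subst sum.delta) auto
    finally show ?thesis unfolding mangoldt_dchar_sum_def by (simp add: distrib_left sum.distrib)
  qed
  also have "\<dots> = (\<Sum>n=1..N. \<Sum>m | m dvd n. \<xi> m * ?mu m / of_nat m * of_real (?l m) * (\<xi> (n div m) / of_nat (n div m)))"
  proof (intro sum.cong refl)
    fix n assume n: "n \<in> {1..N}"
    have "(\<Sum>m | m dvd n. of_int (mobius m) * ?l m) = (\<Sum>m | m dvd n. of_int (mobius m)) * ln (real N) - (\<Sum>m | m dvd n. of_int (mobius m) * ln (real m))"
      by (simp add: sum_distrib_right sum_subtractf right_diff_distrib)
    also have "(\<Sum>m | m dvd n. of_int (mobius m) :: real) = of_int (if n = 1 then 1 else 0)"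
      using n by (subst of_int_sum[symmetric], subst sum_mobius_divisors) auto
    also have "(\<Sum>m | m dvd n. of_int (mobius m) * ln (real m)) = - mangoldt n" using n by (intro sum_mobius_ln) auto
    finally have "(\<Sum>m | m dvd n. of_int (mobius m) * ?l m) = mangoldt n + (if n = 1 then ln (real N) else 0)" by simp
    then have "of_real (\<Sum>m | m dvd n. of_int (mobius m) * ?l m) = (of_real (mangoldt n + (if n = 1 then ln (real N) else 0)) :: complex)"
      by (simp only:)
    then have e: "mangoldt n + (if n = 1 then of_real (ln (real N)) else 0) = (\<Sum>m | m dvd n. ?mu m * of_real (?l m))"
      by (simp split: if_splits)
    show "\<xi> n / of_nat n * (mangoldt n + (if n = 1 then of_real (ln (real N)) else 0))
       = (\<Sum>m | m dvd n. \<xi> m * ?mu m / of_nat m * of_real (?l m) * (\<xi> (n div m) / of_nat (n div m)))"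
      unfolding e sum_distrib_left
    proof (intro sum.cong refl)
      fix m assume "m \<in> {m. m dvd n}"
      then obtain k where k: "n = m * k" by auto
      with n have "m > 0" by (auto intro: Nat.gr0I)
      then show "\<xi> n / of_nat n * (?mu m * of_real (?l m)) = \<xi> m * ?mu m / of_nat m * of_real (?l m) * (\<xi> (n div m) / of_nat (n div m))"
        by (simp add: k dchar_mult[OF assms(1)])
    qed
  qed
  also have "\<dots> = (\<Sum>m=1..N. \<Sum>k=1..N div m. \<xi> m * ?mu m / of_nat m * of_real (?l m) * (\<xi> k / of_nat k))"
    by (rule sum_divisors_swap)
  also have "\<dots> = (\<Sum>m=1..N. \<xi> m * ?mu m / of_nat m * of_real (?l m) * ?A m)"
    by (simp add: sum_distrib_left)
  also have "norm \<dots> \<le> (\<Sum>m=1..N. ?l m * (2 * real q / real N))"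
  proof (rule sum_norm_le)
    fix m assume m: "m \<in> {1..N}"
    then have l0: "?l m \<ge> 0" by (auto simp: ln_le_cancel_iff)
    have mu: "norm (?mu m) \<le> 1"
      using abs_mobius_le[of m] by (metis norm_of_int of_int_1_le_iff of_int_le_1_iff of_int_abs)
    have "norm (\<xi> m * ?mu m / of_nat m * of_real (?l m) * ?A m) = norm (\<xi> m) * (norm (?mu m) * ((1 / real m) * (?l m * norm (?A m))))"
      using l0 by (simp add: norm_mult norm_divide del: of_real_diff norm_of_int)
    also have "\<dots> \<le> 1 * (1 * ((1 / real m) * (?l m * norm (?A m))))"
      by (intro mult_mono norm_dchar_le[OF assms(1,2)] mu order_refl mult_nonneg_nonneg l0) auto
    also have "\<dots> \<le> 1 * (1 * ((1 / real m) * (?l m * (2 * real q * real m / real N))))"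
      by (intro mult_left_mono l0) (use m L_one_tail_div[OF assms(1-3), of m N] assms(4) in auto)
    also have "\<dots> = ?l m * (2 * real q / real N)" using m by simp
    finally show "norm (\<xi> m * ?mu m / of_nat m * of_real (?l m) * ?A m) \<le> ?l m * (2 * real q / real N)" .
  qed
  \<comment> \<open>The weights \<open>ln (N / m)\<close> add up to
    \<open>N * ln N - ln (fact N)\<close>, which is at most \<open>N\<close> by the lower Stirling
    bound. Bounding each weight by \<open>ln N\<close> would lose a logarithm and with it the
    conclusion.\<close>
  also have "\<dots> = (real N * ln (real N) - ln (fact N)) * (2 * real q / real N)"
  proof -
    have "ln (fact N :: real) = (\<Sum>n=1..N. ln (real n))" by (induction N) (auto simp: ln_mult)
    then show ?thesis unfolding sum_distrib_right[symmetric] by (simp add: sum_subtractf)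
  qed
  also have "\<dots> \<le> real N * (2 * real q / real N)"
    using ln_fact_ge[of N] by (intro mult_right_mono) auto
  also have "\<dots> = 2 * real q" using assms(5) by simp
  finally show ?thesis .
qed

section \<open>How many characters can vanish at 1\<close>

lemma sum_dchars_mangoldt:
  assumes "q > 0" "coprime a q"
  shows "(\<Sum>\<xi> | dchar q \<xi>. cnj (\<xi> a) * mangoldt_dchar_sum \<xi> N) =
    of_real (real (totient q) * (\<Sum>n | n \<in> {1..N} \<and> [n = a] (mod q). mangoldt n / real n))"
proof -
  have "(\<Sum>\<xi> | dchar q \<xi>. cnj (\<xi> a) * mangoldt_dchar_sum \<xi> N) =
      (\<Sum>n=1..N. \<Sum>\<xi> | dchar q \<xi>. cnj (\<xi> a) * \<xi> n * (mangoldt n / of_nat n))"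
    unfolding mangoldt_dchar_sum_def sum_distrib_left by (subst sum.swap) (simp add: mult_ac)
  also have "\<dots> = (\<Sum>n=1..N. (if [n = a] (mod q) then of_nat (totient q) else 0) * (mangoldt n / of_nat n))"
    unfolding sum_distrib_right[symmetric] sum_dchars_cnj[OF assms] ..
  also have "\<dots> = (\<Sum>n | n \<in> {1..N} \<and> [n = a] (mod q). of_nat (totient q) * (mangoldt n / of_nat n))"
    by (rule sum.mono_neutral_cong_right) auto
  also have "\<dots> = of_real (real (totient q) * (\<Sum>n | n \<in> {1..N} \<and> [n = a] (mod q). mangoldt n / real n))"
    by (simp add: sum_distrib_left)
  finally show ?thesis .
qed

lemma L_one_cnj:
  assumes "dchar q \<xi>" "q > 0" "\<xi> \<noteq> principal_dchar q"
  shows "L_one q (\<lambda>n. cnj (\<xi> n)) = cnj (L_one q \<xi>)" "(\<lambda>n. cnj (\<xi> n)) \<noteq> principal_dchar q"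
proof -
  show ne: "(\<lambda>n. cnj (\<xi> n)) \<noteq> principal_dchar q"
  proof
    assume *: "(\<lambda>n. cnj (\<xi> n)) = principal_dchar q"
    have "\<xi> n = principal_dchar q n" for n
      using arg_cong[OF fun_cong[OF *, of n], of cnj] by (simp add: principal_dchar_def split: if_splits)
    with assms(3) show False by auto
  qed
  have "(\<lambda>x. cnj (\<Sum>n=1..x. \<xi> n / of_nat n)) \<longlonglongrightarrow> cnj (L_one q \<xi>)"
    using L_one_lim[OF assms] by (rule tendsto_cnj)
  moreover have "(\<lambda>x. \<Sum>n=1..x. cnj (\<xi> n) / of_nat n) \<longlonglongrightarrow> L_one q (\<lambda>n. cnj (\<xi> n))"
    by (rule L_one_lim[OF dchar_cnj[OF assms(1)] assms(2) ne])
  ultimately show "L_one q (\<lambda>n. cnj (\<xi> n)) = cnj (L_one q \<xi>)"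
    using LIMSEQ_unique by simp
qed

lemma Re_mangoldt_principal_le:
  assumes "N \<ge> 1" shows "Re (mangoldt_dchar_sum (principal_dchar q) N) \<le> ln (real N) + 4"
proof -
  have "Re (mangoldt_dchar_sum (principal_dchar q) N) \<le> norm (mangoldt_dchar_sum (principal_dchar q) N)"
    by (rule complex_Re_le_cmod)
  also have "\<dots> \<le> (\<Sum>n=1..N. mangoldt n / real n)"
    unfolding mangoldt_dchar_sum_def
    by (intro sum_norm_le) (auto simp: norm_mult norm_divide principal_dchar_def mangoldt_nonneg)
  also have "\<dots> \<le> ln (real N) + 4" by (rule sum_mangoldt_over_le[OF assms])
  finally show ?thesis .
qed

text \<open>A prime not coprime to \<open>q\<close> divides \<open>q\<close>, so the terms missing
  from the full Mertens sum are non-primes, whose sum is bounded, or lie in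
  \<open>{1..q}\<close>.\<close>

lemma Re_mangoldt_principal_ge:
  assumes "q > 0" shows "\<exists>C. \<forall>N\<ge>1. Re (mangoldt_dchar_sum (principal_dchar q) N) \<ge> ln (real N) - C"
proof -
  obtain C where C: "\<And>N. (\<Sum>n\<in>{n\<in>{1..N}. \<not> prime n}. mangoldt n / real n) \<le> C"
    using sum_mangoldt_nonprime_bounded by blast
  let ?K = "\<Sum>n=1..q. mangoldt n / real n :: real"
  have "Re (mangoldt_dchar_sum (principal_dchar q) N) \<ge> ln (real N) - (1 + C + ?K)" if "N \<ge> 1" for N
  proof -
    have nn: "0 \<le> mangoldt n / real n" for n by (simp add: mangoldt_nonneg)
    have "(\<Sum>n=1..N. mangoldt n / real n) =
        (\<Sum>n\<in>{n\<in>{1..N}. coprime n q}. mangoldt n / real n) + (\<Sum>n\<in>{n\<in>{1..N}. \<not> coprime n q}. mangoldt n / real n)"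
      by (subst sum.union_disjoint[symmetric]) (auto intro!: sum.cong)
    also have "(\<Sum>n\<in>{n\<in>{1..N}. coprime n q}. mangoldt n / real n) = Re (mangoldt_dchar_sum (principal_dchar q) N)"
      unfolding mangoldt_dchar_sum_def Re_sum by (rule sum.mono_neutral_cong_left) (auto simp: principal_dchar_def)
    also have "(\<Sum>n\<in>{n\<in>{1..N}. \<not> coprime n q}. mangoldt n / real n) \<le> (\<Sum>n\<in>{n\<in>{1..N}. \<not> prime n} \<union> {1..q}. mangoldt n / real n)"
    proof (rule sum_mono2)
      show "{n\<in>{1..N}. \<not> coprime n q} \<subseteq> {n\<in>{1..N}. \<not> prime n} \<union> {1..q}"
      proof
        fix n assume n: "n \<in> {n\<in>{1..N}. \<not> coprime n q}"
        show "n \<in> {n\<in>{1..N}. \<not> prime n} \<union> {1..q}"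
        proof (cases "prime n")
          case True
          then have "n dvd q" using n prime_imp_coprime by blast
          then show ?thesis using n assms dvd_imp_le by auto
        qed (use n in auto)
      qed
    qed (use nn in auto)
    also have "\<dots> \<le> (\<Sum>n\<in>{n\<in>{1..N}. \<not> prime n}. mangoldt n / real n) + ?K"
      by (subst sum.union_inter[symmetric]) (auto intro!: sum_nonneg simp: mangoldt_nonneg)
    finally show ?thesis using C[of N] sum_mangoldt_over_ge[OF that] by linarith
  qed
  then show ?thesis by blast
qed

text \<open>Summed over all characters, \<open>mangoldt_dchar_sum\<close> is nonnegative; the principal character contributes
  \<open>ln N\<close> and every character with a zero \<open>- ln N\<close>.\<close>

lemma at_most_one_zero:
  assumes "q > 0" "dchar q \<xi>" "\<xi> \<noteq> principal_dchar q" "L_one q \<xi> = 0"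
    and "dchar q \<psi>" "\<psi> \<noteq> principal_dchar q" "L_one q \<psi> = 0"
  shows "\<xi> = \<psi>"
proof (rule ccontr)
  assume ne: "\<xi> \<noteq> \<psi>"
  let ?X = "{\<xi>. dchar q \<xi>}"
  \<comment> \<open>\<open>e\<close> is the coefficient of \<open>ln N\<close> in the growth of each
    character. Two distinct zeros would make the total at most 1 - 2 = -1, so a nonnegative quantity
    would tend to minus infinity.\<close>
  define e :: "(nat \<Rightarrow> complex) \<Rightarrow> real" where
    "e \<theta> = (if \<theta> = principal_dchar q then 1 else if L_one q \<theta> = 0 then -1 else 0)" for \<theta>
  have "\<exists>C. \<forall>N\<ge>1. Re (mangoldt_dchar_sum \<theta> N) \<le> C + e \<theta> * ln (real N)" if \<theta>: "\<theta> \<in> ?X" for \<theta>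
  proof -
    consider "\<theta> = principal_dchar q" | "\<theta> \<noteq> principal_dchar q" "L_one q \<theta> = 0" | "\<theta> \<noteq> principal_dchar q" "L_one q \<theta> \<noteq> 0"
      by blast
    then show ?thesis
    proof cases
      case 1
      then show ?thesis using Re_mangoldt_principal_le[of _ q] by (intro exI[of _ 4]) (simp add: e_def add.commute)
    next
      case 2
      have "Re (mangoldt_dchar_sum \<theta> N) \<le> 2 * real q - ln (real N)" if "N \<ge> 1" for N
        using mangoldt_dchar_sum_zero[of q \<theta> N] 2 \<theta> assms(1) that
          complex_Re_le_cmod[of "mangoldt_dchar_sum \<theta> N + of_real (ln (real N))"] by simp
      then show ?thesis using 2 by (intro exI[of _ "2 * real q"]) (simp add: e_def)
    next
      case 3
      obtain C where "\<And>N. norm (mangoldt_dchar_sum \<theta> N) \<le> C"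
        using mangoldt_dchar_sum_bounded[of q \<theta>] 3 \<theta> assms(1) by blast
      then have "Re (mangoldt_dchar_sum \<theta> N) \<le> C" for N
        using complex_Re_le_cmod order_trans by blast
      then show ?thesis using 3 by (intro exI[of _ C]) (simp add: e_def)
    qed
  qed
  then obtain C where C: "\<And>\<theta> N. \<theta> \<in> ?X \<Longrightarrow> N \<ge> 1 \<Longrightarrow> Re (mangoldt_dchar_sum \<theta> N) \<le> C \<theta> + e \<theta> * ln (real N)"
    by metis
  have fin: "finite ?X" by (rule finite_dchars[OF assms(1)])
  let ?Y = "{principal_dchar q, \<xi>, \<psi>}"
  have "sum e ?X \<le> sum e ?Y"
  proof -
    have "sum e ?X = sum e (?X - ?Y) + sum e ?Y"
      using assms dchar_principal by (intro sum.subset_diff fin) auto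
    moreover have "sum e (?X - ?Y) \<le> 0" by (intro sum_nonpos) (auto simp: e_def)
    ultimately show ?thesis by simp
  qed
  also have "sum e ?Y = -1" using assms ne by (simp add: e_def)
  finally have e: "sum e ?X \<le> -1" .
  have bound: "ln (real N) \<le> (\<Sum>\<theta>\<in>?X. C \<theta>)" if N: "N \<ge> 1" for N
  proof -
    have "0 \<le> real (totient q) * (\<Sum>n | n \<in> {1..N} \<and> [n = 1] (mod q). mangoldt n / real n)"
      by (intro mult_nonneg_nonneg sum_nonneg divide_nonneg_nonneg mangoldt_nonneg) auto
    also have "\<dots> = Re (\<Sum>\<theta>\<in>?X. cnj (\<theta> 1) * mangoldt_dchar_sum \<theta> N)"
      using sum_dchars_mangoldt[OF assms(1), of 1 N] by simp
    also have "\<dots> = (\<Sum>\<theta>\<in>?X. Re (mangoldt_dchar_sum \<theta> N))"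
      unfolding Re_sum
    proof (intro sum.cong refl)
      fix \<theta> assume "\<theta> \<in> ?X"
      then have "\<theta> 1 = 1" using dchar_1 by blast
      then show "Re (cnj (\<theta> 1) * mangoldt_dchar_sum \<theta> N) = Re (mangoldt_dchar_sum \<theta> N)" by simp
    qed
    also have "\<dots> \<le> (\<Sum>\<theta>\<in>?X. C \<theta> + e \<theta> * ln (real N))" using C N by (intro sum_mono) auto
    also have "\<dots> = (\<Sum>\<theta>\<in>?X. C \<theta>) + sum e ?X * ln (real N)" by (simp add: sum.distrib sum_distrib_right)
    also have "sum e ?X * ln (real N) \<le> (-1) * ln (real N)" using e N by (intro mult_right_mono) auto
    finally show ?thesis by simp
  qed
  obtain N where N: "real N > exp ((\<Sum>\<theta>\<in>?X. C \<theta>))" using reals_Archimedean2 by blast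
  then have "N \<ge> 1" using exp_gt_zero[of "\<Sum>\<theta>\<in>?X. C \<theta>"] by (cases N) auto
  moreover have "ln (real N) > (\<Sum>\<theta>\<in>?X. C \<theta>)" using N \<open>N \<ge> 1\<close> by (subst ln_exp[symmetric], subst ln_less_cancel_iff) auto
  ultimately show False using bound[of N] by simp
qed

section \<open>Real characters: divisor sums and Lambert series\<close>

lemma sum_divisors_prime_power_times:
  fixes f :: "nat \<Rightarrow> 'a::comm_monoid_add"
  assumes "prime p" "\<not> p dvd m" "m > 0"
  shows "(\<Sum>d | d dvd p ^ a * m. f d) = (\<Sum>i\<le>a. \<Sum>e | e dvd m. f (p ^ i * e))"
proof -
  have pu: "\<not> is_unit p" "p \<noteq> 0" using assms(1) by (auto simp: prime_gt_0_nat)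
  have p0: "p ^ i > 0" for i using pu by simp
  have "(\<Sum>i\<le>a. \<Sum>e | e dvd m. f (p ^ i * e)) = (\<Sum>(i,e)\<in>{..a} \<times> {e. e dvd m}. f (p ^ i * e))"
    by (simp add: sum.cartesian_product)
  also have "\<dots> = (\<Sum>d | d dvd p ^ a * m. f d)"
  proof (rule sum.reindex_bij_witness[where j="\<lambda>(i,e). p ^ i * e" and i="\<lambda>d. (multiplicity p d, d div p ^ multiplicity p d)"], goal_cases)
    case (1 b)
    then obtain i e where b: "b = (i,e)" "e dvd m" by auto
    then have "\<not> p dvd e" using assms(2) dvd_trans by blast
    then have "multiplicity p (p ^ i * e) = i"
      using assms(1) pu b(2) assms(3) multiplicity_eqI[of p i "p ^ i * e"] p0[of i] by simp
    then show ?case using b p0[of i] by simp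
  next
    case (2 b) then show ?case by (auto intro: mult_dvd_mono le_imp_power_dvd)
  next
    case (3 d) then show ?case by (simp add: multiplicity_dvd)
  next
    case (4 d)
    then have d: "d dvd p ^ a * m" "d \<noteq> 0" using assms(3) p0[of a] dvd_pos_nat[of "p ^ a * m" d] by auto
    obtain d' where d': "d = p ^ multiplicity p d * d'" "\<not> p dvd d'"
      using multiplicity_decompose'[of d p] d pu by metis
    then have "coprime d' (p ^ a)" using assms(1) by (metis coprime_commute coprime_power_right_iff prime_imp_coprime)
    moreover have "d' dvd p ^ a * m" using d(1) d'(1) by (metis dvd_mult_right)
    ultimately have "d' dvd m" by (simp add: coprime_dvd_mult_right_iff)
    moreover have "d div p ^ multiplicity p d = d'" using d'(1) p0 by (metis nonzero_mult_div_cancel_left less_irrefl)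
    moreover have "multiplicity p d \<le> a"
    proof -
      have "multiplicity p d \<le> multiplicity p (p ^ a * m)"
        using d(1) assms pu by (intro dvd_imp_multiplicity_le) auto
      also have "\<dots> = a" using assms pu multiplicity_eqI[of p a "p ^ a * m"] p0[of a] by simp
      finally show ?thesis .
    qed
    ultimately show ?case by simp
  qed auto
  finally show ?thesis ..
qed

text \<open>The divisor sum is multiplicative, and at \<open>p ^ a\<close> it is the geometric sum
  of \<open>x p\<close>: this equals 1, \<open>a + 1\<close>, or alternates between 1 and 0. It is
  never negative, and at least 1 for even \<open>a\<close>.\<close>

lemma real_dchar_divisor_sum:
  fixes x :: "nat \<Rightarrow> real"
  assumes mult: "\<And>a b. x (a * b) = x a * x b" and x1: "x 1 = 1" and vals: "\<And>a. x a = 0 \<or> x a = 1 \<or> x a = -1"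
    and "n > 0"
  shows "(\<Sum>d | d dvd n. x d) \<ge> 0 \<and> ((\<forall>p. prime p \<longrightarrow> even (multiplicity p n)) \<longrightarrow> (\<Sum>d | d dvd n. x d) \<ge> 1)"
  using \<open>n > 0\<close>
proof (induction n rule: less_induct)
  case (less n)
  show ?case
  proof (cases "n = 1")
    case True then show ?thesis using x1 by simp
  next
    case False
    then obtain p where p: "prime p" "p dvd n" using prime_factor_nat by blast
    have pu: "\<not> is_unit p" "p \<noteq> 0" "p > 1" using p(1) prime_gt_1_nat[OF p(1)] by auto
    define a where "a = multiplicity p n"
    obtain m where m: "n = p ^ a * m" "\<not> p dvd m"
      unfolding a_def using multiplicity_decompose'[of n p] less(2) pu by (metis less_irrefl)
    have "a > 0" using p m by (cases a) auto
    have m0: "m > 0" using m less(2) by (cases m) auto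
    have "m < n" using m m0 pu \<open>a > 0\<close> one_less_power[of p a] by simp
    note IH = less(1)[OF this m0]
    have xp: "x (p ^ i) = x p ^ i" for i by (induction i) (use mult x1 in auto)
    have eq: "(\<Sum>d | d dvd n. x d) = (\<Sum>i\<le>a. x p ^ i) * (\<Sum>d | d dvd m. x d)"
      unfolding m(1) sum_divisors_prime_power_times[OF p(1) m(2) m0]
      by (simp add: mult xp sum_product)
    have g: "(\<Sum>i\<le>k. x p ^ i) \<ge> 0 \<and> (even k \<longrightarrow> (\<Sum>i\<le>k. x p ^ i) \<ge> 1)" for k
    proof -
      consider "x p = 0" | "x p = 1" | "x p = -1" using vals by blast
      then show ?thesis
      proof cases
        case 1 then show ?thesis by (simp add: power_0_left sum.delta)
      next
        case 2 then show ?thesis by simp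
      next
        case 3
        have "(\<Sum>i\<le>k. (-1::real) ^ i) = (if even k then 1 else 0)" by (induction k) auto
        then show ?thesis using 3 by simp
      qed
    qed
    have "(\<Sum>d | d dvd n. x d) \<ge> 1" if ev: "\<forall>r. prime r \<longrightarrow> even (multiplicity r n)"
    proof -
      have "even (multiplicity r m)" if "prime r" for r
      proof (cases "r = p")
        case True then show ?thesis using m(2) by (simp add: not_dvd_imp_multiplicity_0)
      next
        case False
        then have "multiplicity r n = multiplicity r m"
          using that p(1) m m0 pu by (simp add: prime_elem_multiplicity_mult_distrib multiplicity_distinct_prime_power)
        then show ?thesis using ev that by metis
      qed
      then have "(\<Sum>d | d dvd m. x d) \<ge> 1" using IH by blast
      moreover have "(\<Sum>i\<le>a. x p ^ i) \<ge> 1" using g ev p(1) unfolding a_def by blast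
      ultimately have "1 * 1 \<le> (\<Sum>i\<le>a. x p ^ i) * (\<Sum>d | d dvd m. x d)" by (intro mult_mono) auto
      then show ?thesis using eq by simp
    qed
    moreover have "(\<Sum>d | d dvd n. x d) \<ge> 0" unfolding eq using g IH by (intro mult_nonneg_nonneg) auto
    ultimately show ?thesis by blast
  qed
qed

text \<open>Pair the terms \<open>i\<close> and \<open>n - 1 - i\<close>, whose product is fixed,
  and apply the inequality of arithmetic and geometric means. It is stated in the square root
  \<open>u\<close> of the ratio to keep the exponents integral.\<close>

lemma geometric_sum_ge:
  fixes u :: real assumes "0 < u" "n > 0"
  shows "(\<Sum>i<n. (u ^ 2) ^ i) \<ge> real n * u ^ (n - 1)"
proof -
  have "(\<Sum>i<n. (u ^ 2) ^ i) = (\<Sum>i<n. (u ^ 2) ^ (n - Suc i))"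
    by (rule sum.nat_diff_reindex[symmetric])
  then have "2 * (\<Sum>i<n. (u ^ 2) ^ i) = (\<Sum>i<n. (u ^ 2) ^ i + (u ^ 2) ^ (n - Suc i))"
    by (simp add: sum.distrib)
  also have "\<dots> \<ge> (\<Sum>i<n. 2 * u ^ (n - 1))"
  proof (rule sum_mono)
    fix i assume "i \<in> {..<n}"
    then have "u ^ i * u ^ (n - Suc i) = u ^ (n - 1)" by (simp flip: power_add)
    moreover have "(u ^ 2) ^ i = (u ^ i) ^ 2" "(u ^ 2) ^ (n - Suc i) = (u ^ (n - Suc i)) ^ 2"
      by (simp_all add: power_mult[symmetric] mult.commute)
    ultimately show "2 * u ^ (n - 1) \<le> (u ^ 2) ^ i + (u ^ 2) ^ (n - Suc i)"
      using sum_squares_bound[of "u ^ i" "u ^ (n - Suc i)"] by simp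
  qed
  finally show ?thesis by simp
qed

text \<open>Monsky's argument for real characters: if the value at \<open>1\<close> vanished, the Lambert series
  \<open>\<Sum>n. \<xi> n * t^n / (1 - t^n)\<close> would stay bounded as \<open>t\<close> tends to \<open>1\<close>, because subtracting \<open>1 / (n * (1 - t))\<close>
  leaves monotone weights; but its coefficients are nonnegative, and at least \<open>1\<close> at squares.\<close>

definition lambert_weight :: "real \<Rightarrow> nat \<Rightarrow> real" where
  "lambert_weight t n = 1 / real n - t ^ n / (\<Sum>i<n. t ^ i)"

text \<open>With \<open>s n\<close> the geometric sum, \<open>s (n + 1) = 1 + t * s n\<close> makes
  consecutive values of \<open>t ^ n / s n\<close> differ by exactly
  \<open>t ^ n / (s n * s (n + 1))\<close>. Monotonicity is thus the comparison of this with
  \<open>1 / (n * (n + 1))\<close>, which follows from \<open>geometric_sum_ge\<close> at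
  \<open>u = sqrt t\<close>.\<close>

lemma lambert_weight:
  assumes "0 < t" "t < 1" "n \<ge> 1"
  shows "lambert_weight t n \<ge> 0" "lambert_weight t (Suc n) \<le> lambert_weight t n"
proof -
  define s where "s n = (\<Sum>i<n. t ^ i)" for n
  have sge: "s n \<ge> real n * t ^ n"
  proof -
    have "(\<Sum>i<n. t ^ n) \<le> s n"
      unfolding s_def using assms by (intro sum_mono power_decreasing) auto
    then show ?thesis by simp
  qed
  have spos: "s k > 0" if "k \<ge> 1" for k
  proof -
    have "0 \<in> {..<k}" using that by auto
    then have "{..<k} \<noteq> {}" by blast
    then show ?thesis unfolding s_def using assms by (intro sum_pos) auto
  qed
  show "lambert_weight t n \<ge> 0"
    using sge spos[of n] assms unfolding lambert_weight_def s_def[symmetric] by (simp add: field_simps)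
  have sS: "s (Suc n) = 1 + t * s n"
    unfolding s_def by (subst sum.lessThan_Suc_shift) (simp add: sum_distrib_left)
  define u where "u = sqrt t"
  have u: "0 < u" "u ^ 2 = t" "u < 1" using assms by (auto simp: u_def)
  have "s n \<ge> real n * u ^ (n - 1)" "s (Suc n) \<ge> real (Suc n) * u ^ n"
    using geometric_sum_ge[OF u(1), of n] geometric_sum_ge[OF u(1), of "Suc n"] assms unfolding s_def u(2) by auto
  then have "(real n * u ^ (n - 1)) * (real (Suc n) * u ^ n) \<le> s n * s (Suc n)"
    using u spos[of n] assms by (intro mult_mono) auto
  moreover have "t ^ n \<le> u ^ (n - 1) * u ^ n"
  proof -
    have "t ^ n = u ^ (2 * n)" by (simp add: u(2)[symmetric] power_mult)
    also have "\<dots> \<le> u ^ (n - 1 + n)" using u by (intro power_decreasing) auto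
    finally show ?thesis by (simp add: power_add)
  qed
  ultimately have key: "real n * real (Suc n) * t ^ n \<le> s n * s (Suc n)"
  proof -
    have "real n * real (Suc n) * t ^ n \<le> real n * real (Suc n) * (u ^ (n - 1) * u ^ n)"
      using \<open>t ^ n \<le> u ^ (n - 1) * u ^ n\<close> by (intro mult_left_mono) auto
    also have "\<dots> = (real n * u ^ (n - 1)) * (real (Suc n) * u ^ n)" by (simp only: mult_ac)
    also have "\<dots> \<le> s n * s (Suc n)" by fact
    finally show ?thesis .
  qed
  have "t ^ n / s n - t ^ Suc n / s (Suc n) = t ^ n / (s n * s (Suc n))"
  proof -
    have "t ^ n / s n - t ^ Suc n / s (Suc n) = (t ^ n * s (Suc n) - t ^ Suc n * s n) / (s n * s (Suc n))"
      using spos[of n] spos[of "Suc n"] assms by (simp add: diff_frac_eq del: power_Suc)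
    also have "t ^ n * s (Suc n) - t ^ Suc n * s n = t ^ n" by (simp add: sS algebra_simps)
    finally show ?thesis .
  qed
  also have "\<dots> \<le> 1 / (real n * real (Suc n))"
    using key spos[of n] spos[of "Suc n"] assms by (simp add: divide_simps mult_ac del: of_nat_Suc)
  also have "\<dots> = 1 / real n - 1 / real (Suc n)" using assms by (simp add: field_simps)
  finally show "lambert_weight t (Suc n) \<le> lambert_weight t n"
    unfolding lambert_weight_def s_def[symmetric] by linarith
qed

lemma L_one_real_nonzero:
  assumes "q > 0" "dchar q \<xi>" "\<xi> \<noteq> principal_dchar q" "\<And>n. cnj (\<xi> n) = \<xi> n"
  shows "L_one q \<xi> \<noteq> 0"
proof
  assume L0: "L_one q \<xi> = 0"
  define x where "x n = Re (\<xi> n)" for n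
  have \<xi>x: "\<xi> n = of_real (x n)" for n
    using assms(4)[of n] unfolding x_def by (metis Reals_cnj_iff of_real_Re)
  have mult: "x (a * b) = x a * x b" for a b
    using dchar_mult[OF assms(2), of a b] by (simp add: \<xi>x flip: of_real_mult)
  have x1: "x 1 = 1" using dchar_1[OF assms(2)] by (simp add: x_def)
  have vals: "x a = 0 \<or> x a = 1 \<or> x a = -1" for a
  proof (cases "coprime a q")
    case True
    then have "\<bar>x a\<bar> = 1" using norm_dchar[OF assms(2) True assms(1)] by (simp add: \<xi>x)
    then show ?thesis by linarith
  next
    case False
    then have "\<xi> a = 0" using dchar_eq_0_iff[OF assms(2)] by blast
    then show ?thesis by (simp add: x_def)
  qed
  note r = real_dchar_divisor_sum[of x, OF mult x1 vals]
  \<comment> \<open>The bound is first proved for truncations at \<open>N\<close> with two error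
    terms that vanish as \<open>N\<close> grows for fixed \<open>t\<close>; only afterwards does
    \<open>t\<close> tend to 1.\<close>
  have bnd: "(\<Sum>k=1..M. t ^ (k ^ 2)) \<le> 2 * real q" if t: "0 < t" "t < 1" for t :: real and M :: nat
  proof -
    have ub: "(\<Sum>k=1..M. t ^ (k ^ 2)) \<le> 2 * real q + 2 * real q / ((real N + 1) * (1 - t)) + real N * t ^ N / (1 - t)"
      if N: "N \<ge> M ^ 2" for N
    proof -
      let ?r = "\<lambda>n. \<Sum>d | d dvd n. x d"
      have "(\<Sum>k=1..M. t ^ (k ^ 2)) = (\<Sum>n\<in>(\<lambda>k. k ^ 2) ` {1..M}. t ^ n)"
        by (subst sum.reindex) (auto simp: inj_on_def)
      also have "\<dots> \<le> (\<Sum>n\<in>(\<lambda>k. k ^ 2) ` {1..M}. ?r n * t ^ n)"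
      proof (rule sum_mono)
        fix n assume "n \<in> (\<lambda>k. k ^ 2) ` {1..M}"
        then obtain k where k: "n = k ^ 2" "k \<ge> 1" by auto
        then have "\<forall>p. prime p \<longrightarrow> even (multiplicity p n)"
          by (auto simp: prime_elem_multiplicity_power_distrib)
        then have "?r n \<ge> 1" using r[of n] k by auto
        then show "t ^ n \<le> ?r n * t ^ n" using t by simp
      qed
      also have "\<dots> \<le> (\<Sum>n=1..N. ?r n * t ^ n)"
      proof (rule sum_mono2)
        show "(\<lambda>k. k ^ 2) ` {1..M} \<subseteq> {1..N}"
        proof
          fix n assume "n \<in> (\<lambda>k. k ^ 2) ` {1..M}"
          then obtain k where k: "n = k ^ 2" "k \<ge> 1" "k \<le> M" by auto
          then have "k ^ 2 \<le> N" using power_mono[of k M 2] N by linarith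
          then show "n \<in> {1..N}" using k N by auto
        qed
      qed (use r t in auto)
      also have "\<dots> = (\<Sum>n=1..N. \<Sum>d | d dvd n. x d * t ^ (d * (n div d)))"
        unfolding sum_distrib_right by (intro sum.cong refl) auto
      also have "\<dots> = (\<Sum>m=1..N. \<Sum>k=1..N div m. x m * t ^ (m * k))"
        by (rule sum_divisors_swap)
      \<comment> \<open>Completing each inner geometric sum to infinity adds only exponents beyond
        \<open>N\<close>, which costs at most \<open>t ^ N / (1 - t)\<close> whatever the sign of
        \<open>x m\<close>.\<close>
      also have "\<dots> \<le> (\<Sum>m=1..N. x m * (t ^ m / (1 - t ^ m)) + t ^ N / (1 - t))"
      proof (rule sum_mono)
        fix m assume m: "m \<in> {1..N}"
        let ?K = "N div m"
        have tm: "t ^ m < 1" "t ^ m \<le> t" "t ^ m > 0" using t m power_Suc_less_one[of t "m - 1"] power_decreasing[of 1 m t] by auto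
        have "(\<Sum>k=1..?K. (t ^ m) ^ k) = (t ^ m - (t ^ m) ^ Suc ?K) / (1 - t ^ m)"
          using tm sum_gp[of "t ^ m" 1 ?K] by (cases "?K < 1") (auto simp: )
        then have 1: "(\<Sum>k=1..?K. t ^ (m * k)) = t ^ m / (1 - t ^ m) - t ^ (m * Suc ?K) / (1 - t ^ m)"
          by (simp only: power_mult diff_divide_distrib)
        have "N < m * Suc ?K" using m by (simp add: dividend_less_times_div)
        then have "t ^ (m * Suc ?K) \<le> t ^ N" using t by (intro power_decreasing) auto
        then have 2: "t ^ (m * Suc ?K) / (1 - t ^ m) \<le> t ^ N / (1 - t)" using tm t by (intro frac_le) auto
        have 3: "0 \<le> t ^ (m * Suc ?K) / (1 - t ^ m)" using tm t by auto
        have "(\<Sum>k=1..?K. x m * t ^ (m * k)) = x m * (t ^ m / (1 - t ^ m)) - x m * (t ^ (m * Suc ?K) / (1 - t ^ m))"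
          unfolding sum_distrib_left[symmetric] 1 by (rule right_diff_distrib)
        also have "\<dots> \<le> x m * (t ^ m / (1 - t ^ m)) + t ^ (m * Suc ?K) / (1 - t ^ m)"
          using vals[of m] 3 by auto
        finally show "(\<Sum>k=1..?K. x m * t ^ (m * k)) \<le> x m * (t ^ m / (1 - t ^ m)) + t ^ N / (1 - t)" using 2 by linarith
      qed
      also have "\<dots> = (\<Sum>m=1..N. x m * (t ^ m / (1 - t ^ m))) + real N * t ^ N / (1 - t)"
        by (simp add: sum.distrib)
      also have "(\<Sum>m=1..N. x m * (t ^ m / (1 - t ^ m))) = ((\<Sum>m=1..N. x m / real m) - (\<Sum>m=1..N. lambert_weight t m * x m)) / (1 - t)"
        unfolding sum_subtractf[symmetric] sum_divide_distrib
      proof (intro sum.cong refl)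
        fix m assume "m \<in> {1..N}"
        have "1 - t ^ m = (1 - t) * (\<Sum>i<m. t ^ i)" by (rule one_diff_power_eq)
        then show "x m * (t ^ m / (1 - t ^ m)) = (x m / real m - lambert_weight t m * x m) / (1 - t)"
          by (simp add: lambert_weight_def algebra_simps)
      qed
      finally have main: "(\<Sum>k=1..M. t ^ (k ^ 2)) \<le> ((\<Sum>m=1..N. x m / real m) - (\<Sum>m=1..N. lambert_weight t m * x m)) / (1 - t) + real N * t ^ N / (1 - t)" .
      \<comment> \<open>The assumed zero enters here: the partial sum of \<open>x m / m\<close> is
        then only a tail.\<close>
      have X: "(\<Sum>m=1..N. x m / real m) \<le> 2 * real q / (real N + 1)"
      proof -
        have "(\<Sum>m=1..N. \<xi> m / of_nat m) = of_real (\<Sum>m=1..N. x m / real m)" by (simp add: \<xi>x)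
        then have "norm (\<Sum>m=1..N. \<xi> m / of_nat m) = \<bar>\<Sum>m=1..N. x m / real m\<bar>" by (simp only: norm_of_real)
        then show ?thesis using L_one_tail[OF assms(2,1,3), of N] L0 by simp
      qed
      \<comment> \<open>Abel summation bounds the sum by \<open>2 * q\<close> times the first
        weight, and \<open>lambert_weight t 1 = 1 - t\<close> cancels the denominator
        \<open>1 - t\<close>.\<close>
      have Y: "- (\<Sum>m=1..N. lambert_weight t m * x m) \<le> 2 * real q * (1 - t)"
      proof -
        have "norm (\<Sum>m=1..<Suc N. of_real (lambert_weight t m) * \<xi> m) \<le> 2 * real q * lambert_weight t 1"
          by (rule norm_abel_sum_le[OF norm_sum_dchar_le[OF assms(2,1,3)]]) (use lambert_weight t in auto)
        moreover have "(\<Sum>m=1..<Suc N. of_real (lambert_weight t m) * \<xi> m) = of_real (\<Sum>m=1..N. lambert_weight t m * x m)"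
          by (simp add: \<xi>x atLeastLessThanSuc_atLeastAtMost)
        ultimately have "\<bar>\<Sum>m=1..N. lambert_weight t m * x m\<bar> \<le> 2 * real q * lambert_weight t 1" by (simp only: norm_of_real)
        then show ?thesis by (simp add: lambert_weight_def)
      qed
      have "((\<Sum>m=1..N. x m / real m) - (\<Sum>m=1..N. lambert_weight t m * x m)) / (1 - t)
          \<le> (2 * real q / (real N + 1) + 2 * real q * (1 - t)) / (1 - t)"
        using X Y t by (intro divide_right_mono) auto
      also have "\<dots> = 2 * real q + 2 * real q / ((real N + 1) * (1 - t))"
        using t by (simp add: add_divide_distrib)
      finally show ?thesis using main by linarith
    qed
    have "(\<lambda>N. 2 * real q + 2 * real q / ((real N + 1) * (1 - t)) + real N * t ^ N / (1 - t)) \<longlonglongrightarrow> 2 * real q + 0 + 0 / (1 - t)"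
    proof (intro tendsto_intros)
      show "(\<lambda>N. 2 * real q / ((real N + 1) * (1 - t))) \<longlonglongrightarrow> 0" using t by real_asymp
      show "(\<lambda>N. real N * t ^ N) \<longlonglongrightarrow> 0" using t powser_times_n_limit_0[of t] by simp
    qed (use t in auto)
    then have "(\<lambda>N. 2 * real q + 2 * real q / ((real N + 1) * (1 - t)) + real N * t ^ N / (1 - t)) \<longlonglongrightarrow> 2 * real q" by simp
    then show ?thesis
      by (rule tendsto_lowerbound) (use ub in \<open>auto intro!: eventually_mono[OF eventually_ge_at_top[of "M ^ 2"]]\<close>)
  qed
  \<comment> \<open>At \<open>t = 1\<close> the sum of \<open>M\<close> powers equals
    \<open>M\<close>, so any \<open>M\<close> above \<open>2 * q\<close> yields the
    contradiction.\<close>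
  define M where "M = 2 * q + 1"
  have "((\<lambda>t::real. \<Sum>k=1..M. t ^ (k ^ 2)) \<longlongrightarrow> (\<Sum>k=1..M. 1 ^ (k ^ 2))) (at_left 1)"
    by (intro tendsto_intros)
  then have "(\<Sum>k=1..M. 1 ^ (k ^ 2)) \<le> 2 * real q"
  proof (rule tendsto_upperbound)
    have "\<forall>\<^sub>F t in at_left (1::real). t \<in> {0<..<1}" by (rule eventually_at_left_real) simp
    then show "\<forall>\<^sub>F t in at_left (1::real). (\<Sum>k=1..M. t ^ (k ^ 2)) \<le> 2 * real q"
      by eventually_elim (use bnd in auto)
  qed simp
  then show False by (simp add: M_def)
qed

text \<open>Conjugation turns a zero at \<open>\<xi>\<close> into one at its conjugate. Since at
  most one nonprincipal character vanishes at 1, \<open>\<xi>\<close> would be real, a case already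
  excluded.\<close>

lemma L_one_nonzero:
  assumes "q > 0" "dchar q \<xi>" "\<xi> \<noteq> principal_dchar q"
  shows "L_one q \<xi> \<noteq> 0"
proof
  assume L0: "L_one q \<xi> = 0"
  have "(\<lambda>n. cnj (\<xi> n)) = \<xi>"
    using L_one_cnj[OF assms(2,1,3)] L0 by (intro at_most_one_zero[OF assms(1)] dchar_cnj assms) auto
  then have "cnj (\<xi> n) = \<xi> n" for n by metis
  then show False using L_one_real_nonzero[OF assms] L0 by blast
qed

text \<open>By orthogonality the class of \<open>a\<close> is an average over characters; the
  principal one carries \<open>ln N\<close>, and nonvanishing at 1 keeps all others bounded.\<close>

theorem mertens_arithmetic_progression:
  assumes "q > 0" "coprime a q"
  shows "\<exists>C. \<forall>N\<ge>1. (\<Sum>n | n \<in> {1..N} \<and> [n = a] (mod q). mangoldt n / real n) \<ge> ln (real N) / real (totient q) - C"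
proof -
  let ?X = "{\<xi>. dchar q \<xi>}"
  have fin: "finite ?X" by (rule finite_dchars[OF assms(1)])
  obtain C0 where C0: "\<And>N. N \<ge> 1 \<Longrightarrow> Re (mangoldt_dchar_sum (principal_dchar q) N) \<ge> ln (real N) - C0"
    using Re_mangoldt_principal_ge[OF assms(1)] by blast
  have "\<exists>C. \<forall>N. norm (mangoldt_dchar_sum \<theta> N) \<le> C" if "\<theta> \<in> ?X - {principal_dchar q}" for \<theta>
    using that mangoldt_dchar_sum_bounded L_one_nonzero assms(1) by blast
  then obtain C where C: "\<And>\<theta> N. \<theta> \<in> ?X - {principal_dchar q} \<Longrightarrow> norm (mangoldt_dchar_sum \<theta> N) \<le> C \<theta>" by metis
  let ?S = "\<lambda>N. \<Sum>n | n \<in> {1..N} \<and> [n = a] (mod q). mangoldt n / real n"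
  let ?C = "C0 + sum C (?X - {principal_dchar q})"
  have tot: "real (totient q) \<ge> 1" using assms(1) by (simp add: Suc_le_eq totient_gt_0_iff)
  have aux: "(l - c) / t \<le> s" if "l - c \<le> t * s" "t \<ge> 1" for l c s t :: real
    using that by (simp add: divide_le_eq mult.commute)
  have "?S N \<ge> ln (real N) / real (totient q) - ?C / real (totient q)" if N: "N \<ge> 1" for N
  proof -
    have "real (totient q) * ?S N = Re (\<Sum>\<theta>\<in>?X. cnj (\<theta> a) * mangoldt_dchar_sum \<theta> N)"
      unfolding sum_dchars_mangoldt[OF assms] by simp
    also have "(\<Sum>\<theta>\<in>?X. cnj (\<theta> a) * mangoldt_dchar_sum \<theta> N) = cnj (principal_dchar q a) * mangoldt_dchar_sum (principal_dchar q) N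
        + (\<Sum>\<theta>\<in>?X - {principal_dchar q}. cnj (\<theta> a) * mangoldt_dchar_sum \<theta> N)"
      using fin dchar_principal by (intro sum.remove) auto
    also have "cnj (principal_dchar q a) = 1" using assms(2) by (simp add: principal_dchar_def)
    finally have eq: "real (totient q) * ?S N = Re (mangoldt_dchar_sum (principal_dchar q) N) + Re (\<Sum>\<theta>\<in>?X - {principal_dchar q}. cnj (\<theta> a) * mangoldt_dchar_sum \<theta> N)"
      by simp
    have "norm (\<Sum>\<theta>\<in>?X - {principal_dchar q}. cnj (\<theta> a) * mangoldt_dchar_sum \<theta> N) \<le> sum C (?X - {principal_dchar q})"
    proof (rule sum_norm_le)
      fix \<theta> assume \<theta>: "\<theta> \<in> ?X - {principal_dchar q}"
      then have "norm (\<theta> a) = 1" using norm_dchar assms by auto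
      then show "norm (cnj (\<theta> a) * mangoldt_dchar_sum \<theta> N) \<le> C \<theta>" using C[OF \<theta>] by (simp add: norm_mult)
    qed
    then have "Re (\<Sum>\<theta>\<in>?X - {principal_dchar q}. cnj (\<theta> a) * mangoldt_dchar_sum \<theta> N) \<ge> - sum C (?X - {principal_dchar q})"
      using abs_Re_le_cmod[of "\<Sum>\<theta>\<in>?X - {principal_dchar q}. cnj (\<theta> a) * mangoldt_dchar_sum \<theta> N"] by linarith
    then have "real (totient q) * ?S N \<ge> ln (real N) - ?C" using eq C0[OF N] by linarith
    then have "(ln (real N) - ?C) / real (totient q) \<le> ?S N"
      by (rule aux) (rule tot)
    then show ?thesis by (simp add: diff_divide_distrib)
  qed
  then show ?thesis by blast
qed

section \<open>The mean of \<open>1/gcd(d, a - 1)\<close> over the units\<close>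

definition gcd_mean :: "nat \<Rightarrow> real" where
  "gcd_mean d = (\<Sum>a\<in>totatives d. 1 / real (gcd d (a - 1))) / real (totient d)"

lemma gcd_pred_cong:
  assumes "[a = b] (mod d)" "a \<ge> 1" "b \<ge> 1"
  shows "gcd d (a - 1) = gcd d (b - (1::nat))"
proof -
  have "[a - 1 + 1 = b - 1 + 1] (mod d)" using assms by simp
  then have "[a - 1 = b - 1] (mod d)" by (simp only: cong_add_rcancel_nat)
  then show ?thesis using cong_gcd_eq[of "a - 1" "b - 1" d] by (simp add: gcd.commute)
qed

lemma gcd_coprime_mult:
  fixes m n x :: nat
  assumes "coprime m n" shows "gcd (m * n) x = gcd m x * gcd n x"
proof (rule dvd_antisym)
  obtain b c where bc: "gcd (m * n) x = b * c" "b dvd m" "c dvd n"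
    using division_decomp[of "gcd (m * n) x" m n] by auto
  then have "b dvd x" "c dvd x" by (metis dvd_mult_left gcd_dvd2, metis dvd_mult_right gcd_dvd2)
  then show "gcd (m * n) x dvd gcd m x * gcd n x" unfolding bc(1) using bc by (intro mult_dvd_mono) auto
  have "coprime (gcd m x) (gcd n x)" using assms by (meson coprime_divisors gcd_dvd1)
  then show "gcd m x * gcd n x dvd gcd (m * n) x" by (intro gcd_greatest mult_dvd_mono divides_mult) auto
qed

text \<open>The Chinese remainder bijection of totatives splits the sum, because the gcd with a
  product of coprime factors is the product of the gcds.\<close>

lemma gcd_mean_mult:
  assumes "m > 1" "n > 1" "coprime m n"
  shows "gcd_mean (m * n) = gcd_mean m * gcd_mean n"
proof -
  have tm: "x mod m \<ge> 1" "x mod n \<ge> 1" "x \<ge> 1" if "x \<in> totatives (m * n)" for x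
  proof -
    have "(x mod m, x mod n) \<in> totatives m \<times> totatives n"
      using bij_betwE[OF bij_betw_totatives[OF assms]] that by blast
    then show "x mod m \<ge> 1" "x mod n \<ge> 1" by (auto simp: totatives_def)
    show "x \<ge> 1" using that by (auto simp: totatives_def)
  qed
  have "(\<Sum>a\<in>totatives (m * n). 1 / real (gcd (m * n) (a - 1))) =
     (\<Sum>a\<in>totatives (m * n). (\<lambda>(b,c). 1 / real (gcd m (b - 1)) * (1 / real (gcd n (c - 1)))) (a mod m, a mod n))"
  proof (intro sum.cong refl)
    fix a assume a: "a \<in> totatives (m * n)"
    have "gcd m (a mod m - 1) = gcd m (a - 1)" "gcd n (a mod n - 1) = gcd n (a - 1)"
      using tm[OF a] by (intro gcd_pred_cong; simp add: unique_euclidean_semiring_class.cong_def)+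
    moreover have "gcd (m * n) (a - 1) = gcd m (a - 1) * gcd n (a - 1)"
      by (rule gcd_coprime_mult[OF assms(3)])
    ultimately show "1 / real (gcd (m * n) (a - 1)) = (\<lambda>(b,c). 1 / real (gcd m (b - 1)) * (1 / real (gcd n (c - 1)))) (a mod m, a mod n)"
      by simp
  qed
  also have "\<dots> = (\<Sum>(b,c)\<in>totatives m \<times> totatives n. 1 / real (gcd m (b - 1)) * (1 / real (gcd n (c - 1))))"
    by (rule sum.reindex_bij_betw[OF bij_betw_totatives[OF assms]])
  also have "\<dots> = (\<Sum>b\<in>totatives m. 1 / real (gcd m (b - 1))) * (\<Sum>c\<in>totatives n. 1 / real (gcd n (c - 1)))"
    by (simp add: sum_product sum.cartesian_product)
  finally show ?thesis using assms(3) by (simp add: gcd_mean_def totient_mult_coprime)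
qed

text \<open>Residues prime to \<open>p\<close> contribute 1 each, and the others are
  \<open>p\<close> times a residue modulo the next lower power. With S m for the sum this is the
  recursion S (m + 1) = p^(m + 1) - p^m + S m / p, which the closed form solves.\<close>

lemma sum_inverse_gcd_prime_power:
  assumes "prime p"
  shows "(\<Sum>b<p^m. 1 / real (gcd (p^m) b)) = real p ^ m - (real p ^ (2*m) - 1) / (real p ^ m * (real p + 1))"
proof (induction m)
  case (Suc m)
  have p: "p > 0" "p > 1" using assms prime_gt_0_nat prime_gt_1_nat by auto
  let ?M = "(\<lambda>b. p * b) ` {..<p^m}"
  have M: "?M = {b\<in>{..<p^Suc m}. p dvd b}" using p by (auto elim!: dvdE)
  have inj: "inj_on (\<lambda>b. p * b) {..<p^m}" using p by (auto simp: inj_on_def)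
  have sub: "?M \<subseteq> {..<p^Suc m}" using M by blast
  have "(\<Sum>b<p^Suc m. 1 / real (gcd (p^Suc m) b)) = (\<Sum>b\<in>{..<p^Suc m} - ?M. 1 / real (gcd (p^Suc m) b)) + (\<Sum>b\<in>?M. 1 / real (gcd (p^Suc m) b))"
    by (rule sum.subset_diff[OF sub]) simp
  also have "(\<Sum>b\<in>{..<p^Suc m} - ?M. 1 / real (gcd (p^Suc m) b)) = (\<Sum>b\<in>{..<p^Suc m} - ?M. 1)"
  proof (intro sum.cong refl)
    fix b assume "b \<in> {..<p^Suc m} - ?M"
    then have "\<not> p dvd b" using M by auto
    then have "coprime (p ^ Suc m) b" using assms by (simp add: prime_imp_coprime)
    then show "1 / real (gcd (p^Suc m) b) = 1" by simp
  qed
  also have "\<dots> = real (card ({..<p^Suc m} - ?M))" by simp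
  also have "card ({..<p^Suc m} - ?M) = p ^ Suc m - p ^ m"
    using sub card_image[OF inj] by (simp add: card_Diff_subset del: power_Suc)
  also have "real (p ^ Suc m - p ^ m) = real p * real p ^ m - real p ^ m"
    using p by (subst of_nat_diff) (auto simp: power_increasing)
  also have "(\<Sum>b\<in>?M. 1 / real (gcd (p^Suc m) b)) = (\<Sum>b<p^m. 1 / real (gcd (p^m) b)) / real p"
    unfolding sum_divide_distrib
    by (subst sum.reindex[OF inj], intro sum.cong refl)
       (simp only: o_def power_Suc gcd_mult_distrib_nat[symmetric] of_nat_mult divide_divide_eq_left, simp only: mult.commute)
  also have "(\<Sum>b<p^m. 1 / real (gcd (p^m) b)) = real p ^ m - (real p ^ (2*m) - 1) / (real p ^ m * (real p + 1))"
    by (rule Suc)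
  finally have e: "(\<Sum>b<p^Suc m. 1 / real (gcd (p^Suc m) b)) = real p * real p ^ m - real p ^ m +
    (real p ^ m - ((real p ^ m)^2 - 1) / (real p ^ m * (real p + 1))) / real p" by (simp add: power_mult mult.commute)
  \<comment> \<open>The recursion step as an identity of rational functions, to be read with
    \<open>x = p ^ m\<close> and \<open>y = p\<close>.\<close>
  have "y * x - x + (x - (x^2 - 1) / (x * (y + 1))) / y = y * x - (y^2 * x^2 - 1) / ((y * x) * (y + 1))" if "x > 0" "y > 0" for x y :: real
  proof -
    have D: "(y * x) * (y + 1) \<noteq> 0" using that by auto
    have "x / y = x^2 * (y + 1) / ((y * x) * (y + 1))"
      using that by (subst nonzero_eq_divide_eq[OF D]) (simp add: power2_eq_square)
    moreover have "x = x * (y * x) * (y + 1) / ((y * x) * (y + 1))"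
      by (subst nonzero_eq_divide_eq[OF D]) (simp only: mult_ac)
    moreover have "(x - (x^2 - 1) / (x * (y + 1))) / y = x / y - (x^2 - 1) / ((y * x) * (y + 1))"
      by (simp add: diff_divide_distrib mult_ac)
    ultimately have "- x + (x - (x^2 - 1) / (x * (y + 1))) / y = (- (x * (y * x) * (y + 1)) + x^2 * (y + 1) - (x^2 - 1)) / ((y * x) * (y + 1))"
      by (simp add: diff_divide_distrib add_divide_distrib)
    also have "- (x * (y * x) * (y + 1)) + x^2 * (y + 1) - (x^2 - 1) = - (y^2 * x^2 - 1)"
      by (simp add: algebra_simps power2_eq_square)
    finally show ?thesis by (simp add: minus_divide_left)
  qed
  from this[of "real p ^ m" "real p"] show ?case using p unfolding e
    by (simp add: power_mult[symmetric] power_mult_distrib mult.commute flip: power_mult) (simp add: power_add power2_eq_square power_mult_distrib mult_ac power_mult)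
qed simp

text \<open>Substituting \<open>b = a - 1\<close>, the sum over all residues is already known. The
  non-units \<open>a\<close> are multiples of \<open>p\<close>, so \<open>a - 1\<close> is prime to
  \<open>p\<close> and each of them removes exactly 1.\<close>

lemma gcd_mean_prime_power:
  assumes "prime p" "m > 0" shows "gcd_mean (p ^ m) = delta (p ^ m)"
proof -
  have p: "p > 0" "p > 1" using assms prime_gt_0_nat prime_gt_1_nat by auto
  obtain k where k: "m = Suc k" using assms(2) by (cases m) auto
  let ?g = "\<lambda>a. 1 / real (gcd (p^m) (a - 1))"
  let ?M = "(\<lambda>b. p * b) ` {1..p^k}"
  have M: "?M = {b\<in>{1..p^m}. p dvd b}" using p by (auto simp: k elim!: dvdE)
  have inj: "inj_on (\<lambda>b. p * b) {1..p^k}" using p by (auto simp: inj_on_def)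
  have "totatives (p^m) = {1..p^m} - ?M"
    unfolding M totatives_def using assms by (auto simp: coprime_power_right_iff prime_imp_coprime coprime_commute[of _ p] prime_nat_not_dvd coprime_absorb_left)
  moreover have "(\<Sum>a\<in>{1..p^m}. ?g a) = (\<Sum>a\<in>{1..p^m} - ?M. ?g a) + (\<Sum>a\<in>?M. ?g a)"
    by (rule sum.subset_diff) (use M in auto)
  moreover have "(\<Sum>a\<in>?M. ?g a) = (\<Sum>a\<in>?M. 1)"
  proof (intro sum.cong refl)
    fix a assume "a \<in> ?M"
    then have a: "a \<ge> 1" "p dvd a" using M by auto
    have "\<not> p dvd a - 1"
    proof
      assume "p dvd a - 1"
      from dvd_diff_nat[OF a(2) this] have "p dvd a - (a - 1)" .
      moreover have "a - (a - 1) = 1" using a by simp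
      ultimately show False using p by simp
    qed
    then have "coprime (p ^ m) (a - 1)" using assms by (simp add: prime_imp_coprime)
    then show "?g a = 1" by simp
  qed
  moreover have "(\<Sum>a\<in>?M. 1 :: real) = real p ^ k" using card_image[OF inj] by simp
  moreover have "(\<Sum>a\<in>{1..p^m}. ?g a) = (\<Sum>b<p^m. 1 / real (gcd (p^m) b))"
    by (rule sum.reindex_bij_witness[of _ Suc "\<lambda>a. a - 1"]) auto
  ultimately have "(\<Sum>a\<in>totatives (p^m). ?g a) = real p ^ m - (real p ^ (2*m) - 1) / (real p ^ m * (real p + 1)) - real p ^ k"
    unfolding sum_inverse_gcd_prime_power[OF assms(1)] by simp
  moreover have "real (totient (p^m)) = real p ^ k * (real p - 1)"
    using assms p by (simp add: k totient_prime_power_Suc of_nat_diff del: power_Suc)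
  \<comment> \<open>To be read with \<open>y = p\<close> and \<open>x = p ^ (m - 1)\<close>.\<close>
  moreover have "y * x - ((y * x)^2 - 1) / (y * x * (y + 1)) - x = (x * (y - 1)) * (1 - ((y * x)^2 - 1) / (y * x^2 * (y^2 - 1)))"
    if "x > 0" "y > 1" for x y :: real
  proof -
    have n: "y^2 - 1 = (y + 1) * (y - 1)" by (simp add: algebra_simps power2_eq_square)
    have "(x * (y - 1)) * (((y * x)^2 - 1) / (y * x^2 * (y^2 - 1))) = ((y * x)^2 - 1) / (y * x * (y + 1))"
      unfolding n using that by (simp add: power2_eq_square)
    then show ?thesis by (simp add: algebra_simps)
  qed
  note id = this[of "real p ^ k" "real p"]
  moreover have "real p ^ m = real p * real p ^ k" "real p ^ (2 * m) = (real p * real p ^ k)^2" "real p ^ (2*m - 1) = real p * (real p ^ k)^2"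
    by (simp_all add: k power_mult[symmetric] power2_eq_square power_add[symmetric] mult_2)
  ultimately show ?thesis
    unfolding delta_prime_power[OF assms] gcd_mean_def using p by simp
qed

text \<open>Prime powers are split off one at a time. The cofactor 1 is a case of its own because
  \<open>gcd_mean_mult\<close> asks for factors greater than 1.\<close>

lemma gcd_mean_eq_delta:
  assumes "d > 0" shows "gcd_mean d = delta d"
  using assms
proof (induction d rule: less_induct)
  case (less d)
  show ?case
  proof (cases "d = 1")
    case True then show ?thesis using delta_one by (simp add: gcd_mean_def)
  next
    case False
    then obtain p where p: "prime p" "p dvd d" using prime_factor_nat by blast
    have pu: "\<not> is_unit p" "p \<noteq> 0" "p > 1" using p(1) prime_gt_1_nat[OF p(1)] by auto
    define a where "a = multiplicity p d"
    obtain m where m: "d = p ^ a * m" "\<not> p dvd m"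
      unfolding a_def using multiplicity_decompose'[of d p] less(2) pu by (metis less_irrefl)
    have "a > 0" using p m by (cases a) auto
    have m0: "m > 0" using m less(2) by (cases m) auto
    have pa: "p ^ a > 1" using pu \<open>a > 0\<close> one_less_power by blast
    have cop: "coprime (p ^ a) m" using p(1) m(2) by (simp add: prime_imp_coprime)
    show ?thesis
    proof (cases "m = 1")
      case True then show ?thesis using gcd_mean_prime_power[OF p(1) \<open>a > 0\<close>] m(1) by simp
    next
      case False
      have "m < d" using m m0 pa by simp
      then have "gcd_mean m = delta m" using less(1) m0 by blast
      moreover have "gcd_mean d = gcd_mean (p ^ a) * gcd_mean m"
        unfolding m(1) using False m0 pa cop by (intro gcd_mean_mult) auto
      moreover have "delta d = delta (p ^ a) * delta m"
        unfolding m(1) using m0 pu cop by (intro delta_mult) auto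
      ultimately show ?thesis using gcd_mean_prime_power[OF p(1) \<open>a > 0\<close>] by simp
    qed
  qed
qed

section \<open>Partial summation and the weighted prime sum\<close>

lemma abel_sum_ge:
  fixes f c :: "nat \<Rightarrow> real"
  assumes D: "\<And>k. a \<le> k \<Longrightarrow> (\<Sum>n=a..<k. f n) \<ge> - D"
    and dec: "\<And>n. a \<le> n \<Longrightarrow> c (Suc n) \<le> c n" and nn: "\<And>n. a \<le> n \<Longrightarrow> 0 \<le> c n" and "a \<le> b"
  shows "(\<Sum>n=a..<b. c n * f n) \<ge> - D * c a"
proof -
  define F where "F k = (\<Sum>n=a..<k. f n)" for k
  have id: "(\<Sum>n=a..<b. c n * f n) = c b * F b + (\<Sum>n=a..<b. (c n - c (Suc n)) * F (Suc n))"
    using \<open>a \<le> b\<close>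
  proof (induction b rule: dec_induct)
    case base then show ?case by (simp add: F_def)
  next
    case (step n)
    then show ?case by (simp add: F_def algebra_simps)
  qed
  have FS: "- D \<le> F (Suc n)" if "a \<le> n" for n
    unfolding F_def using that by (intro D) simp
  have "(\<Sum>n=a..<b. (c n - c (Suc n)) * F (Suc n)) \<ge> (\<Sum>n=a..<b. (c n - c (Suc n)) * (- D))"
    using dec FS by (intro sum_mono mult_left_mono) auto
  moreover have "(\<Sum>n=a..<b. (c n - c (Suc n)) * (- D)) = (c a - c b) * (- D)"
    unfolding sum_distrib_right[symmetric] using sum_Suc_diff'[of a b "\<lambda>n. - c n"] \<open>a \<le> b\<close> by simp
  moreover have "c b * F b \<ge> c b * (- D)"
    using nn[OF \<open>a \<le> b\<close>] D[OF \<open>a \<le> b\<close>] by (intro mult_left_mono) (auto simp: F_def)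
  ultimately show ?thesis unfolding id by (simp add: algebra_simps)
qed

text \<open>Compare \<open>a\<close> with the increments \<open>c * (ln (n + 1) - ln n)\<close>,
  which have the same main term. The difference has partial sums bounded below, so the decreasing
  weights \<open>1 / ln n\<close> preserve this; for the increments, \<open>ln x \<le> x - 1\<close>
  gives a telescoping lower bound in \<open>ln (ln n)\<close>.\<close>

lemma sum_over_ln_ge:
  fixes a :: "nat \<Rightarrow> real"
  assumes c: "c \<ge> 0" and A: "\<And>N. N \<ge> 2 \<Longrightarrow> (\<Sum>n=2..N. a n) \<ge> c * ln (real N) - C"
  shows "\<exists>C'. \<forall>N\<ge>2. (\<Sum>n=2..N. a n / ln (real n)) \<ge> c * ln (ln (real N)) - C'"
proof -
  define D where "D = max C 0"
  let ?b = "\<lambda>n. c * (ln (real (Suc n)) - ln (real n))"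
  have G: "(\<Sum>n=2..<k. a n - ?b n) \<ge> - D" if k: "2 \<le> k" for k
  proof (cases "k = 2")
    case False
    then obtain N where N: "k = Suc N" "N \<ge> 2" using k by (cases k) auto
    have "(\<Sum>n=2..<k. ?b n) = c * (ln (real k) - ln 2)"
      using sum_Suc_diff'[of 2 k "\<lambda>n. ln (real n)"] k by (simp add: sum_distrib_left[symmetric])
    \<comment> \<open>The increments telescope to \<open>k = N + 1\<close>; since
      \<open>N + 1 \<le> 2 * N\<close>, the subtracted \<open>ln 2\<close> absorbs the
      shift.\<close>
    moreover have "ln (real k) - ln 2 \<le> ln (real N)"
    proof -
      have "ln (real k) \<le> ln (2 * real N)" using N by (subst ln_le_cancel_iff) auto
      also have "\<dots> = ln 2 + ln (real N)" using N by (intro ln_mult_pos) auto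
      finally show ?thesis by simp
    qed
    then have "c * (ln (real k) - ln 2) \<le> c * ln (real N)" using c by (rule mult_left_mono)
    moreover have "(\<Sum>n=2..<k. a n) \<ge> c * ln (real N) - C"
      using A[OF N(2)] N by (simp add: atLeastLessThanSuc_atLeastAtMost)
    ultimately show ?thesis by (simp add: sum_subtractf D_def)
  qed (simp add: D_def)
  show ?thesis
  proof (intro exI allI impI)
    fix N :: nat assume N: "N \<ge> 2"
    have "(\<Sum>n=2..<Suc N. 1 / ln (real n) * (a n - ?b n)) \<ge> - D * (1 / ln (real 2))"
    proof (rule abel_sum_ge[OF G])
      show "1 / ln (real (Suc n)) \<le> 1 / ln (real n)" if "2 \<le> n" for n
        using that by (intro divide_left_mono mult_pos_pos) (auto simp: ln_gt_zero)
    qed (use N in auto)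
    then have 1: "(\<Sum>n=2..N. 1 / ln (real n) * (a n - ?b n)) \<ge> - D / ln 2"
      by (simp only: atLeastLessThanSuc_atLeastAtMost) simp
    have "(\<Sum>n=2..N. 1 / ln (real n) * ?b n) \<ge> (\<Sum>n=2..N. c * (ln (ln (real (Suc n))) - ln (ln (real n))))"
    proof (rule sum_mono)
      fix n assume n: "n \<in> {2..N}"
      then have l: "ln (real n) > 0" "ln (real (Suc n)) > 0" by (auto intro!: ln_gt_zero)
      have "ln (ln (real (Suc n))) - ln (ln (real n)) = ln (ln (real (Suc n)) / ln (real n))"
        using l by (simp add: ln_div)
      also have "\<dots> \<le> ln (real (Suc n)) / ln (real n) - 1" using l by (intro ln_le_minus_one) auto
      also have "\<dots> = 1 / ln (real n) * (ln (real (Suc n)) - ln (real n))" using l by (simp add: field_simps)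
      finally have "c * (ln (ln (real (Suc n))) - ln (ln (real n))) \<le> c * (1 / ln (real n) * (ln (real (Suc n)) - ln (real n)))"
        using c by (rule mult_left_mono)
      then show "c * (ln (ln (real (Suc n))) - ln (ln (real n))) \<le> 1 / ln (real n) * ?b n" by (simp only: mult_ac)
    qed
    also have "(\<Sum>n=2..N. c * (ln (ln (real (Suc n))) - ln (ln (real n)))) = c * (ln (ln (real (Suc N))) - ln (ln 2))"
      using sum_Suc_diff[of 2 N "\<lambda>n. ln (ln (real n))"] N by (simp add: sum_distrib_left[symmetric])
    finally have 2: "(\<Sum>n=2..N. 1 / ln (real n) * ?b n) \<ge> c * (ln (ln (real (Suc N))) - ln (ln 2))" .
    have "ln (ln (real N)) \<le> ln (ln (real (Suc N)))"
      using N by (subst ln_le_cancel_iff) (auto intro!: ln_gt_zero)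
    then have 3: "c * ln (ln (real N)) \<le> c * ln (ln (real (Suc N)))" using c by (rule mult_left_mono)
    have "(\<Sum>n=2..N. a n / ln (real n)) = (\<Sum>n=2..N. 1 / ln (real n) * (a n - ?b n)) + (\<Sum>n=2..N. 1 / ln (real n) * ?b n)"
      unfolding sum.distrib[symmetric] by (intro sum.cong refl) (simp only: distrib_left[symmetric] diff_add_cancel, simp)
    then show "(\<Sum>n=2..N. a n / ln (real n)) \<ge> c * ln (ln (real N)) - (D / ln 2 + c * ln (ln 2))"
      using 1 2 3 by (simp add: algebra_simps)
  qed
qed

text \<open>At a prime this is the proportion of units that are not \<open>d\<close>-th powers; on
  positive arguments it depends only on the residue class modulo \<open>d\<close>.\<close>

definition gcd_weight :: "nat \<Rightarrow> nat \<Rightarrow> real" where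
  "gcd_weight d n = 1 - 1 / real (gcd d (n - 1))"

lemma gcd_weight_bounds:
  assumes "d > 0" shows "0 \<le> gcd_weight d n" "gcd_weight d n \<le> 1"
proof -
  have "1 \<le> gcd d (n - 1)" using assms by (simp add: Suc_le_eq)
  then have x: "1 \<le> real (gcd d (n - 1))" by (metis of_nat_1 of_nat_mono)
  have "0 \<le> 1 - 1 / x" "1 - 1 / x \<le> 1" if "1 \<le> x" for x :: real
    using that by (auto simp: field_simps)
  from this[OF x] show "0 \<le> gcd_weight d n" "gcd_weight d n \<le> 1" unfolding gcd_weight_def by blast+
qed

lemma delta_le_1: assumes "d > 0" shows "delta d \<le> 1"
proof -
  have "(\<Sum>a\<in>totatives d. 1 / real (gcd d (a - 1))) \<le> (\<Sum>a\<in>totatives d. 1)"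
    using gcd_weight_bounds(1)[OF assms] by (intro sum_mono) (simp add: gcd_weight_def)
  also have "\<dots> = real (totient d)" by (simp add: totient_def)
  finally have "gcd_mean d \<le> 1" unfolding gcd_mean_def using assms by (simp add: divide_le_eq_1)
  then show ?thesis using gcd_mean_eq_delta[OF assms] by simp
qed

text \<open>The weight is constant on classes modulo \<open>d\<close>, so Mertens' theorem applies
  in each coprime class, and the weights average to \<open>1 - delta d\<close>. The remaining
  classes are dropped by nonnegativity.\<close>

lemma sum_gcd_weight_mangoldt_ge:
  assumes "d > 0"
  shows "\<exists>C. \<forall>N\<ge>1. (\<Sum>n=1..N. gcd_weight d n * mangoldt n / real n) \<ge> (1 - delta d) * ln (real N) - C"
proof -
  have tot: "totient d > 0" using assms by (simp add: totient_gt_0_iff)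
  have "\<exists>C. \<forall>N\<ge>1. (\<Sum>n | n \<in> {1..N} \<and> [n = a] (mod d). mangoldt n / real n) \<ge> ln (real N) / real (totient d) - C"
    if "a \<in> totatives d" for a
    using that by (intro mertens_arithmetic_progression assms) (auto simp: totatives_def)
  then have "\<forall>a\<in>totatives d. \<exists>C. \<forall>N\<ge>1. (\<Sum>n | n \<in> {1..N} \<and> [n = a] (mod d). mangoldt n / real n) \<ge> ln (real N) / real (totient d) - C"
    by blast
  from bchoice[OF this] obtain C where C: "\<forall>a\<in>totatives d. \<forall>N\<ge>1.
     (\<Sum>n | n \<in> {1..N} \<and> [n = a] (mod d). mangoldt n / real n) \<ge> ln (real N) / real (totient d) - C a" by blast
  show ?thesis
  proof (intro exI allI impI)
    fix N :: nat assume N: "N \<ge> 1"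
    let ?T = "\<lambda>a. {n. n \<in> {1..N} \<and> [n = a] (mod d)}"
    have avg: "(\<Sum>a\<in>totatives d. gcd_weight d a) = (1 - delta d) * real (totient d)"
    proof -
      have "(\<Sum>a\<in>totatives d. 1 / real (gcd d (a - 1))) = delta d * real (totient d)"
        using gcd_mean_eq_delta[OF assms] tot assms unfolding gcd_mean_def by (simp add: divide_eq_eq)
      then show ?thesis by (simp add: gcd_weight_def sum_subtractf left_diff_distrib totient_def)
    qed
    have "(\<Sum>a\<in>totatives d. gcd_weight d a * (ln (real N) / real (totient d) - C a))
       = (\<Sum>a\<in>totatives d. gcd_weight d a) * (ln (real N) / real (totient d)) - (\<Sum>a\<in>totatives d. gcd_weight d a * C a)"
      unfolding sum_distrib_right right_diff_distrib sum_subtractf ..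
    also have "\<dots> = (1 - delta d) * ln (real N) - (\<Sum>a\<in>totatives d. gcd_weight d a * C a)"
      unfolding avg using tot by simp
    finally have "(1 - delta d) * ln (real N) - (\<Sum>a\<in>totatives d. gcd_weight d a * C a)
        = (\<Sum>a\<in>totatives d. gcd_weight d a * (ln (real N) / real (totient d) - C a))" ..
    also have "\<dots> \<le> (\<Sum>a\<in>totatives d. gcd_weight d a * (\<Sum>n\<in>?T a. mangoldt n / real n))"
      using C N gcd_weight_bounds(1)[OF assms] by (intro sum_mono mult_left_mono) auto
    also have "\<dots> = (\<Sum>a\<in>totatives d. \<Sum>n\<in>?T a. gcd_weight d n * mangoldt n / real n)"
    proof (intro sum.cong refl)
      fix a assume a: "a \<in> totatives d"
      show "gcd_weight d a * (\<Sum>n\<in>?T a. mangoldt n / real n) = (\<Sum>n\<in>?T a. gcd_weight d n * mangoldt n / real n)"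
        unfolding sum_distrib_left
      proof (intro sum.cong refl)
        fix n assume n: "n \<in> ?T a"
        then have "gcd d (n - 1) = gcd d (a - 1)" using a by (intro gcd_pred_cong) (auto simp: totatives_def)
        then show "gcd_weight d a * (mangoldt n / real n) = gcd_weight d n * mangoldt n / real n"
          by (simp add: gcd_weight_def)
      qed
    qed
    also have "\<dots> = (\<Sum>n\<in>(\<Union>a\<in>totatives d. ?T a). gcd_weight d n * mangoldt n / real n)"
    proof (rule sum.UNION_disjoint[symmetric])
      show "\<forall>a\<in>totatives d. \<forall>b\<in>totatives d. a \<noteq> b \<longrightarrow> ?T a \<inter> ?T b = {}"
      proof (intro ballI impI)
        fix a b assume ab: "a \<in> totatives d" "b \<in> totatives d" "a \<noteq> b"
        show "?T a \<inter> ?T b = {}"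
        proof (rule ccontr)
          assume "?T a \<inter> ?T b \<noteq> {}"
          then obtain n where "[n = a] (mod d)" "[n = b] (mod d)" by auto
          then have "[a = b] (mod d)" by (blast intro: cong_trans cong_sym)
          moreover have "1 \<le> a" "a \<le> d" "1 \<le> b" "b \<le> d" using ab by (auto simp: totatives_def)
          ultimately have "a = b"
            by (cases "a = d"; cases "b = d") (auto simp: unique_euclidean_semiring_class.cong_def)
          then show False using ab by simp
        qed
      qed
    qed auto
    also have "\<dots> \<le> (\<Sum>n=1..N. gcd_weight d n * mangoldt n / real n)"
      by (rule sum_mono2) (auto intro!: divide_nonneg_nonneg mult_nonneg_nonneg mangoldt_nonneg gcd_weight_bounds assms)
    finally show "(1 - delta d) * ln (real N) - (\<Sum>a\<in>totatives d. gcd_weight d a * C a) \<le> (\<Sum>n=1..N. gcd_weight d n * mangoldt n / real n)" .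
  qed
qed

theorem sum_gcd_weight_primes_ge:
  assumes "d > 0"
  shows "\<exists>C. \<forall>N\<ge>2. (\<Sum>p | prime p \<and> p \<le> N. gcd_weight d p / real p) \<ge> (1 - delta d) * ln (ln (real N)) - C"
proof -
  obtain C where C: "\<And>N. N \<ge> 1 \<Longrightarrow> (\<Sum>n=1..N. gcd_weight d n * mangoldt n / real n) \<ge> (1 - delta d) * ln (real N) - C"
    using sum_gcd_weight_mangoldt_ge[OF assms] by blast
  obtain C1 where C1: "\<And>N. (\<Sum>n\<in>{n\<in>{1..N}. \<not> prime n}. mangoldt n / real n) \<le> C1"
    using sum_mangoldt_nonprime_bounded by blast
  let ?a = "\<lambda>n. if prime n then gcd_weight d n * ln (real n) / real n else 0"
  have "(\<Sum>n=2..N. ?a n) \<ge> (1 - delta d) * ln (real N) - (C + C1)" if N: "N \<ge> 2" for N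
  proof -
    have "(\<Sum>n=1..N. gcd_weight d n * mangoldt n / real n) = (\<Sum>n\<in>{n\<in>{1..N}. prime n}. gcd_weight d n * mangoldt n / real n)
       + (\<Sum>n\<in>{n\<in>{1..N}. \<not> prime n}. gcd_weight d n * mangoldt n / real n)"
      by (subst sum.union_disjoint[symmetric]) (auto intro!: sum.cong)
    also have "(\<Sum>n\<in>{n\<in>{1..N}. prime n}. gcd_weight d n * mangoldt n / real n) = (\<Sum>n=2..N. ?a n)"
      by (rule sum.mono_neutral_cong_left) (auto dest: prime_ge_2_nat)
    also have "(\<Sum>n\<in>{n\<in>{1..N}. \<not> prime n}. gcd_weight d n * mangoldt n / real n) \<le> (\<Sum>n\<in>{n\<in>{1..N}. \<not> prime n}. mangoldt n / real n)"
      using gcd_weight_bounds[OF assms] by (intro sum_mono divide_right_mono mult_left_le_one_le mangoldt_nonneg) auto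
    also have "\<dots> \<le> C1" by (rule C1)
    finally show ?thesis using C[of N] N by simp
  qed
  then have "\<exists>C'. \<forall>N\<ge>2. (\<Sum>n=2..N. ?a n / ln (real n)) \<ge> (1 - delta d) * ln (ln (real N)) - C'"
    using delta_le_1[OF assms] by (intro sum_over_ln_ge[where C="C + C1"]) auto
  moreover have "(\<Sum>n=2..N. ?a n / ln (real n)) = (\<Sum>p | prime p \<and> p \<le> N. gcd_weight d p / real p)" for N
  proof (rule sum.mono_neutral_cong_right)
    show "?a n / ln (real n) = gcd_weight d n / real n" if "n \<in> {p. prime p \<and> p \<le> N}" for n
      using that prime_gt_1_nat[of n] by auto
  qed (auto dest: prime_ge_2_nat)
  ultimately show ?thesis by simp
qed

section \<open>A sieve modulo squares of primes\<close>

definition box_sum :: "int \<Rightarrow> nat \<Rightarrow> (int \<Rightarrow> int \<Rightarrow> int \<Rightarrow> real) \<Rightarrow> real" where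
  "box_sum l M f = (\<Sum>x\<in>{l..<l + int M}. \<Sum>y\<in>{l..<l + int M}. \<Sum>z\<in>{l..<l + int M}. f x y z)"

definition periodic3 :: "nat \<Rightarrow> (int \<Rightarrow> int \<Rightarrow> int \<Rightarrow> 'a) \<Rightarrow> bool" where
  "periodic3 q f \<longleftrightarrow> (\<forall>x y z x' y' z'. [x = x'] (mod int q) \<longrightarrow> [y = y'] (mod int q) \<longrightarrow> [z = z'] (mod int q) \<longrightarrow>
     f x y z = f x' y' z')"

lemma sum_period:
  fixes g :: "int \<Rightarrow> real"
  assumes "q > 0" "\<And>x x'. [x = x'] (mod int q) \<Longrightarrow> g x = g x'"
  shows "(\<Sum>x\<in>{l..<l + int q}. g x) = (\<Sum>x\<in>{0..<int q}. g x)"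
proof (rule sum.reindex_bij_witness[where j="\<lambda>x. x mod int q" and i="\<lambda>r. l + (r - l) mod int q"], goal_cases)
  case (1 a)
  have "(l + (a mod int q - l) mod int q) = l + (a - l) mod int q" by (simp add: mod_simps)
  also have "(a - l) mod int q = a - l" using 1 by auto
  finally show ?case by simp
next
  case (3 b)
  have "(l + (b - l) mod int q) mod int q = b mod int q" by (simp add: mod_simps)
  then show ?case using 3 by simp
next
  case (5 a) show ?case by (rule assms(2)) (simp add: unique_euclidean_semiring_class.cong_def)
qed (use assms(1) in auto)

lemma sum_periods:
  fixes g :: "int \<Rightarrow> real"
  assumes "q > 0" "\<And>x x'. [x = x'] (mod int q) \<Longrightarrow> g x = g x'"
  shows "(\<Sum>x\<in>{l..<l + int (q * k)}. g x) = real k * (\<Sum>x\<in>{0..<int q}. g x)"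
proof (induction k)
  case (Suc k)
  have e: "l + int (q * Suc k) = l + int (q * k) + int q" by (simp add: algebra_simps)
  have "{l..<l + int (q * Suc k)} = {l..<l + int (q * k)} \<union> {l + int (q * k)..<(l + int (q * k)) + int q}"
    unfolding e by (rule ivl_disj_un_two(3)[symmetric]) auto
  then have "(\<Sum>x\<in>{l..<l + int (q * Suc k)}. g x) = (\<Sum>x\<in>{l..<l + int (q * k)}. g x) + (\<Sum>x\<in>{l + int (q * k)..<(l + int (q * k)) + int q}. g x)"
    by (simp only:) (subst sum.union_disjoint, auto)
  also have "\<dots> = real k * (\<Sum>x\<in>{0..<int q}. g x) + (\<Sum>x\<in>{0..<int q}. g x)"
    using sum_period[OF assms, where l="l + int (q * k)"] Suc by (simp only:)
  finally show ?case by (simp add: distrib_right)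
qed simp

lemma box_sum_periods:
  assumes "q > 0" "periodic3 q f"
  shows "box_sum l (q * k) f = real k ^ 3 * box_sum 0 q f"
proof -
  have f: "f x y z = f x' y' z'" if "[x = x'] (mod int q)" "[y = y'] (mod int q)" "[z = z'] (mod int q)" for x y z x' y' z'
    using assms(2) that unfolding periodic3_def by blast
  have "(\<Sum>z\<in>{l..<l + int (q * k)}. f x y z) = real k * (\<Sum>z\<in>{0..<int q}. f x y z)" for x y
    by (rule sum_periods[OF assms(1)]) (rule f, auto)
  moreover have "(\<Sum>y\<in>{l..<l + int (q * k)}. (\<Sum>z\<in>{0..<int q}. f x y z)) = real k * (\<Sum>y\<in>{0..<int q}. \<Sum>z\<in>{0..<int q}. f x y z)" for x
    by (rule sum_periods[OF assms(1)]) (intro sum.cong refl f, auto)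
  moreover have "(\<Sum>x\<in>{l..<l + int (q * k)}. (\<Sum>y\<in>{0..<int q}. \<Sum>z\<in>{0..<int q}. f x y z)) = real k * (\<Sum>x\<in>{0..<int q}. \<Sum>y\<in>{0..<int q}. \<Sum>z\<in>{0..<int q}. f x y z)"
    by (rule sum_periods[OF assms(1)]) (intro sum.cong refl f, auto)
  ultimately show ?thesis unfolding box_sum_def
    by (simp add: sum_distrib_left[symmetric] power3_eq_cube)
qed

lemma box_sum_mono:
  assumes "\<And>x y z. f x y z \<le> g x y z" shows "box_sum l M f \<le> box_sum l M g"
  unfolding box_sum_def by (intro sum_mono assms)

lemma box_sum_extend:
  assumes "M' \<le> M" "\<And>x y z. \<bar>f x y z\<bar> \<le> 1"
  shows "\<bar>box_sum l M f - box_sum l M' f\<bar> \<le> real M ^ 3 - real M' ^ 3"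
proof -
  let ?I = "{l..<l + int M}" and ?J = "{l..<l + int M'}"
  have b: "box_sum l M f = (\<Sum>(x,y,z)\<in>?I \<times> ?I \<times> ?I. f x y z)" "box_sum l M' f = (\<Sum>(x,y,z)\<in>?J \<times> ?J \<times> ?J. f x y z)"
    unfolding box_sum_def by (simp_all add: sum.cartesian_product)
  have sub: "?J \<times> ?J \<times> ?J \<subseteq> ?I \<times> ?I \<times> ?I" using assms(1) by auto
  have eq: "box_sum l M f - box_sum l M' f = (\<Sum>(x,y,z)\<in>?I \<times> ?I \<times> ?I - ?J \<times> ?J \<times> ?J. f x y z)"
    unfolding b by (subst sum.subset_diff[OF sub]) auto
  have "\<bar>box_sum l M f - box_sum l M' f\<bar> \<le> (\<Sum>w\<in>?I \<times> ?I \<times> ?I - ?J \<times> ?J \<times> ?J. 1)"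
    unfolding eq by (rule order_trans[OF sum_abs]) (intro sum_mono, use assms(2) in auto)
  also have "\<dots> = real (card (?I \<times> ?I \<times> ?I - ?J \<times> ?J \<times> ?J))" by simp
  also have "card (?I \<times> ?I \<times> ?I - ?J \<times> ?J \<times> ?J) = M ^ 3 - M' ^ 3"
    by (subst card_Diff_subset[OF _ sub]) (auto simp: card_cartesian_product power3_eq_cube)
  also have "real (M ^ 3 - M' ^ 3) = real M ^ 3 - real M' ^ 3"
    using power_mono[OF assms(1), of 3] by (simp add: of_nat_diff)
  finally show ?thesis .
qed

text \<open>The subcube of side \<open>q * (M div q)\<close> consists of complete periods. What is
  left is a shell of thickness less than \<open>q\<close>, with at most \<open>3 * q * M^2\<close>
  points.\<close>

lemma box_sum_periodic_approx:
  assumes "q > 0" "periodic3 q f" "\<And>x y z. \<bar>f x y z\<bar> \<le> 1"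
  shows "\<bar>box_sum l M f - real (M div q) ^ 3 * box_sum 0 q f\<bar> \<le> 3 * real q * real M ^ 2"
proof -
  define k where "k = M div q"
  have le: "q * k \<le> M" by (simp add: k_def)
  have "\<bar>box_sum l M f - box_sum l (q * k) f\<bar> \<le> real M ^ 3 - real (q * k) ^ 3"
    by (rule box_sum_extend[OF le assms(3)])
  also have "\<dots> = (real M - real (q * k)) * (real M ^ 2 + real M * real (q * k) + real (q * k) ^ 2)"
    by (simp add: algebra_simps power2_eq_square power3_eq_cube)
  also have "\<dots> \<le> real q * (real M ^ 2 + real M * real M + real M ^ 2)"
  proof (intro mult_mono add_mono order_refl mult_left_mono power_mono)
    have "M < q * k + q" unfolding k_def using assms(1) dividend_less_times_div[of q M] by simp
    then have "real M < real (q * k) + real q" by (simp flip: of_nat_add of_nat_mult)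
    then show "real M - real (q * k) \<le> real q" by simp
  qed (use le in \<open>auto simp del: of_nat_mult intro!: add_nonneg_nonneg\<close>)
  finally show ?thesis unfolding box_sum_periods[OF assms(1,2)] k_def by (simp add: power2_eq_square)
qed

text \<open>Giving the two residues separate arguments lets the diagonal sum become a double sum,
  and the rule can then be applied to one coordinate after another.\<close>

lemma sum_crt:
  fixes k :: "int \<Rightarrow> int \<Rightarrow> real"
  assumes "q1 > 0" "q2 > 0" "coprime q1 q2"
    and "\<And>u v u' v'. [u = u'] (mod int q1) \<Longrightarrow> [v = v'] (mod int q2) \<Longrightarrow> k u v = k u' v'"
  shows "(\<Sum>x\<in>{0..<int (q1 * q2)}. k x x) = (\<Sum>u\<in>{0..<int q1}. \<Sum>v\<in>{0..<int q2}. k u v)"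
proof -
  let ?h = "\<lambda>x. (x mod int q1, x mod int q2)"
  have inj: "inj_on ?h {0..<int (q1 * q2)}"
  proof (rule inj_onI)
    fix x y assume xy: "x \<in> {0..<int (q1 * q2)}" "y \<in> {0..<int (q1 * q2)}" "?h x = ?h y"
    then have "[x = y] (mod int q1)" "[x = y] (mod int q2)" by (auto simp: unique_euclidean_semiring_class.cong_def)
    then have "[x = y] (mod int q1 * int q2)"
      by (rule coprime_cong_mult) (use assms(3) in simp)
    then show "x = y" using xy by (simp add: unique_euclidean_semiring_class.cong_def)
  qed
  have "?h ` {0..<int (q1 * q2)} = {0..<int q1} \<times> {0..<int q2}"
  proof (rule card_subset_eq)
    show "?h ` {0..<int (q1 * q2)} \<subseteq> {0..<int q1} \<times> {0..<int q2}" using assms by auto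
    show "card (?h ` {0..<int (q1 * q2)}) = card ({0..<int q1} \<times> {0..<int q2})"
      using card_image[OF inj] by (simp add: card_cartesian_product nat_mult_distrib)
  qed simp
  then have bij: "bij_betw ?h {0..<int (q1 * q2)} ({0..<int q1} \<times> {0..<int q2})" using inj by (simp add: bij_betw_def)
  have "(\<Sum>x\<in>{0..<int (q1 * q2)}. k x x) = (\<Sum>x\<in>{0..<int (q1 * q2)}. (\<lambda>(u,v). k u v) (?h x))"
    by (intro sum.cong refl) (auto intro!: assms(4) simp: unique_euclidean_semiring_class.cong_def)
  also have "\<dots> = (\<Sum>(u,v)\<in>{0..<int q1} \<times> {0..<int q2}. k u v)"
    by (rule sum.reindex_bij_betw[OF bij])
  finally show ?thesis by (simp add: sum.cartesian_product)
qed

lemma box_sum_crt: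
  assumes "q1 > 0" "q2 > 0" "coprime q1 q2" "periodic3 q1 f" "periodic3 q2 g"
  shows "box_sum 0 (q1 * q2) (\<lambda>x y z. f x y z * g x y z) = box_sum 0 q1 f * box_sum 0 q2 g"
proof -
  have f: "f x y z = f x' y' z'" if "[x = x'] (mod int q1)" "[y = y'] (mod int q1)" "[z = z'] (mod int q1)" for x y z x' y' z'
    using assms(4) that unfolding periodic3_def by blast
  have g: "g x y z = g x' y' z'" if "[x = x'] (mod int q2)" "[y = y'] (mod int q2)" "[z = z'] (mod int q2)" for x y z x' y' z'
    using assms(5) that unfolding periodic3_def by blast
  let ?I = "{0..<int (q1 * q2)}" and ?A = "{0..<int q1}" and ?B = "{0..<int q2}"
  note crt = sum_crt[OF assms(1-3)]
  have "(\<Sum>z\<in>?I. f x y z * g x' y' z) = (\<Sum>z\<in>?A. \<Sum>z'\<in>?B. f x y z * g x' y' z')" for x y x' y'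
    by (rule crt[of "\<lambda>z z'. f x y z * g x' y' z'"]) (intro arg_cong2[of _ _ _ _ "(*)"] f g; simp)
  moreover have "(\<Sum>y\<in>?I. \<Sum>z\<in>?A. \<Sum>z'\<in>?B. f x y z * g x' y z') = (\<Sum>y\<in>?A. \<Sum>y'\<in>?B. \<Sum>z\<in>?A. \<Sum>z'\<in>?B. f x y z * g x' y' z')" for x x'
    by (rule crt[of "\<lambda>y y'. \<Sum>z\<in>?A. \<Sum>z'\<in>?B. f x y z * g x' y' z'"]) (intro sum.cong arg_cong2[of _ _ _ _ "(*)"] f g refl; simp)
  moreover have "(\<Sum>x\<in>?I. \<Sum>y\<in>?A. \<Sum>y'\<in>?B. \<Sum>z\<in>?A. \<Sum>z'\<in>?B. f x y z * g x y' z') = (\<Sum>x\<in>?A. \<Sum>x'\<in>?B. \<Sum>y\<in>?A. \<Sum>y'\<in>?B. \<Sum>z\<in>?A. \<Sum>z'\<in>?B. f x y z * g x' y' z')"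
    by (rule crt[of "\<lambda>x x'. \<Sum>y\<in>?A. \<Sum>y'\<in>?B. \<Sum>z\<in>?A. \<Sum>z'\<in>?B. f x y z * g x' y' z'"]) (intro sum.cong arg_cong2[of _ _ _ _ "(*)"] f g refl; simp)
  ultimately have "box_sum 0 (q1 * q2) (\<lambda>x y z. f x y z * g x y z) = (\<Sum>x\<in>?A. \<Sum>x'\<in>?B. \<Sum>y\<in>?A. \<Sum>y'\<in>?B. \<Sum>z\<in>?A. \<Sum>z'\<in>?B. f x y z * g x' y' z')"
    by (simp add: box_sum_def)
  also have "\<dots> = box_sum 0 q1 f * box_sum 0 q2 g"
    unfolding box_sum_def sum_product by simp
  finally show ?thesis .
qed

lemma periodic3_dvd: "periodic3 q f \<Longrightarrow> q dvd q' \<Longrightarrow> periodic3 q' f"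
  unfolding periodic3_def by (meson cong_dvd_modulus int_dvd_int_iff)

lemma periodic3_prod:
  fixes \<psi> :: "nat \<Rightarrow> int \<Rightarrow> int \<Rightarrow> int \<Rightarrow> real"
  assumes "finite U" "\<And>p. p \<in> U \<Longrightarrow> periodic3 (m p) (\<psi> p)"
  shows "periodic3 (\<Prod>p\<in>U. m p) (\<lambda>x y z. \<Prod>p\<in>U. \<psi> p x y z)"
  unfolding periodic3_def
proof (intro allI impI prod.cong refl)
  fix x y z x' y' z' p
  assume *: "[x = x'] (mod int (\<Prod>p\<in>U. m p))" "[y = y'] (mod int (\<Prod>p\<in>U. m p))" "[z = z'] (mod int (\<Prod>p\<in>U. m p))" "p \<in> U"
  have "periodic3 (\<Prod>p\<in>U. m p) (\<psi> p)"
    by (rule periodic3_dvd[OF assms(2)[OF *(4)]]) (use assms(1) *(4) in \<open>auto intro: dvd_prodI\<close>)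
  then show "\<psi> p x y z = \<psi> p x' y' z'" using * unfolding periodic3_def by blast
qed

lemma box_sum_prod:
  fixes \<psi> :: "nat \<Rightarrow> int \<Rightarrow> int \<Rightarrow> int \<Rightarrow> real"
  assumes "finite U" "\<And>p. p \<in> U \<Longrightarrow> prime p" "\<And>p. p \<in> U \<Longrightarrow> periodic3 (p ^ 2) (\<psi> p)"
  shows "box_sum 0 (\<Prod>p\<in>U. p ^ 2) (\<lambda>x y z. \<Prod>p\<in>U. \<psi> p x y z) = (\<Prod>p\<in>U. box_sum 0 (p ^ 2) (\<psi> p))"
  using assms
proof (induction U rule: finite_induct)
  case empty then show ?case by (simp add: box_sum_def)
next
  case (insert p U)
  have pos: "(\<Prod>p\<in>U. p ^ 2) > 0" using insert by (intro prod_pos) (auto simp: prime_gt_0_nat)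
  have "coprime (p ^ 2) (\<Prod>p\<in>U. p ^ 2)"
  proof (intro prod_coprime_right)
    fix x assume x: "x \<in> U"
    then have "p \<noteq> x" using insert(2) by auto
    then show "coprime (p ^ 2) (x ^ 2)" using x insert(4) by (simp add: primes_coprime)
  qed
  moreover have "periodic3 (\<Prod>p\<in>U. p ^ 2) (\<lambda>x y z. \<Prod>p\<in>U. \<psi> p x y z)"
    using insert by (intro periodic3_prod) auto
  ultimately have "box_sum 0 (p ^ 2 * (\<Prod>p\<in>U. p ^ 2)) (\<lambda>x y z. \<psi> p x y z * (\<Prod>p\<in>U. \<psi> p x y z)) = box_sum 0 (p ^ 2) (\<psi> p) * box_sum 0 (\<Prod>p\<in>U. p ^ 2) (\<lambda>x y z. \<Prod>p\<in>U. \<psi> p x y z)"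
    using insert pos by (intro box_sum_crt) (auto simp: prime_gt_0_nat)
  then show ?case using insert by simp
qed

lemma box_sum_sum: "box_sum l M (\<lambda>x y z. \<Sum>i\<in>A. f i x y z) = (\<Sum>i\<in>A. box_sum l M (f i))"
proof -
  have "(\<Sum>z\<in>I. \<Sum>i\<in>A. f i x y z) = (\<Sum>i\<in>A. \<Sum>z\<in>I. f i x y z)" for x y and I :: "int set" by (rule sum.swap)
  moreover have "(\<Sum>y\<in>I. \<Sum>i\<in>A. \<Sum>z\<in>I. f i x y z) = (\<Sum>i\<in>A. \<Sum>y\<in>I. \<Sum>z\<in>I. f i x y z)" for x and I :: "int set" by (rule sum.swap)
  moreover have "(\<Sum>x\<in>I. \<Sum>i\<in>A. \<Sum>y\<in>I. \<Sum>z\<in>I. f i x y z) = (\<Sum>i\<in>A. \<Sum>x\<in>I. \<Sum>y\<in>I. \<Sum>z\<in>I. f i x y z)" for I :: "int set" by (rule sum.swap)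
  ultimately show ?thesis unfolding box_sum_def by simp
qed

lemma box_sum_affine: "box_sum l M (\<lambda>x y z. c + b * f x y z) = c * real M ^ 3 + b * box_sum l M f"
  unfolding box_sum_def by (simp add: sum.distrib sum_distrib_left power3_eq_cube algebra_simps)

section \<open>Orthogonal test functions and the sieve inequality\<close>

locale square_sieve =
  fixes P :: "nat set" and bad :: "nat \<Rightarrow> int \<Rightarrow> int \<Rightarrow> int \<Rightarrow> bool"
  assumes finite_P: "finite P" and prime_P: "\<And>p. p \<in> P \<Longrightarrow> prime p"
    and periodic_bad: "\<And>p. p \<in> P \<Longrightarrow> periodic3 (p ^ 2) (bad p)"
begin

definition density :: "nat \<Rightarrow> real" where
  "density p = box_sum 0 (p ^ 2) (\<lambda>x y z. of_bool (bad p x y z)) / real p ^ 6"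

definition odds :: "nat \<Rightarrow> real" where "odds p = density p / (1 - density p)"

text \<open>The value \<open>odds p\<close> off the excluded classes makes the mean of \<open>test p\<close> vanish and the mean of its square
  equal to \<open>odds p\<close>, so products over distinct sets of primes are orthogonal on average.\<close>

definition test :: "nat \<Rightarrow> int \<Rightarrow> int \<Rightarrow> int \<Rightarrow> real" where
  "test p x y z = (if bad p x y z then -1 else odds p)"

definition levels :: "real \<Rightarrow> nat set set" where
  "levels R = {T. T \<subseteq> P \<and> real (\<Prod>T) \<le> R}"

definition sieve_sum :: "real \<Rightarrow> real" where
  "sieve_sum R = (\<Sum>T\<in>levels R. \<Prod>p\<in>T. odds p)"

lemma finite_levels: "finite (levels R)"
  by (rule finite_subset[of _ "Pow P"]) (auto simp: levels_def finite_P)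

lemma levelsD:
  assumes "T \<in> levels R" shows "T \<subseteq> P" "finite T" "real (\<Prod>T) \<le> R" "\<And>p. p \<in> T \<Longrightarrow> prime p" "\<Prod>T \<ge> 1"
proof -
  show "T \<subseteq> P" "real (\<Prod>T) \<le> R" using assms by (auto simp: levels_def)
  then show "finite T" "\<And>p. p \<in> T \<Longrightarrow> prime p" using finite_P finite_subset prime_P by auto
  then show "\<Prod>T \<ge> 1" using prod_pos[of T "\<lambda>p. p"] by (auto simp: prime_gt_0_nat Suc_le_eq)
qed

text \<open>A set of primes is recovered from its product, so levels inject into the integers up to
  \<open>R\<close>.\<close>

lemma card_levels: assumes "R \<ge> 1" shows "real (card (levels R)) \<le> R"
proof -
  have "inj_on \<Prod> (levels R)"
  proof (rule inj_onI)
    fix S T assume "S \<in> levels R" "T \<in> levels R" "\<Prod>S = \<Prod>T"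
    then show "S = T" using prod_primes_prime_factors(1)[of S] prod_primes_prime_factors(1)[of T] levelsD(2,4) by metis
  qed
  then have "card (levels R) = card (\<Prod> ` levels R)" by (simp add: card_image)
  also have "\<dots> \<le> card {1..nat \<lfloor>R\<rfloor>}"
    using levelsD(3,5) assms by (intro card_mono) (auto simp: le_nat_floor)
  also have "\<dots> = nat \<lfloor>R\<rfloor>" by simp
  finally show ?thesis using assms by linarith
qed

lemma density_nonneg: "0 \<le> density p"
  unfolding density_def box_sum_def by (intro divide_nonneg_nonneg sum_nonneg) auto

context
  assumes density_le: "\<And>p. p \<in> P \<Longrightarrow> density p \<le> 1 / 2"
begin

lemma odds_bounds: assumes "p \<in> P" shows "0 \<le> odds p" "odds p \<le> 1" "odds p \<le> 2 * density p" "1 + odds p = 1 / (1 - density p)"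
proof -
  have d: "0 \<le> density p" "density p \<le> 1 / 2" using density_le[OF assms] density_nonneg by auto
  show "0 \<le> odds p" "odds p \<le> 1" "1 + odds p = 1 / (1 - density p)"
    using d by (auto simp: odds_def field_simps)
  have "density p * 1 \<le> density p * (2 * (1 - density p))" using d by (intro mult_left_mono) auto
  then show "odds p \<le> 2 * density p" using d unfolding odds_def by (subst pos_divide_le_eq) (auto simp: algebra_simps)
qed

lemma abs_test_le: "p \<in> P \<Longrightarrow> \<bar>test p x y z\<bar> \<le> 1"
  using odds_bounds by (auto simp: test_def)

lemma box_sum_bad: assumes "p \<in> P"
  shows "box_sum 0 (p ^ 2) (\<lambda>x y z. of_bool (bad p x y z)) = density p * real p ^ 6"
  using prime_gt_0_nat[OF prime_P[OF assms]] by (simp add: density_def)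

lemma box_sum_test: assumes "p \<in> P" shows "box_sum 0 (p ^ 2) (test p) = 0"
proof -
  have "test p = (\<lambda>x y z. odds p + (- (1 + odds p)) * of_bool (bad p x y z))"
    by (intro ext) (auto simp: test_def)
  then have "box_sum 0 (p ^ 2) (test p) = odds p * real (p ^ 2) ^ 3 + (- (1 + odds p)) * (density p * real p ^ 6)"
    using box_sum_affine[of 0 "p ^ 2" "odds p" "- (1 + odds p)" "\<lambda>x y z. of_bool (bad p x y z)"] box_sum_bad[OF assms]
    by simp
  also have "\<dots> = (odds p - (1 + odds p) * density p) * real p ^ 6"
    by (simp add: algebra_simps flip: power_mult)
  also have "odds p - (1 + odds p) * density p = 0"
    unfolding odds_bounds(4)[OF assms] by (simp add: odds_def)
  finally show ?thesis by simp
qed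

lemma box_sum_test_square: assumes "p \<in> P"
  shows "box_sum 0 (p ^ 2) (\<lambda>x y z. test p x y z * test p x y z) = odds p * real (p ^ 2) ^ 3"
proof -
  have "(\<lambda>x y z. test p x y z * test p x y z) = (\<lambda>x y z. odds p ^ 2 + (1 - odds p ^ 2) * of_bool (bad p x y z))"
    by (intro ext) (auto simp: test_def power2_eq_square)
  then have "box_sum 0 (p ^ 2) (\<lambda>x y z. test p x y z * test p x y z) = odds p ^ 2 * real (p ^ 2) ^ 3 + (1 - odds p ^ 2) * (density p * real p ^ 6)"
    using box_sum_affine[of 0 "p ^ 2" "odds p ^ 2" "1 - odds p ^ 2" "\<lambda>x y z. of_bool (bad p x y z)"] box_sum_bad[OF assms]
    by simp
  also have "\<dots> = (odds p ^ 2 + (1 - odds p ^ 2) * density p) * real (p ^ 2) ^ 3"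
    by (simp add: algebra_simps flip: power_mult)
  also have "odds p ^ 2 + (1 - odds p ^ 2) * density p = odds p"
  proof -
    have e: "density p = odds p * (1 - density p)" using density_le[OF assms] by (simp add: odds_def)
    have "odds p ^ 2 * (1 - density p) = odds p * (odds p * (1 - density p))" by (simp add: power2_eq_square)
    also have "\<dots> = odds p * density p" using e by simp
    finally have "odds p ^ 2 + (1 - odds p ^ 2) * density p = odds p * density p + density p" by (simp add: algebra_simps)
    then show ?thesis using e by (simp add: algebra_simps)
  qed
  finally show ?thesis .
qed

text \<open>A prime in exactly one of the two sets contributes a factor of mean zero over its
  period, so only \<open>T = T'\<close> has a main term. The common period is the square of the
  product over the union, which is at most \<open>\<Prod>T * \<Prod>T' \<le> R^2\<close>; hence the
  factor \<open>R^4\<close> in the error.\<close>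

lemma sieve_pair:
  assumes R: "R \<ge> 1" and T: "T \<in> levels R" "T' \<in> levels R"
  shows "box_sum l M (\<lambda>x y z. (\<Prod>p\<in>T. test p x y z) * (\<Prod>p\<in>T'. test p x y z))
    \<le> (if T = T' then real M ^ 3 * (\<Prod>p\<in>T. odds p) else 0) + 3 * R ^ 4 * real M ^ 2"
proof -
  let ?U = "T \<union> T'"
  note D = levelsD[OF T(1)] and D' = levelsD[OF T(2)]
  \<comment> \<open>Merging the two products into one over the union gives coprime moduli, as
    \<open>box_sum_prod\<close> requires; primes in both sets contribute the square of the
    test.\<close>
  define \<psi> where "\<psi> p x y z = (if p \<in> T then test p x y z else 1) * (if p \<in> T' then test p x y z else 1)" for p x y z
  define q where "q = (\<Prod>p\<in>?U. p ^ 2)"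
  have finU: "finite ?U" and primeU: "\<And>p. p \<in> ?U \<Longrightarrow> prime p" using D D' by auto
  have perU: "periodic3 (p ^ 2) (\<psi> p)" if "p \<in> ?U" for p
  proof -
    have "periodic3 (p ^ 2) (bad p)" using that D D' periodic_bad by blast
    then have "bad p x y z = bad p x' y' z'"
      if "[x = x'] (mod int (p ^ 2))" "[y = y'] (mod int (p ^ 2))" "[z = z'] (mod int (p ^ 2))" for x y z x' y' z'
      using that unfolding periodic3_def by blast
    then show ?thesis unfolding periodic3_def \<psi>_def test_def by simp
  qed
  have eq: "(\<lambda>x y z. (\<Prod>p\<in>T. test p x y z) * (\<Prod>p\<in>T'. test p x y z)) = (\<lambda>x y z. \<Prod>p\<in>?U. \<psi> p x y z)"
  proof (intro ext)
    fix x y z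
    have "(\<Prod>p\<in>T. test p x y z) = (\<Prod>p\<in>?U. if p \<in> T then test p x y z else 1)"
      by (rule prod.mono_neutral_cong_left) (use finU in auto)
    moreover have "(\<Prod>p\<in>T'. test p x y z) = (\<Prod>p\<in>?U. if p \<in> T' then test p x y z else 1)"
      by (rule prod.mono_neutral_cong_left) (use finU in auto)
    ultimately show "(\<Prod>p\<in>T. test p x y z) * (\<Prod>p\<in>T'. test p x y z) = (\<Prod>p\<in>?U. \<psi> p x y z)"
      by (simp add: \<psi>_def prod.distrib)
  qed
  have q0: "q > 0" unfolding q_def using primeU by (intro prod_pos) (auto simp: prime_gt_0_nat)
  have qR: "real q \<le> R ^ 4"
  proof -
    have "\<Prod>(T \<inter> T') \<ge> 1"
      using D(4) prod_pos[of "T \<inter> T'" "\<lambda>p. p"] by (auto simp: prime_gt_0_nat Suc_le_eq)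
    then have "\<Prod>?U * 1 \<le> \<Prod>?U * \<Prod>(T \<inter> T')" by (intro mult_left_mono) auto
    also have "\<dots> = \<Prod>T * \<Prod>T'" by (rule prod.union_inter) (use D D' in auto)
    finally have "real (\<Prod>?U) \<le> real (\<Prod>T) * real (\<Prod>T')" by (metis mult.right_neutral of_nat_le_iff of_nat_mult)
    also have "\<dots> \<le> R * R" using D(3) D'(3) R by (intro mult_mono) (auto intro!: prod_nonneg)
    finally have "real (\<Prod>?U) ^ 2 \<le> (R * R) ^ 2" by (intro power_mono) (auto intro!: prod_nonneg)
    moreover have "q = (\<Prod>?U) ^ 2" unfolding q_def by (simp add: prod_power_distrib)
    ultimately show ?thesis by (simp add: power2_eq_square power4_eq_xxxx mult_ac)
  qed
  have mean: "box_sum 0 q (\<lambda>x y z. \<Prod>p\<in>?U. \<psi> p x y z) = (\<Prod>p\<in>?U. box_sum 0 (p ^ 2) (\<psi> p))"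
    unfolding q_def by (rule box_sum_prod[OF finU primeU perU])
  have per: "periodic3 q (\<lambda>x y z. \<Prod>p\<in>?U. \<psi> p x y z)"
    unfolding q_def by (rule periodic3_prod[OF finU perU])
  have abs: "\<bar>\<Prod>p\<in>?U. \<psi> p x y z\<bar> \<le> 1" for x y z
    unfolding abs_prod
  proof (rule prod_le_1)
    fix p assume "p \<in> ?U"
    then have "\<bar>test p x y z\<bar> \<le> 1" using abs_test_le D(1) D'(1) by blast
    then show "0 \<le> \<bar>\<psi> p x y z\<bar> \<and> \<bar>\<psi> p x y z\<bar> \<le> 1"
      by (auto simp: \<psi>_def abs_mult mult_le_one)
  qed
  have main: "box_sum l M (\<lambda>x y z. \<Prod>p\<in>?U. \<psi> p x y z) \<le> real (M div q) ^ 3 * (\<Prod>p\<in>?U. box_sum 0 (p ^ 2) (\<psi> p)) + 3 * real q * real M ^ 2"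
    using box_sum_periodic_approx[OF q0 per abs, of l M] unfolding mean by linarith
  have err: "3 * real q * real M ^ 2 \<le> 3 * R ^ 4 * real M ^ 2" using qR by (intro mult_right_mono) auto
  have "real (M div q) ^ 3 * (\<Prod>p\<in>?U. box_sum 0 (p ^ 2) (\<psi> p)) \<le> (if T = T' then real M ^ 3 * (\<Prod>p\<in>T. odds p) else 0)"
  proof (cases "T = T'")
    case True
    have "box_sum 0 (p ^ 2) (\<psi> p) = odds p * real (p ^ 2) ^ 3" if "p \<in> T" for p
    proof -
      have "\<psi> p = (\<lambda>x y z. test p x y z * test p x y z)" using that True by (intro ext) (simp add: \<psi>_def)
      then show ?thesis using box_sum_test_square[of p] that D(1) by auto
    qed
    then have "(\<Prod>p\<in>?U. box_sum 0 (p ^ 2) (\<psi> p)) = (\<Prod>p\<in>T. odds p) * real q ^ 3"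
      using True by (simp add: q_def prod.distrib prod_power_distrib del: of_nat_power)
    moreover have "real (M div q) ^ 3 * real q ^ 3 \<le> real M ^ 3"
    proof -
      have "real (M div q) * real q \<le> real M" by (simp flip: of_nat_mult)
      then have "(real (M div q) * real q) ^ 3 \<le> real M ^ 3" by (intro power_mono) auto
      then show ?thesis by (simp add: power_mult_distrib)
    qed
    then have "real (M div q) ^ 3 * real q ^ 3 * (\<Prod>p\<in>T. odds p) \<le> real M ^ 3 * (\<Prod>p\<in>T. odds p)"
      using odds_bounds(1) D(1) by (intro mult_right_mono prod_nonneg) auto
    ultimately show ?thesis using True by (simp add: mult_ac)
  next
    case False
    then obtain p where p: "p \<in> ?U" "\<not> (p \<in> T \<and> p \<in> T')" by blast
    then have "\<psi> p = test p" by (intro ext) (auto simp: \<psi>_def)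
    then have "box_sum 0 (p ^ 2) (\<psi> p) = 0" using box_sum_test p D(1) D'(1) by auto
    then have "(\<Prod>p\<in>?U. box_sum 0 (p ^ 2) (\<psi> p)) = 0" using p finU by (intro prod_zero) auto
    then show ?thesis using False by simp
  qed
  then show ?thesis unfolding eq using main err by linarith
qed

text \<open>There are at most \<open>R^2\<close> pairs of levels, each with error
  \<open>3 * R^4 * M^2\<close>; this explains \<open>R^6\<close>.\<close>

theorem sieve_bound:
  assumes R: "R \<ge> 1" and S: "S \<subseteq> {l..<l + int M} \<times> {l..<l + int M} \<times> {l..<l + int M}"
    and good: "\<And>x y z p. (x, y, z) \<in> S \<Longrightarrow> p \<in> P \<Longrightarrow> \<not> bad p x y z"
  shows "real (card S) * sieve_sum R ^ 2 \<le> real M ^ 3 * sieve_sum R + 3 * R ^ 6 * real M ^ 2"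
proof -
  let ?I = "{l..<l + int M}"
  let ?F = "\<lambda>x y z. \<Sum>T\<in>levels R. \<Prod>p\<in>T. test p x y z"
  have "real (card S) * sieve_sum R ^ 2 = (\<Sum>(x,y,z)\<in>S. ?F x y z ^ 2)"
  proof -
    have "?F x y z = sieve_sum R" if "(x,y,z) \<in> S" for x y z
      unfolding sieve_sum_def using good[OF that] levelsD(1) by (intro sum.cong prod.cong refl) (auto simp: test_def)
    then have "(\<Sum>(x,y,z)\<in>S. ?F x y z ^ 2) = (\<Sum>w\<in>S. sieve_sum R ^ 2)" by (intro sum.cong) auto
    then show ?thesis by simp
  qed
  also have "\<dots> \<le> (\<Sum>(x,y,z)\<in>?I \<times> ?I \<times> ?I. ?F x y z ^ 2)"
    by (rule sum_mono2) (use S in auto)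
  also have "\<dots> = box_sum l M (\<lambda>x y z. ?F x y z ^ 2)" unfolding box_sum_def by (simp add: sum.cartesian_product)
  also have "(\<lambda>x y z. ?F x y z ^ 2) = (\<lambda>x y z. \<Sum>T\<in>levels R. \<Sum>T'\<in>levels R. (\<Prod>p\<in>T. test p x y z) * (\<Prod>p\<in>T'. test p x y z))"
    by (simp add: power2_eq_square sum_product)
  also have "box_sum l M \<dots> = (\<Sum>T\<in>levels R. \<Sum>T'\<in>levels R. box_sum l M (\<lambda>x y z. (\<Prod>p\<in>T. test p x y z) * (\<Prod>p\<in>T'. test p x y z)))"
    by (simp add: box_sum_sum)
  also have "\<dots> \<le> (\<Sum>T\<in>levels R. \<Sum>T'\<in>levels R. (if T = T' then real M ^ 3 * (\<Prod>p\<in>T. odds p) else 0) + 3 * R ^ 4 * real M ^ 2)"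
    by (intro sum_mono sieve_pair[OF R])
  also have "\<dots> = real M ^ 3 * sieve_sum R + real (card (levels R)) ^ 2 * (3 * R ^ 4 * real M ^ 2)"
    by (simp add: sum.distrib sum.delta finite_levels sieve_sum_def sum_distrib_left power2_eq_square mult.assoc)
  also have "real (card (levels R)) ^ 2 * (3 * R ^ 4 * real M ^ 2) \<le> R ^ 2 * (3 * R ^ 4 * real M ^ 2)"
    using card_levels[OF R] R by (intro mult_right_mono power_mono) auto
  also have "R ^ 2 * (3 * R ^ 4 * real M ^ 2) = 3 * R ^ 6 * real M ^ 2"
    by (simp add: mult.left_commute mult.assoc flip: power_add)
  finally show ?thesis by simp
qed

lemma sieve_sum_ge_1: assumes "R \<ge> 1" shows "sieve_sum R \<ge> 1"
proof -
  have "(\<Sum>T\<in>{{}}. \<Prod>p\<in>T. odds p) \<le> sieve_sum R"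
    unfolding sieve_sum_def using assms finite_levels
    by (intro sum_mono2) (auto intro!: prod_nonneg odds_bounds(1) simp: levels_def)
  then show ?thesis by simp
qed

text \<open>The Euler product of \<open>1 + odds p\<close> expands over all subsets of
  \<open>P\<close>. Subsets whose product exceeds \<open>R\<close> are controlled as in Markov's
  inequality: each is weighted by the logarithm of its product, and the weighted total is at most
  the Euler product times the sum of \<open>odds p * ln p\<close>. By hypothesis these subsets carry
  at most half. Finally \<open>1 + odds p = 1 / (1 - density p)\<close> is at least
  \<open>exp (density p)\<close>.\<close>

lemma sieve_sum_ge:
  assumes R: "R > 1" and small: "(\<Sum>p\<in>P. odds p * ln (real p)) \<le> ln R / 2"
  shows "sieve_sum R \<ge> exp (\<Sum>p\<in>P. density p) / 2"
proof -
  let ?g = "\<lambda>T. \<Prod>p\<in>T. odds p"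
  let ?\<Pi> = "\<Prod>p\<in>P. 1 + odds p"
  have gn: "?g T \<ge> 0" if "T \<subseteq> P" for T using that by (intro prod_nonneg odds_bounds(1)) auto
  have full: "(\<Sum>T\<in>Pow A. ?g T) = (\<Prod>p\<in>A. 1 + odds p)" if "finite A" for A
    using prod_add[OF that, of odds "\<lambda>_. 1"] by (simp add: add.commute)
  have lnp: "0 \<le> ln (real p)" if "p \<in> P" for p using prime_ge_1_nat[OF prime_P[OF that]] by simp
  have \<Pi>0: "?\<Pi> \<ge> 0" using odds_bounds(1) by (intro prod_nonneg) auto
  have split: "Pow P = levels R \<union> (Pow P - levels R)" unfolding levels_def by auto
  have "?\<Pi> = sieve_sum R + (\<Sum>T\<in>Pow P - levels R. ?g T)"
    unfolding full[OF finite_P, symmetric] sieve_sum_def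
    by (subst split, rule sum.union_disjoint) (auto simp: finite_levels finite_P)
  moreover have "(\<Sum>T\<in>Pow P - levels R. ?g T) * ln R \<le> ?\<Pi> * (ln R / 2)"
  proof -
    have "(\<Sum>T\<in>Pow P - levels R. ?g T) * ln R \<le> (\<Sum>T\<in>Pow P - levels R. ?g T * (\<Sum>p\<in>T. ln (real p)))"
      unfolding sum_distrib_right
    proof (intro sum_mono mult_left_mono)
      fix T assume T: "T \<in> Pow P - levels R"
      then have "finite T" "\<And>p. p \<in> T \<Longrightarrow> p > 0" using finite_P finite_subset prime_P prime_gt_0_nat by auto
      then have "(\<Sum>p\<in>T. ln (real p)) = ln (real (\<Prod>T))" unfolding of_nat_prod by (subst ln_prod) fastforce+
      moreover have "R < real (\<Prod>T)" using T by (auto simp: levels_def)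
      ultimately show "ln R \<le> (\<Sum>p\<in>T. ln (real p))" using R by simp
    qed (use gn in auto)
    also have "\<dots> \<le> (\<Sum>T\<in>Pow P. ?g T * (\<Sum>p\<in>T. ln (real p)))"
      by (rule sum_mono2) (auto simp: finite_P intro!: mult_nonneg_nonneg gn sum_nonneg lnp)
    also have "\<dots> = (\<Sum>T\<in>Pow P. \<Sum>p\<in>P. if p \<in> T then ?g T * ln (real p) else 0)"
      unfolding sum_distrib_left by (intro sum.cong refl sum.mono_neutral_cong_left) (auto simp: finite_P)
    also have "\<dots> = (\<Sum>p\<in>P. \<Sum>T\<in>Pow P. if p \<in> T then ?g T * ln (real p) else 0)" by (rule sum.swap)
    also have "\<dots> \<le> (\<Sum>p\<in>P. odds p * ln (real p) * ?\<Pi>)"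
    proof (rule sum_mono)
      fix p assume p: "p \<in> P"
      have "(\<Sum>T\<in>Pow P. if p \<in> T then ?g T * ln (real p) else 0) = (\<Sum>T\<in>Pow (P - {p}). ?g (insert p T) * ln (real p))"
      proof -
        have "(\<Sum>T\<in>Pow P. if p \<in> T then ?g T * ln (real p) else 0) = (\<Sum>T\<in>{T\<in>Pow P. p \<in> T}. ?g T * ln (real p))"
          by (rule sum.mono_neutral_cong_right) (auto simp: finite_P)
        also have "\<dots> = (\<Sum>T\<in>Pow (P - {p}). ?g (insert p T) * ln (real p))"
          by (rule sum.reindex_bij_witness[where i="insert p" and j="\<lambda>T. T - {p}"]) (use p in \<open>auto simp: insert_absorb\<close>)
        finally show ?thesis .
      qed
      also have "\<dots> = (\<Sum>T\<in>Pow (P - {p}). odds p * ln (real p) * ?g T)"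
      proof (intro sum.cong refl)
        fix T assume "T \<in> Pow (P - {p})"
        then have "finite T" "p \<notin> T" using finite_P finite_subset[of T P] by auto
        then show "?g (insert p T) * ln (real p) = odds p * ln (real p) * ?g T" by simp
      qed
      also have "\<dots> = odds p * ln (real p) * (\<Sum>T\<in>Pow (P - {p}). ?g T)" by (rule sum_distrib_left[symmetric])
      \<comment> \<open>Enlarging the subsets avoiding \<open>p\<close> to all subsets restores the
        same Euler product for every \<open>p\<close>.\<close>
      also have "\<dots> \<le> odds p * ln (real p) * (\<Sum>T\<in>Pow P. ?g T)"
      proof (rule mult_left_mono)
        show "(\<Sum>T\<in>Pow (P - {p}). ?g T) \<le> (\<Sum>T\<in>Pow P. ?g T)" by (rule sum_mono2) (auto simp: finite_P intro!: gn)
        show "0 \<le> odds p * ln (real p)" using odds_bounds(1)[OF p] prime_ge_1_nat[OF prime_P[OF p]] by simp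
      qed
      also have "(\<Sum>T\<in>Pow P. ?g T) = ?\<Pi>" by (rule full[OF finite_P])
      finally show "(\<Sum>T\<in>Pow P. if p \<in> T then ?g T * ln (real p) else 0) \<le> odds p * ln (real p) * ?\<Pi>" .
    qed
    also have "\<dots> = ?\<Pi> * (\<Sum>p\<in>P. odds p * ln (real p))" by (simp add: sum_distrib_left mult.commute)
    also have "\<dots> \<le> ?\<Pi> * (ln R / 2)" using small \<Pi>0 by (rule mult_left_mono)
    finally show ?thesis .
  qed
  then have "(\<Sum>T\<in>Pow P - levels R. ?g T) \<le> ?\<Pi> / 2" using R by (simp add: field_simps)
  ultimately have 1: "sieve_sum R \<ge> ?\<Pi> / 2" by linarith
  have "exp (\<Sum>p\<in>P. density p) = (\<Prod>p\<in>P. exp (density p))" by (rule exp_sum[OF finite_P])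
  also have "\<dots> \<le> ?\<Pi>"
  proof (rule prod_mono)
    fix p assume p: "p \<in> P"
    have "1 - density p \<le> exp (- density p)" using exp_ge_add_one_self[of "- density p"] by simp
    then have "(1 - density p) * exp (density p) \<le> exp (- density p) * exp (density p)" by (rule mult_right_mono) simp
    also have "\<dots> = 1" by (simp flip: exp_add)
    finally have "exp (density p) \<le> 1 / (1 - density p)"
      using density_le[OF p] by (subst pos_le_divide_eq) (auto simp: mult.commute)
    then show "0 \<le> exp (density p) \<and> exp (density p) \<le> 1 + odds p" using odds_bounds(4)[OF p] by simp
  qed
  finally show ?thesis using 1 by linarith
qed

end
end

section \<open>Local obstructions\<close>

text \<open>A unit modulo \<open>p\<close> is a \<open>d\<close>-th power iff its power with this exponent is \<open>1\<close>.\<close>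

definition residue_exponent :: "nat \<Rightarrow> nat \<Rightarrow> nat" where
  "residue_exponent d p = (p - 1) div gcd d (p - 1)"

text \<open>Comparing powers of \<open>b\<close> and \<open>- c\<close> expresses that their
  quotient is not a \<open>d\<close>-th power without inverting anything modulo
  \<open>p\<close>.\<close>

definition obstructed :: "nat \<Rightarrow> nat \<Rightarrow> int \<Rightarrow> int \<Rightarrow> int \<Rightarrow> bool" where
  "obstructed d p a b c \<longleftrightarrow> int p dvd a \<and> \<not> int p ^ 2 dvd a \<and> \<not> int p dvd b \<and> \<not> int p dvd c \<and>
     \<not> [b ^ residue_exponent d p = (- c) ^ residue_exponent d p] (mod int p)"

definition bad :: "nat \<Rightarrow> nat \<Rightarrow> int \<Rightarrow> int \<Rightarrow> int \<Rightarrow> bool" where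
  "bad d p a b c \<longleftrightarrow> obstructed d p a b c \<or> obstructed d p b c a \<or> obstructed d p c a b"

lemma fermat_int:
  fixes y :: int
  assumes "prime p" "\<not> int p dvd y" shows "[y ^ (p - 1) = 1] (mod int p)"
proof -
  define n where "n = nat (y mod int p)"
  have p: "p > 0" using assms prime_gt_0_nat by blast
  have n: "int n = y mod int p" using p by (simp add: n_def)
  have ny: "[int n = y] (mod int p)" unfolding n by (simp add: unique_euclidean_semiring_class.cong_def)
  have "\<not> int p dvd int n" using assms(2) cong_dvd_iff[OF ny] cong_dvd_modulus by (metis dvd_mod_iff dvd_refl n)
  then have "\<not> p dvd n" by simp
  then have "[n ^ (p - 1) = 1] (mod p)" using assms(1) by (rule fermat_theorem[rotated])
  then have "[int (n ^ (p - 1)) = int 1] (mod int p)" by (simp only: cong_int_iff)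
  then have "[int n ^ (p - 1) = 1] (mod int p)" by simp
  moreover have "[y ^ (p - 1) = int n ^ (p - 1)] (mod int p)" using ny by (intro cong_pow cong_sym[OF ny])
  ultimately show ?thesis by (rule cong_trans[rotated])
qed

lemma residue_exponent_mult:
  "d * residue_exponent d p = (d div gcd d (p - 1)) * (p - 1)"
  unfolding residue_exponent_def by (metis div_mult_swap dvd_div_mult gcd_dvd1 gcd_dvd2 mult.commute)

text \<open>Modulo \<open>p\<close> the equation relates \<open>b * v^d\<close> and
  \<open>- c * w^d\<close>. If \<open>v\<close> were a unit, so would be \<open>w\<close>, and
  raising to \<open>residue_exponent\<close> turns both \<open>d\<close>-th powers into 1 by Fermat,
  contradicting the obstruction. So \<open>p\<close> divides \<open>v\<close> and \<open>w\<close>;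
  as \<open>d \<ge> 2\<close> their terms vanish modulo \<open>p^2\<close>, and since
  \<open>p\<close> divides \<open>a\<close> only once it must divide \<open>u\<close>.\<close>

lemma obstructed_imp_insoluble:
  assumes p: "prime p" and d: "d \<ge> 2" and ob: "obstructed d p a b c"
    and y: "int p ^ 2 dvd a * u ^ d + b * v ^ d + c * w ^ d"
  shows "int p dvd u \<and> int p dvd v \<and> int p dvd w"
proof -
  let ?k = "residue_exponent d p"
  have ip: "prime (int p)" using p by simp
  have a: "int p dvd a" "\<not> int p ^ 2 dvd a" and b: "\<not> int p dvd b" and c: "\<not> int p dvd c"
    and k: "\<not> [b ^ ?k = (- c) ^ ?k] (mod int p)" using ob by (auto simp: obstructed_def)
  have "int p dvd a * u ^ d + b * v ^ d + c * w ^ d" using y by (metis dvd_power_le dvd_refl dvd_trans one_le_numeral power_one_right)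
  then have bc: "int p dvd b * v ^ d + c * w ^ d" using a(1) by (metis add.assoc dvd_add_right_iff dvd_mult2)
  have vw: "int p dvd v \<longleftrightarrow> int p dvd w"
  proof
    assume "int p dvd v"
    then have "int p dvd b * v ^ d" using d by (intro dvd_mult dvd_power_le[of "int p" v 1, simplified]) (auto intro: dvd_trans dvd_power)
    then have "int p dvd c * w ^ d" using bc by (simp add: dvd_add_right_iff)
    then show "int p dvd w" using c ip by (metis prime_dvd_mult_iff prime_dvd_power)
  next
    assume "int p dvd w"
    then have "int p dvd c * w ^ d" using d by (intro dvd_mult dvd_power_le[of "int p" w 1, simplified]) (auto intro: dvd_trans dvd_power)
    then have "int p dvd b * v ^ d" using bc by (simp add: dvd_add_left_iff)
    then show "int p dvd v" using b ip by (metis prime_dvd_mult_iff prime_dvd_power)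
  qed
  have pv: "int p dvd v"
  proof (rule ccontr)
    assume nv: "\<not> int p dvd v"
    then have nw: "\<not> int p dvd w" using vw by simp
    have one: "[(t ^ d) ^ ?k = 1] (mod int p)" if "\<not> int p dvd t" for t
    proof -
      have "[(t ^ (p - 1)) ^ (d div gcd d (p - 1)) = 1 ^ (d div gcd d (p - 1))] (mod int p)"
        by (intro cong_pow fermat_int[OF p that])
      moreover have "(t ^ d) ^ ?k = (t ^ (p - 1)) ^ (d div gcd d (p - 1))"
        unfolding power_mult[symmetric] residue_exponent_mult by (simp add: mult.commute)
      ultimately show ?thesis by simp
    qed
    have "[b * v ^ d = - c * w ^ d] (mod int p)" using bc by (simp add: cong_iff_dvd_diff)
    then have "[(b * v ^ d) ^ ?k = (- c * w ^ d) ^ ?k] (mod int p)" by (rule cong_pow)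
    then have "[b ^ ?k * (v ^ d) ^ ?k = (- c) ^ ?k * (w ^ d) ^ ?k] (mod int p)" by (simp only: power_mult_distrib)
    moreover have "[b ^ ?k * (v ^ d) ^ ?k = b ^ ?k * 1] (mod int p)" by (intro cong_mult cong_refl one nv)
    moreover have "[(- c) ^ ?k * (w ^ d) ^ ?k = (- c) ^ ?k * 1] (mod int p)" by (intro cong_mult cong_refl one nw)
    ultimately have "[b ^ ?k = (- c) ^ ?k] (mod int p)" by (metis cong_sym cong_trans mult.right_neutral)
    with k show False ..
  qed
  have pw: "int p dvd w" using pv vw by simp
  have sq: "int p ^ 2 dvd t ^ d" if "int p dvd t" for t
    using dvd_trans[OF dvd_power_same[OF that, of 2] le_imp_power_dvd[OF d]] .
  have "int p ^ 2 dvd b * v ^ d + c * w ^ d" using sq[OF pv] sq[OF pw] by (intro dvd_add dvd_mult)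
  then have "int p ^ 2 dvd a * u ^ d" using y by (metis add.assoc dvd_add_left_iff)
  moreover obtain a' where a': "a = int p * a'" using a(1) by blast
  ultimately have "int p dvd a' * u ^ d" using p prime_gt_0_nat by (auto simp: power2_eq_square mult.assoc)
  moreover have "\<not> int p dvd a'" using a(2) a' by (auto simp: power2_eq_square)
  ultimately have "int p dvd u" using ip by (metis prime_dvd_mult_iff prime_dvd_power)
  then show ?thesis using pv pw by simp
qed

lemma bad_imp_insoluble:
  assumes "prime p" "d \<ge> 2" "bad d p a b c" "int p ^ 2 dvd a * u ^ d + b * v ^ d + c * w ^ d"
  shows "int p dvd u \<and> int p dvd v \<and> int p dvd w"
proof -
  have e: "int p ^ 2 dvd b * v ^ d + c * w ^ d + a * u ^ d" "int p ^ 2 dvd c * w ^ d + a * u ^ d + b * v ^ d"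
    using assms(4) by (simp_all add: add_ac)
  from assms(3) show ?thesis unfolding bad_def
    using obstructed_imp_insoluble[OF assms(1,2) _ assms(4)] obstructed_imp_insoluble[OF assms(1,2) _ e(1)]
      obstructed_imp_insoluble[OF assms(1,2) _ e(2)] by blast
qed

section \<open>Densities of the excluded classes\<close>

lemma obstructed_cong:
  assumes "[a = a'] (mod int (p ^ 2))" "[b = b'] (mod int (p ^ 2))" "[c = c'] (mod int (p ^ 2))"
  shows "obstructed d p a b c = obstructed d p a' b' c'"
proof -
  have m: "[x = x'] (mod int p)" if "[x = x'] (mod int (p ^ 2))" for x x'
    using that by (rule cong_dvd_modulus) (simp add: power2_eq_square)
  have d1: "int p dvd x \<longleftrightarrow> int p dvd x'" if "[x = x'] (mod int (p ^ 2))" for x x'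
    using m[OF that] by (metis cong_dvd_iff)
  have d2: "int p ^ 2 dvd a \<longleftrightarrow> int p ^ 2 dvd a'" using assms(1) by (metis cong_dvd_iff of_nat_power)
  have "[b ^ k = (- c) ^ k] (mod int p) \<longleftrightarrow> [b' ^ k = (- c') ^ k] (mod int p)" for k
  proof -
    have "[b ^ k = b' ^ k] (mod int p)" "[(- c) ^ k = (- c') ^ k] (mod int p)"
      using m[OF assms(2)] m[OF assms(3)] by (auto intro!: cong_pow simp: cong_minus_minus_iff)
    then show ?thesis by (metis cong_sym cong_trans)
  qed
  then show ?thesis unfolding obstructed_def using d1[OF assms(1)] d1[OF assms(2)] d1[OF assms(3)] d2 by simp
qed

lemma periodic3_bad: "periodic3 (p ^ 2) (bad d p)"
  unfolding periodic3_def bad_def using obstructed_cong by blast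

lemma box_sum_rotate: "box_sum l M (\<lambda>x y z. f y z x) = box_sum l M f"
proof -
  let ?I = "{l..<l + int M}"
  have "(\<Sum>x\<in>?I. \<Sum>y\<in>?I. \<Sum>z\<in>?I. f y z x) = (\<Sum>y\<in>?I. \<Sum>x\<in>?I. \<Sum>z\<in>?I. f y z x)" by (rule sum.swap)
  also have "\<dots> = (\<Sum>y\<in>?I. \<Sum>z\<in>?I. \<Sum>x\<in>?I. f y z x)" by (intro sum.cong refl sum.swap)
  finally show ?thesis by (simp add: box_sum_def)
qed

lemma box_sum_add: "box_sum l M (\<lambda>x y z. f x y z + g x y z) = box_sum l M f + box_sum l M g"
  by (simp add: box_sum_def sum.distrib)

lemma card_root_shift_le:
  assumes "prime p" "k > 0"
  shows "card {z\<in>{0..<int p}. [(- z) ^ k = e] (mod int p)} \<le> k"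
proof -
  have p: "p > 0" using assms prime_gt_0_nat by blast
  let ?f = "\<lambda>z. nat ((- z) mod int p)"
  have f: "int (?f z) = (- z) mod int p" for z using p by simp
  have "inj_on ?f {0..<int p}"
  proof (rule inj_onI)
    fix x y assume xy: "x \<in> {0..<int p}" "y \<in> {0..<int p}" "?f x = ?f y"
    then have "(- x) mod int p = (- y) mod int p" using f by metis
    then have "[- x = - y] (mod int p)" by (simp add: unique_euclidean_semiring_class.cong_def)
    then have "[x = y] (mod int p)" by (simp add: cong_minus_minus_iff)
    then show "x = y" using xy by (simp add: unique_euclidean_semiring_class.cong_def)
  qed
  then have "inj_on ?f {z\<in>{0..<int p}. [(- z) ^ k = e] (mod int p)}" by (rule inj_on_subset) auto
  moreover have "?f ` {z\<in>{0..<int p}. [(- z) ^ k = e] (mod int p)} \<subseteq> {x\<in>{..<p}. [x ^ k = nat (e mod int p)] (mod p)}"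
  proof
    fix x assume "x \<in> ?f ` {z\<in>{0..<int p}. [(- z) ^ k = e] (mod int p)}"
    then obtain z where z: "x = ?f z" "[(- z) ^ k = e] (mod int p)" by auto
    have "[int x ^ k = (- z) ^ k] (mod int p)"
      unfolding z(1) f by (intro cong_pow) (simp add: unique_euclidean_semiring_class.cong_def)
    then have "[int x ^ k = e mod int p] (mod int p)" using z(2) by (simp add: unique_euclidean_semiring_class.cong_def)
    moreover have "e mod int p = int (nat (e mod int p))" using p by simp
    ultimately have "[int (x ^ k) = int (nat (e mod int p))] (mod int p)" by simp
    then have "[x ^ k = nat (e mod int p)] (mod p)" by (simp only: cong_int_iff)
    moreover have "int x < int p" unfolding z(1) f using p by simp
    ultimately show "x \<in> {x\<in>{..<p}. [x ^ k = nat (e mod int p)] (mod p)}" by simp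
  qed
  ultimately have "card {z\<in>{0..<int p}. [(- z) ^ k = e] (mod int p)} \<le> card {x\<in>{..<p}. [x ^ k = nat (e mod int p)] (mod p)}"
    by (intro card_inj_on_le) auto
  also have "\<dots> \<le> k" by (rule roots_mod_prime_bound[OF assms])
  finally show ?thesis .
qed

text \<open>The \<open>p - 1\<close> multiples \<open>p * u\<close> with
  \<open>1 \<le> u < p\<close> serve as first coordinate. For each unit \<open>y\<close> modulo
  \<open>p\<close>, the excluded \<open>z\<close> are 0 and at most
  \<open>residue_exponent d p\<close> roots of a polynomial congruence, leaving at least
  \<open>(p - 1) * gcd_weight d p\<close>. The two latter coordinates matter only modulo
  \<open>p\<close>, hence the factor \<open>p^2\<close>.\<close>

lemma box_sum_obstructed_ge:
  assumes p: "prime p" and d: "d > 0"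
  shows "box_sum 0 (p ^ 2) (\<lambda>x y z. of_bool (obstructed d p x y z)) \<ge> real p ^ 2 * (real p - 1) ^ 3 * gcd_weight d p"
proof -
  let ?k = "residue_exponent d p" and ?I = "{0..<0 + int (p ^ 2)}"
  have p1: "p > 1" using p prime_gt_1_nat by blast
  let ?g = "gcd d (p - 1)"
  have g: "?g > 0" "?g dvd p - 1" using d by auto
  have k0: "?k > 0" unfolding residue_exponent_def using g p1 by (simp add: div_greater_zero_iff dvd_imp_le)
  have kr: "real p - 1 - real ?k = (real p - 1) * gcd_weight d p"
  proof -
    have "real ?k = real (p - 1) / real ?g" unfolding residue_exponent_def by (rule real_of_nat_div[OF g(2)])
    then show ?thesis using p1 by (simp add: gcd_weight_def of_nat_diff right_diff_distrib)
  qed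
  let ?A = "\<lambda>x. int p dvd x \<and> \<not> int p ^ 2 dvd x"
  let ?C = "\<lambda>y z. \<not> int p dvd y \<and> \<not> int p dvd z \<and> \<not> [y ^ ?k = (- z) ^ ?k] (mod int p)"
  have "box_sum 0 (p ^ 2) (\<lambda>x y z. of_bool (obstructed d p x y z))
      = (\<Sum>x\<in>?I. of_bool (?A x)) * (\<Sum>y\<in>?I. \<Sum>z\<in>?I. of_bool (?C y z))"
    unfolding box_sum_def sum_distrib_right obstructed_def
    unfolding sum_distrib_left by (intro sum.cong refl) auto
  moreover have "(\<Sum>x\<in>?I. of_bool (?A x) :: real) \<ge> real p - 1"
  proof -
    have "card {1..<p} \<le> card {x\<in>?I. ?A x}"
    proof (rule card_inj_on_le[where f="\<lambda>u. int p * int u"])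
      show "inj_on (\<lambda>u. int p * int u) {1..<p}" using p1 by (auto simp: inj_on_def)
      show "(\<lambda>u. int p * int u) ` {1..<p} \<subseteq> {x\<in>?I. ?A x}"
      proof
        fix x assume "x \<in> (\<lambda>u. int p * int u) ` {1..<p}"
        then obtain u where u: "x = int p * int u" "1 \<le> u" "u < p" by auto
        have "x < int p * int p" unfolding u(1) using u p1 by (intro mult_strict_left_mono) auto
        moreover have "\<not> int p ^ 2 dvd x"
        proof
          assume "int p ^ 2 dvd x"
          then have "int p dvd int u" using p1 by (simp add: u(1) power2_eq_square)
          then have "p \<le> u" using u dvd_imp_le by simp
          then show False using u by simp
        qed
        ultimately show "x \<in> {x\<in>?I. ?A x}" using u by (auto simp: power2_eq_square)
      qed
      show "finite {x\<in>?I. ?A x}" by (rule finite_subset[of _ ?I]) auto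
    qed
    then have "real p - 1 \<le> real (card {x\<in>?I. ?A x})" using p1 by (simp add: of_nat_diff flip: of_nat_le_iff)
    also have "\<dots> = (\<Sum>x\<in>?I. of_bool (?A x))" by (simp add: sum.If_cases of_bool_def Int_def conj_commute)
    finally show ?thesis .
  qed
  moreover have "(\<Sum>y\<in>?I. \<Sum>z\<in>?I. of_bool (?C y z) :: real) \<ge> real p ^ 2 * ((real p - 1) * ((real p - 1) * gcd_weight d p))"
  proof -
    have C: "?C y z = ?C y' z'" if "[y = y'] (mod int p)" "[z = z'] (mod int p)" for y z y' z'
    proof -
      have "int p dvd y \<longleftrightarrow> int p dvd y'" "int p dvd z \<longleftrightarrow> int p dvd z'" using that by (metis cong_dvd_iff)+
      moreover have "[y ^ ?k = y' ^ ?k] (mod int p)" "[(- z) ^ ?k = (- z') ^ ?k] (mod int p)"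
        using that by (auto intro!: cong_pow simp: cong_minus_minus_iff)
      then have "[y ^ ?k = (- z) ^ ?k] (mod int p) \<longleftrightarrow> [y' ^ ?k = (- z') ^ ?k] (mod int p)" by (metis cong_sym cong_trans)
      ultimately show ?thesis by simp
    qed
    have Cb: "(of_bool (?C y z) :: real) = of_bool (?C y' z')" if "[y = y'] (mod int p)" "[z = z'] (mod int p)" for y z y' z'
      using C[OF that] by simp
    have "(\<Sum>z\<in>?I. of_bool (?C y z) :: real) = real p * (\<Sum>z\<in>{0..<int p}. of_bool (?C y z))" for y
      unfolding power2_eq_square by (rule sum_periods) (use p1 in simp, intro Cb, auto)
    moreover have "(\<Sum>y\<in>?I. \<Sum>z\<in>{0..<int p}. of_bool (?C y z) :: real) = real p * (\<Sum>y\<in>{0..<int p}. \<Sum>z\<in>{0..<int p}. of_bool (?C y z))"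
      unfolding power2_eq_square by (rule sum_periods) (use p1 in simp, intro sum.cong refl Cb, auto)
    ultimately have "(\<Sum>y\<in>?I. \<Sum>z\<in>?I. of_bool (?C y z) :: real) = real p ^ 2 * (\<Sum>y\<in>{0..<int p}. \<Sum>z\<in>{0..<int p}. of_bool (?C y z))"
      by (simp only: sum_distrib_left[symmetric] power2_eq_square mult.assoc)
    moreover have "(\<Sum>y\<in>{0..<int p}. \<Sum>z\<in>{0..<int p}. of_bool (?C y z) :: real) \<ge> (\<Sum>y\<in>{1..<int p}. real p - 1 - real ?k)"
    proof -
      have "(\<Sum>z\<in>{0..<int p}. of_bool (?C y z) :: real) \<ge> real p - 1 - real ?k" if y: "y \<in> {1..<int p}" for y
      proof -
        have ny: "\<not> int p dvd y" using y zdvd_not_zless[of y "int p"] by auto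
        let ?Z = "{z\<in>{0..<int p}. [(- z) ^ ?k = y ^ ?k] (mod int p)}"
        have fin: "finite {z\<in>{0..<int p}. Q z}" for Q by (rule finite_subset[of _ "{0..<int p}"]) auto
        have "{0..<int p} - ({0} \<union> ?Z) \<subseteq> {z\<in>{0..<int p}. ?C y z}"
          using ny zdvd_not_zless by (auto simp: cong_sym_eq)
        then have "card ({0..<int p} - ({0} \<union> ?Z)) \<le> card {z\<in>{0..<int p}. ?C y z}" by (intro card_mono fin)
        moreover have "card {0..<int p} - card ({0} \<union> ?Z) \<le> card ({0..<int p} - ({0} \<union> ?Z))" by (intro diff_card_le_card_Diff finite_UnI fin) auto
        moreover have "card ({0} \<union> ?Z) \<le> 1 + ?k" using card_root_shift_le[OF p k0, of "y ^ ?k"] card_Un_le[of "{0}" ?Z] by simp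
        ultimately have "real p - 1 - real ?k \<le> real (card {z\<in>{0..<int p}. ?C y z})" by simp
        also have "\<dots> = (\<Sum>z\<in>{0..<int p}. of_bool (?C y z))" by (simp add: sum.If_cases of_bool_def Int_def conj_commute)
        finally show ?thesis .
      qed
      then have "(\<Sum>y\<in>{1..<int p}. real p - 1 - real ?k) \<le> (\<Sum>y\<in>{1..<int p}. \<Sum>z\<in>{0..<int p}. of_bool (?C y z))" by (rule sum_mono)
      also have "\<dots> \<le> (\<Sum>y\<in>{0..<int p}. \<Sum>z\<in>{0..<int p}. of_bool (?C y z))" by (rule sum_mono2) (auto intro: sum_nonneg)
      finally show ?thesis .
    qed
    moreover have "(\<Sum>y\<in>{1..<int p}. real p - 1 - real ?k) = (real p - 1) * ((real p - 1) * gcd_weight d p)"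
      using p1 unfolding kr by (simp add: of_nat_diff)
    ultimately show ?thesis by (simp add: mult_left_mono)
  qed
  ultimately have "box_sum 0 (p ^ 2) (\<lambda>x y z. of_bool (obstructed d p x y z)) \<ge> (real p - 1) * (real p ^ 2 * ((real p - 1) * ((real p - 1) * gcd_weight d p)))"
    using p1 gcd_weight_bounds(1)[OF d] by (simp only:) (intro mult_mono mult_nonneg_nonneg sum_nonneg, auto)
  then show ?thesis by (simp add: power3_eq_cube mult_ac)
qed

text \<open>The lower bound triples the count for one position of the divisible coefficient by
  rotating coordinates. The upper bound keeps only that some coordinate is divisible by
  \<open>p\<close>.\<close>

lemma box_sum_bad_bounds:
  assumes p: "prime p" and d: "d > 0"
  defines "W \<equiv> box_sum 0 (p ^ 2) (\<lambda>x y z. of_bool (bad d p x y z))"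
  shows "W \<ge> 3 * (real p ^ 2 * (real p - 1) ^ 3 * gcd_weight d p)" "W \<le> 3 * real p ^ 5"
proof -
  let ?o = "\<lambda>x y z. of_bool (obstructed d p x y z) :: real"
  \<comment> \<open>The three cases exclude one another, since each names the single coordinate
    divisible by \<open>p\<close>; so the indicators add up exactly.\<close>
  have "(\<lambda>x y z. of_bool (bad d p x y z) :: real) = (\<lambda>x y z. ?o x y z + ?o y z x + ?o z x y)"
    by (intro ext) (auto simp: bad_def obstructed_def)
  then have "W = box_sum 0 (p ^ 2) ?o + box_sum 0 (p ^ 2) (\<lambda>x y z. ?o y z x) + box_sum 0 (p ^ 2) (\<lambda>x y z. ?o z x y)"
    unfolding W_def by (simp only: box_sum_add)
  also have "box_sum 0 (p ^ 2) (\<lambda>x y z. ?o z x y) = box_sum 0 (p ^ 2) (\<lambda>x y z. (\<lambda>x y z. ?o z x y) y z x)"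
    by (rule box_sum_rotate[symmetric])
  finally have "W = 3 * box_sum 0 (p ^ 2) ?o" using box_sum_rotate[of 0 "p ^ 2" ?o] by simp
  then show "W \<ge> 3 * (real p ^ 2 * (real p - 1) ^ 3 * gcd_weight d p)" using box_sum_obstructed_ge[OF p d] by simp
  let ?e = "\<lambda>x y z. of_bool (int p dvd x) :: real"
  have p0: "p > 0" using p prime_gt_0_nat by blast
  have "(\<Sum>x\<in>{0..<0 + int (p * p)}. of_bool (int p dvd x) :: real) = real p * (\<Sum>x\<in>{0..<int p}. of_bool (int p dvd x))"
    by (rule sum_periods[OF p0]) (simp add: cong_dvd_iff)
  also have "(\<Sum>x\<in>{0..<int p}. of_bool (int p dvd x) :: real) = (\<Sum>x\<in>{0..<int p}. if x = 0 then 1 else 0)"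
    using zdvd_not_zless[of _ "int p"] by (intro sum.cong refl) auto
  also have "\<dots> = 1" using p0 by (subst sum.delta) auto
  finally have "box_sum 0 (p ^ 2) ?e = real p ^ 5"
    unfolding box_sum_def by (simp add: power2_eq_square sum_distrib_left[symmetric] eval_nat_numeral)
  moreover have "W \<le> box_sum 0 (p ^ 2) (\<lambda>x y z. ?e x y z + ?e y z x + ?e z x y)"
    unfolding W_def by (rule box_sum_mono) (auto simp: bad_def obstructed_def)
  moreover have "box_sum 0 (p ^ 2) (\<lambda>x y z. ?e x y z + ?e y z x + ?e z x y) = 3 * box_sum 0 (p ^ 2) ?e"
  proof -
    have "box_sum 0 (p ^ 2) (\<lambda>x y z. ?e z x y) = box_sum 0 (p ^ 2) (\<lambda>x y z. (\<lambda>x y z. ?e z x y) y z x)"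
      by (rule box_sum_rotate[symmetric])
    then show ?thesis using box_sum_rotate[of 0 "p ^ 2" ?e] by (simp only: box_sum_add)
  qed
  ultimately show "W \<le> 3 * real p ^ 5" by simp
qed

section \<open>Adelic points\<close>

lemma rat_fraction: obtains a b :: int where "b > 0" "q = of_int a / of_int b" "quotient_of q = (a, b)"
  by (metis quotient_of_denom_pos quotient_of_div surj_pair)

section \<open>The p-adic absolute value on the rationals\<close>

context
  fixes p :: nat
  assumes p: "prime p"
begin

lemma powi_le_iff: "real p powi m \<le> real p powi n \<longleftrightarrow> m \<le> n"
proof -
  have "real p > 1" using prime_gt_1_nat[OF p] by simp
  then show ?thesis
    using power_int_strict_increasing[of n m "real p"] power_int_increasing[of m n "real p"] by (cases "m \<le> n") auto
qed

lemma padic_abs_frac: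
  assumes "a \<noteq> 0" "b \<noteq> 0"
  shows "padic_abs p (of_int a / of_int b) = real p powi (int (multiplicity (int p) b) - int (multiplicity (int p) a))"
proof -
  obtain n m where nm: "m > 0" "(of_int a / of_int b :: rat) = of_int n / of_int m" "quotient_of (of_int a / of_int b) = (n, m)"
    by (rule rat_fraction)
  have "(of_int (a * m) :: rat) = of_int (n * b)" using nm(1,2) assms by (simp add: field_simps)
  then have e: "a * m = n * b" by (simp only: of_int_eq_iff)
  then have n0: "n \<noteq> 0" using assms nm(1) by auto
  have "multiplicity (int p) (a * m) = multiplicity (int p) (n * b)" by (simp only: e)
  then have "multiplicity (int p) a + multiplicity (int p) m = multiplicity (int p) n + multiplicity (int p) b"
    using p assms nm(1) n0 by (simp add: prime_elem_multiplicity_mult_distrib)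
  then have "int (multiplicity (int p) m) - int (multiplicity (int p) n) = int (multiplicity (int p) b) - int (multiplicity (int p) a)"
    by linarith
  then show ?thesis using assms by (simp add: padic_abs_def nm(3))
qed

lemma padic_abs_0 [simp]: "padic_abs p 0 = 0"
  and padic_abs_1 [simp]: "padic_abs p 1 = 1"
  by (simp_all add: padic_abs_def)

lemma padic_abs_pos: "q \<noteq> 0 \<Longrightarrow> padic_abs p q > 0"
  using prime_gt_0_nat[OF p] by (simp add: padic_abs_def zero_less_power_int)

lemma padic_abs_nonneg [simp]: "padic_abs p q \<ge> 0"
  using padic_abs_pos[of q] by (cases "q = 0") auto

lemma padic_abs_mult: "padic_abs p (q * r) = padic_abs p q * padic_abs p r"
proof (cases "q = 0 \<or> r = 0")
  case False
  obtain a b where ab: "b > 0" "q = of_int a / of_int b" by (metis rat_fraction)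
  obtain c d where cd: "d > 0" "r = of_int c / of_int d" by (metis rat_fraction)
  have nz: "a \<noteq> 0" "b \<noteq> 0" "c \<noteq> 0" "d \<noteq> 0" using False ab cd by auto
  have "q * r = of_int (a * c) / of_int (b * d)" by (simp add: ab cd)
  then have "padic_abs p (q * r) = real p powi (int (multiplicity (int p) (b * d)) - int (multiplicity (int p) (a * c)))"
    using nz padic_abs_frac[of "a * c" "b * d"] by simp
  also have "\<dots> = real p powi ((int (multiplicity (int p) b) - int (multiplicity (int p) a)) + (int (multiplicity (int p) d) - int (multiplicity (int p) c)))"
    using nz p by (simp add: prime_elem_multiplicity_mult_distrib algebra_simps)
  also have "\<dots> = padic_abs p q * padic_abs p r"
    unfolding ab cd padic_abs_frac[OF nz(1,2)] padic_abs_frac[OF nz(3,4)]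
    using prime_gt_0_nat[OF p] by (intro power_int_add) auto
  finally show ?thesis .
qed auto

lemma padic_abs_add_le: "padic_abs p (q + r) \<le> max (padic_abs p q) (padic_abs p r)"
proof (cases "q = 0 \<or> r = 0 \<or> q + r = 0")
  case False
  have p1: "real p > 1" using prime_gt_1_nat[OF p] by simp
  obtain a b where ab: "b > 0" "q = of_int a / of_int b" by (metis rat_fraction)
  obtain c d where cd: "d > 0" "r = of_int c / of_int d" by (metis rat_fraction)
  have e: "q = of_int (a * d) / of_int (b * d)" "r = of_int (c * b) / of_int (b * d)" using ab cd by auto
  then have e': "q + r = of_int (a * d + c * b) / of_int (b * d)" by (simp add: add_divide_distrib)
  let ?m = "multiplicity (int p)"
  have nz: "a * d \<noteq> 0" "c * b \<noteq> 0" "b * d \<noteq> 0" using False ab cd by auto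
  have nz4: "a * d + c * b \<noteq> 0"
  proof
    assume "a * d + c * b = 0"
    with e' have "q + r = 0" by (simp only: of_int_0 div_0)
    with False show False by simp
  qed
  have "min (?m (a * d)) (?m (c * b)) \<le> ?m (a * d + c * b)"
    using nz nz4 prime_gt_1_nat[OF p]
    by (intro multiplicity_geI dvd_add) (auto intro: multiplicity_dvd')
  then have "padic_abs p (q + r) \<le> real p powi (int (?m (b * d)) - int (min (?m (a * d)) (?m (c * b))))"
    unfolding e' padic_abs_frac[OF nz4 nz(3)] by (simp add: powi_le_iff)
  also have "\<dots> = max (padic_abs p q) (padic_abs p r)"
    unfolding e padic_abs_frac[OF nz(1,3)] padic_abs_frac[OF nz(2,3)]
    by (auto simp: min_def max_def powi_le_iff)
  finally show ?thesis .
qed (auto simp: padic_abs_pos less_imp_le max_def)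

lemma padic_abs_minus [simp]: "padic_abs p (- q) = padic_abs p q"
proof -
  have "padic_abs p (-1) ^ 2 = 1" using padic_abs_mult[of "-1" "-1"] by (simp add: power2_eq_square)
  then have "padic_abs p (-1) = 1" using padic_abs_nonneg[of "-1"] by (auto simp: power2_eq_1_iff)
  then show ?thesis using padic_abs_mult[of "-1" q] by simp
qed

lemma padic_abs_diff_le: "padic_abs p (q - r) \<le> max (padic_abs p q) (padic_abs p r)"
  using padic_abs_add_le[of q "- r"] by simp

lemma padic_abs_power: "padic_abs p (q ^ n) = padic_abs p q ^ n"
  by (induction n) (auto simp: padic_abs_mult)

text \<open>The translation from p-adic smallness to divisibility that finally turns a limit
  statement into a congruence.\<close>

lemma padic_abs_int_le_iff: "padic_abs p (of_int n) \<le> 1 / real p ^ k \<longleftrightarrow> int p ^ k dvd n"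
proof (cases "n = 0")
  case False
  have p1: "real p > 1" using prime_gt_1_nat[OF p] by simp
  have "padic_abs p (of_int n) = real p powi (- int (multiplicity (int p) n))"
    using padic_abs_frac[OF False, of 1] by simp
  moreover have "1 / real p ^ k = real p powi (- int k)" by (simp add: power_int_minus field_simps)
  ultimately have "padic_abs p (of_int n) \<le> 1 / real p ^ k \<longleftrightarrow> k \<le> multiplicity (int p) n"
    by (simp add: powi_le_iff)
  then show ?thesis using False prime_gt_1_nat[OF p] by (simp add: power_dvd_iff_le_multiplicity)
qed simp

lemma padic_abs_int_le_1: "padic_abs p (of_int n) \<le> 1"
  using padic_abs_int_le_iff[of n 0] by simp

lemma padic_abs_le_1_denominator:
  assumes "padic_abs p q \<le> 1"
  obtains a b where "q = of_int a / of_int b" "b > 0" "\<not> int p dvd b"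
proof -
  obtain a b where ab: "b > 0" "q = of_int a / of_int b" "quotient_of q = (a, b)" by (rule rat_fraction)
  have "\<not> int p dvd b"
  proof
    assume pb: "int p dvd b"
    have "coprime a b" using ab(3) by (rule quotient_of_coprime)
    then have na: "\<not> int p dvd a" using pb p by (meson coprime_common_divisor not_prime_unit prime_nat_int_transfer)
    then have a0: "a \<noteq> 0" by auto
    have "multiplicity (int p) a = 0" using na by (simp add: not_dvd_imp_multiplicity_0)
    moreover have "multiplicity (int p) b \<ge> 1" using pb ab(1) prime_gt_1_nat[OF p] by (intro multiplicity_geI) auto
    ultimately have "padic_abs p q = real p ^ multiplicity (int p) b" "multiplicity (int p) b > 0"
      unfolding ab(2) using padic_abs_frac[OF a0, of b] ab(1) by simp_all
    moreover have "1 < real p ^ multiplicity (int p) b"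
      using \<open>multiplicity (int p) b > 0\<close> prime_gt_1_nat[OF p] by (intro one_less_power) auto
    ultimately show False using assms by simp
  qed
  then show ?thesis using that ab by blast
qed

section \<open>Cauchy sequences, null sequences and the quotient ring\<close>

lemma padic_cauchy_sel:
  "x \<in> carrier (padic_cauchy p) \<longleftrightarrow> (\<forall>e>0. \<exists>N. \<forall>m\<ge>N. \<forall>n\<ge>N. padic_abs p (x m - x n) < e)"
  "x \<otimes>\<^bsub>padic_cauchy p\<^esub> y = (\<lambda>n. x n * y n)" "x \<oplus>\<^bsub>padic_cauchy p\<^esub> y = (\<lambda>n. x n + y n)"
  "\<one>\<^bsub>padic_cauchy p\<^esub> = (\<lambda>_. 1)" "\<zero>\<^bsub>padic_cauchy p\<^esub> = (\<lambda>_. 0)"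
  by (simp_all add: padic_cauchy_def)

lemma padic_cauchy_const: "(\<lambda>_. q) \<in> carrier (padic_cauchy p)"
  by (simp add: padic_cauchy_sel)

lemma padic_cauchy_bounded:
  assumes "x \<in> carrier (padic_cauchy p)" obtains B where "B > 0" "\<And>n. padic_abs p (x n) \<le> B"
proof -
  obtain N where N: "\<And>m n. m \<ge> N \<Longrightarrow> n \<ge> N \<Longrightarrow> padic_abs p (x m - x n) < 1"
    using assms unfolding padic_cauchy_sel by (metis zero_less_one)
  define B where "B = 1 + (\<Sum>n\<le>N. padic_abs p (x n))"
  have S0: "0 \<le> (\<Sum>n\<le>N. padic_abs p (x n))" by (intro sum_nonneg) simp
  have S: "padic_abs p (x n) \<le> (\<Sum>n\<le>N. padic_abs p (x n))" if "n \<le> N" for n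
    using that by (intro member_le_sum) auto
  have "padic_abs p (x n) \<le> B" for n
  proof (cases "n \<le> N")
    case True then show ?thesis using S[OF True] by (simp add: B_def)
  next
    case False
    then have "padic_abs p (x n - x N) < 1" by (intro N) auto
    then show ?thesis using padic_abs_add_le[of "x n - x N" "x N", simplified] S[OF order_refl] S0
      unfolding B_def by linarith
  qed
  moreover have "B > 0" unfolding B_def by (intro add_pos_nonneg sum_nonneg) auto
  ultimately show ?thesis using that by blast
qed

lemma padic_cauchy_add:
  assumes "x \<in> carrier (padic_cauchy p)" "y \<in> carrier (padic_cauchy p)"
  shows "(\<lambda>n. x n + y n) \<in> carrier (padic_cauchy p)"
  unfolding padic_cauchy_sel
proof (intro allI impI)
  fix e :: real assume e: "e > 0"
  obtain N where N: "\<And>m n. m \<ge> N \<Longrightarrow> n \<ge> N \<Longrightarrow> padic_abs p (x m - x n) < e"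
    using assms(1) e unfolding padic_cauchy_sel by metis
  obtain M where M: "\<And>m n. m \<ge> M \<Longrightarrow> n \<ge> M \<Longrightarrow> padic_abs p (y m - y n) < e"
    using assms(2) e unfolding padic_cauchy_sel by metis
  have "padic_abs p ((x m + y m) - (x n + y n)) < e" if "m \<ge> max N M" "n \<ge> max N M" for m n
  proof -
    have e: "(x m + y m) - (x n + y n) = (x m - x n) + (y m - y n)" by simp
    show ?thesis unfolding e using padic_abs_add_le[of "x m - x n" "y m - y n"] N[of m n] M[of m n] that by simp
  qed
  then show "\<exists>N. \<forall>m\<ge>N. \<forall>n\<ge>N. padic_abs p ((x m + y m) - (x n + y n)) < e" by blast
qed

lemma padic_cauchy_mult:
  assumes "x \<in> carrier (padic_cauchy p)" "y \<in> carrier (padic_cauchy p)"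
  shows "(\<lambda>n. x n * y n) \<in> carrier (padic_cauchy p)"
  unfolding padic_cauchy_sel
proof (intro allI impI)
  fix e :: real assume e: "e > 0"
  obtain A where A: "A > 0" "\<And>n. padic_abs p (x n) \<le> A" using padic_cauchy_bounded[OF assms(1)] by blast
  obtain B where B: "B > 0" "\<And>n. padic_abs p (y n) \<le> B" using padic_cauchy_bounded[OF assms(2)] by blast
  have eA: "e / A > 0" and eB: "e / B > 0" using e A B by auto
  obtain N where N: "\<And>m n. m \<ge> N \<Longrightarrow> n \<ge> N \<Longrightarrow> padic_abs p (x m - x n) < e / B"
    using assms(1) eB unfolding padic_cauchy_sel by metis
  obtain M where M: "\<And>m n. m \<ge> M \<Longrightarrow> n \<ge> M \<Longrightarrow> padic_abs p (y m - y n) < e / A"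
    using assms(2) eA unfolding padic_cauchy_sel by metis
  have "padic_abs p (x m * y m - x n * y n) < e" if "m \<ge> max N M" "n \<ge> max N M" for m n
  proof -
    have "x m * y m - x n * y n = (x m - x n) * y m + x n * (y m - y n)" by (simp add: algebra_simps)
    then have "padic_abs p (x m * y m - x n * y n) \<le> max (padic_abs p (x m - x n) * padic_abs p (y m)) (padic_abs p (x n) * padic_abs p (y m - y n))"
      using padic_abs_add_le[of "(x m - x n) * y m" "x n * (y m - y n)"] by (simp add: padic_abs_mult)
    moreover have "padic_abs p (x m - x n) * padic_abs p (y m) < e"
    proof -
      have "padic_abs p (x m - x n) * padic_abs p (y m) \<le> padic_abs p (x m - x n) * B" using B by (intro mult_left_mono) auto
      also have "\<dots> < e" using N[of m n] that B by (simp add: pos_less_divide_eq)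
      finally show ?thesis .
    qed
    moreover have "padic_abs p (x n) * padic_abs p (y m - y n) < e"
    proof -
      have "padic_abs p (x n) * padic_abs p (y m - y n) \<le> A * padic_abs p (y m - y n)" using A by (intro mult_right_mono) auto
      also have "\<dots> < e" using M[of m n] that A by (simp add: pos_less_divide_eq mult.commute)
      finally show ?thesis .
    qed
    ultimately show ?thesis by linarith
  qed
  then show "\<exists>N. \<forall>m\<ge>N. \<forall>n\<ge>N. padic_abs p (x m * y m - x n * y n) < e" by blast
qed

lemma padic_cauchy_minus:
  assumes "x \<in> carrier (padic_cauchy p)" shows "(\<lambda>n. - x n) \<in> carrier (padic_cauchy p)"
  using padic_cauchy_mult[OF padic_cauchy_const[of "-1"] assms] by simp

lemma padic_cauchy_cring: "cring (padic_cauchy p)"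
proof (rule cringI)
  show "abelian_group (padic_cauchy p)"
  proof (rule abelian_groupI)
    fix x assume "x \<in> carrier (padic_cauchy p)"
    then show "\<exists>y\<in>carrier (padic_cauchy p). y \<oplus>\<^bsub>padic_cauchy p\<^esub> x = \<zero>\<^bsub>padic_cauchy p\<^esub>"
      using padic_cauchy_minus by (intro bexI[of _ "\<lambda>n. - x n"]) (auto simp: padic_cauchy_sel(2-5))
  qed (auto simp: padic_cauchy_sel(2-5) padic_cauchy_add padic_cauchy_const add_ac)
  show "comm_monoid (padic_cauchy p)"
    by (rule comm_monoidI) (auto simp: padic_cauchy_sel(2-5) padic_cauchy_mult padic_cauchy_const mult_ac)
qed (auto simp: padic_cauchy_sel(2-5) algebra_simps)

lemma padic_null_iff: "x \<in> padic_null p \<longleftrightarrow> (\<forall>e>0. \<exists>N. \<forall>n\<ge>N. padic_abs p (x n) < e)"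
  by (simp add: padic_null_def LIMSEQ_iff)

lemma padic_null_subset: "padic_null p \<subseteq> carrier (padic_cauchy p)"
proof
  fix x assume x: "x \<in> padic_null p"
  show "x \<in> carrier (padic_cauchy p)" unfolding padic_cauchy_sel
  proof (intro allI impI)
    fix e :: real assume "e > 0"
    then obtain N where "\<And>n. n \<ge> N \<Longrightarrow> padic_abs p (x n) < e" using x unfolding padic_null_iff by metis
    then have "padic_abs p (x m - x n) < e" if "m \<ge> N" "n \<ge> N" for m n
      using padic_abs_diff_le[of "x m" "x n"] that by (metis le_less_trans max_less_iff_conj)
    then show "\<exists>N. \<forall>m\<ge>N. \<forall>n\<ge>N. padic_abs p (x m - x n) < e" by blast
  qed
qed

lemma padic_null_add:
  assumes "x \<in> padic_null p" "y \<in> padic_null p" shows "(\<lambda>n. x n + y n) \<in> padic_null p"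
  unfolding padic_null_iff
proof (intro allI impI)
  fix e :: real assume e: "e > 0"
  obtain N where N: "\<And>n. n \<ge> N \<Longrightarrow> padic_abs p (x n) < e" using assms(1) e unfolding padic_null_iff by metis
  obtain M where M: "\<And>n. n \<ge> M \<Longrightarrow> padic_abs p (y n) < e" using assms(2) e unfolding padic_null_iff by metis
  have "padic_abs p (x n + y n) < e" if "n \<ge> max N M" for n
    using padic_abs_add_le[of "x n" "y n"] N[of n] M[of n] that by simp
  then show "\<exists>N. \<forall>n\<ge>N. padic_abs p (x n + y n) < e" by blast
qed

lemma padic_null_mult:
  assumes "x \<in> carrier (padic_cauchy p)" "y \<in> padic_null p" shows "(\<lambda>n. x n * y n) \<in> padic_null p"
  unfolding padic_null_iff
proof (intro allI impI)
  fix e :: real assume e: "e > 0"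
  obtain A where A: "A > 0" "\<And>n. padic_abs p (x n) \<le> A" using padic_cauchy_bounded[OF assms(1)] by blast
  then have "e / A > 0" using e by simp
  then obtain N where N: "\<And>n. n \<ge> N \<Longrightarrow> padic_abs p (y n) < e / A" using assms(2) unfolding padic_null_iff by metis
  have "padic_abs p (x n * y n) < e" if "n \<ge> N" for n
  proof -
    have "padic_abs p (x n * y n) \<le> A * padic_abs p (y n)" using A by (auto simp: padic_abs_mult intro!: mult_right_mono)
    also have "\<dots> < e" using N[OF that] A by (simp add: pos_less_divide_eq mult.commute)
    finally show ?thesis .
  qed
  then show "\<exists>N. \<forall>n\<ge>N. padic_abs p (x n * y n) < e" by blast
qed

lemma padic_null_ideal: "ideal (padic_null p) (padic_cauchy p)"
proof (rule idealI)
  interpret cring "padic_cauchy p" by (rule padic_cauchy_cring)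
  show "ring (padic_cauchy p)" ..
  show "subgroup (padic_null p) (add_monoid (padic_cauchy p))"
  proof (rule add.subgroupI)
    show "padic_null p \<subseteq> carrier (padic_cauchy p)" by (rule padic_null_subset)
    have "(\<lambda>_. 0) \<in> padic_null p" by (auto simp: padic_null_iff)
    then show "padic_null p \<noteq> {}" by blast
    show "\<ominus>\<^bsub>padic_cauchy p\<^esub> a \<in> padic_null p" if a: "a \<in> padic_null p" for a
    proof -
      have "\<ominus>\<^bsub>padic_cauchy p\<^esub> a = (\<lambda>n. - a n)"
        using a padic_null_subset padic_cauchy_minus[of a]
        by (intro minus_equality) (auto simp: padic_cauchy_sel(2-5))
      then show ?thesis using padic_null_mult[OF padic_cauchy_const[of "-1"] a] by simp
    qed
    show "a \<oplus>\<^bsub>padic_cauchy p\<^esub> b \<in> padic_null p" if "a \<in> padic_null p" "b \<in> padic_null p" for a b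
      using padic_null_add[OF that] by (simp add: padic_cauchy_sel)
  qed
  show "x \<otimes>\<^bsub>padic_cauchy p\<^esub> a \<in> padic_null p" "a \<otimes>\<^bsub>padic_cauchy p\<^esub> x \<in> padic_null p"
    if "a \<in> padic_null p" "x \<in> carrier (padic_cauchy p)" for a x
    using padic_null_mult[OF that(2,1)] by (simp_all add: padic_cauchy_sel mult.commute)
qed

lemma padic_field_cring: "cring (padic_field p)"
  unfolding padic_field_def by (rule ideal.quotient_is_cring[OF padic_null_ideal padic_cauchy_cring])

definition padic_class :: "(nat \<Rightarrow> rat) \<Rightarrow> (nat \<Rightarrow> rat) set" where
  "padic_class x = padic_null p +>\<^bsub>padic_cauchy p\<^esub> x"

lemma padic_class_hom: "padic_class \<in> ring_hom (padic_cauchy p) (padic_field p)"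
  unfolding padic_field_def padic_class_def[abs_def] by (rule ideal.rcos_ring_hom[OF padic_null_ideal])

lemma padic_class_simps:
  assumes "x \<in> carrier (padic_cauchy p)" "y \<in> carrier (padic_cauchy p)"
  shows "padic_class x \<in> carrier (padic_field p)"
    "padic_class x \<otimes>\<^bsub>padic_field p\<^esub> padic_class y = padic_class (\<lambda>n. x n * y n)"
    "padic_class x \<oplus>\<^bsub>padic_field p\<^esub> padic_class y = padic_class (\<lambda>n. x n + y n)"
  using ring_hom_closed[OF padic_class_hom assms(1)] ring_hom_mult[OF padic_class_hom assms] ring_hom_add[OF padic_class_hom assms]
  by (auto simp: padic_cauchy_sel(2-5))

lemma padic_class_one: "\<one>\<^bsub>padic_field p\<^esub> = padic_class (\<lambda>_. 1)"
  using ring_hom_one[OF padic_class_hom] by (simp add: padic_cauchy_sel)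

lemma padic_class_zero: "\<zero>\<^bsub>padic_field p\<^esub> = padic_class (\<lambda>_. 0)"
  using ring_hom_zero[OF padic_class_hom] padic_cauchy_cring padic_field_cring
  by (simp add: padic_cauchy_sel cring.axioms(1))

lemma padic_class_power:
  assumes "x \<in> carrier (padic_cauchy p)"
  shows "padic_class x [^]\<^bsub>padic_field p\<^esub> (k::nat) = padic_class (\<lambda>n. x n ^ k)" "(\<lambda>n. x n ^ k) \<in> carrier (padic_cauchy p)"
proof -
  have "padic_class x [^]\<^bsub>padic_field p\<^esub> k = padic_class (\<lambda>n. x n ^ k) \<and> (\<lambda>n. x n ^ k) \<in> carrier (padic_cauchy p)"
  proof (induction k)
    case 0 show ?case using padic_cauchy_const by (simp add: padic_class_one)
  next
    case (Suc k)
    then show ?case using padic_class_simps(2)[of "\<lambda>n. x n ^ k" x] padic_cauchy_mult[of "\<lambda>n. x n ^ k" x] assms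
      by (simp add: mult.commute)
  qed
  then show "padic_class x [^]\<^bsub>padic_field p\<^esub> k = padic_class (\<lambda>n. x n ^ k)" "(\<lambda>n. x n ^ k) \<in> carrier (padic_cauchy p)" by auto
qed

lemma padic_class_eq:
  assumes "x \<in> carrier (padic_cauchy p)" "y \<in> carrier (padic_cauchy p)"
  shows "padic_class x = padic_class y \<longleftrightarrow> (\<lambda>n. x n - y n) \<in> padic_null p"
proof -
  interpret cring "padic_cauchy p" by (rule padic_cauchy_cring)
  have "\<ominus>\<^bsub>padic_cauchy p\<^esub> y = (\<lambda>n. - y n)"
    using assms padic_cauchy_minus[of y] by (intro minus_equality) (auto simp: padic_cauchy_sel(2-5))
  then have "x \<ominus>\<^bsub>padic_cauchy p\<^esub> y = (\<lambda>n. x n - y n)" by (simp add: a_minus_def padic_cauchy_sel(2-5))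
  then show ?thesis
    using quotient_eq_iff_same_a_r_cos[OF padic_null_ideal assms] by (simp add: padic_class_def)
qed

lemma padic_field_rep:
  assumes "\<xi> \<in> carrier (padic_field p)" obtains x where "x \<in> carrier (padic_cauchy p)" "\<xi> = padic_class x"
  using assms by (auto simp: padic_field_def FactRing_def A_RCOSETS_def' padic_class_def)

lemma mem_padic_class: assumes "x \<in> carrier (padic_cauchy p)" shows "y \<in> padic_class x \<longleftrightarrow> y \<in> carrier (padic_cauchy p) \<and> padic_class y = padic_class x"
proof -
  interpret cring "padic_cauchy p" by (rule padic_cauchy_cring)
  interpret I: ideal "padic_null p" "padic_cauchy p" by (rule padic_null_ideal)
  show ?thesis
  proof
    assume y: "y \<in> padic_class x"
    then show "y \<in> carrier (padic_cauchy p) \<and> padic_class y = padic_class x"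
      using a_repr_independence[of y "padic_null p" x] a_r_coset_subset_G[OF padic_null_subset assms] assms I.a_subgroup
      by (auto simp: padic_class_def)
  next
    assume "y \<in> carrier (padic_cauchy p) \<and> padic_class y = padic_class x"
    then show "y \<in> padic_class x" using abelian_subgroup.a_rcos_self[OF abelian_subgroupI3[OF I.is_additive_subgroup is_abelian_group], of y] by (auto simp: padic_class_def)
  qed
qed

lemma padic_integers_iff:
  "\<xi> \<in> padic_integers p \<longleftrightarrow> (\<exists>x\<in>carrier (padic_cauchy p). \<xi> = padic_class x \<and> (\<forall>n. padic_abs p (x n) \<le> 1))"
proof
  assume "\<xi> \<in> padic_integers p"
  then obtain x where x: "\<xi> \<in> carrier (padic_field p)" "x \<in> \<xi>" "\<forall>n. padic_abs p (x n) \<le> 1" by (auto simp: padic_integers_def)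
  obtain y where y: "y \<in> carrier (padic_cauchy p)" "\<xi> = padic_class y" by (rule padic_field_rep[OF x(1)])
  then show "\<exists>x\<in>carrier (padic_cauchy p). \<xi> = padic_class x \<and> (\<forall>n. padic_abs p (x n) \<le> 1)"
    using x mem_padic_class[OF y(1), of x] by auto
next
  assume "\<exists>x\<in>carrier (padic_cauchy p). \<xi> = padic_class x \<and> (\<forall>n. padic_abs p (x n) \<le> 1)"
  then obtain x where x: "x \<in> carrier (padic_cauchy p)" "\<xi> = padic_class x" "\<forall>n. padic_abs p (x n) \<le> 1" by blast
  then show "\<xi> \<in> padic_integers p"
    using padic_class_simps(1)[OF x(1) x(1)] mem_padic_class[OF x(1), of x] by (auto simp: padic_integers_def)
qed

lemma padic_integers_closed:
  assumes "\<xi> \<in> padic_integers p" "\<eta> \<in> padic_integers p"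
  shows "\<xi> \<otimes>\<^bsub>padic_field p\<^esub> \<eta> \<in> padic_integers p" "\<xi> \<oplus>\<^bsub>padic_field p\<^esub> \<eta> \<in> padic_integers p"
proof -
  obtain x where x: "x \<in> carrier (padic_cauchy p)" "\<xi> = padic_class x" "\<And>n. padic_abs p (x n) \<le> 1" using assms(1) unfolding padic_integers_iff by blast
  obtain y where y: "y \<in> carrier (padic_cauchy p)" "\<eta> = padic_class y" "\<And>n. padic_abs p (y n) \<le> 1" using assms(2) unfolding padic_integers_iff by blast
  have "padic_abs p (x n * y n) \<le> 1" for n using x(3)[of n] y(3)[of n] by (simp add: padic_abs_mult mult_le_one)
  then show "\<xi> \<otimes>\<^bsub>padic_field p\<^esub> \<eta> \<in> padic_integers p"
    unfolding padic_integers_iff using padic_cauchy_mult[OF x(1) y(1)] padic_class_simps(2)[OF x(1) y(1)] x(2) y(2) by auto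
  have "padic_abs p (x n + y n) \<le> 1" for n using padic_abs_add_le[of "x n" "y n"] x(3)[of n] y(3)[of n] by simp
  then show "\<xi> \<oplus>\<^bsub>padic_field p\<^esub> \<eta> \<in> padic_integers p"
    unfolding padic_integers_iff using padic_cauchy_add[OF x(1) y(1)] padic_class_simps(3)[OF x(1) y(1)] x(2) y(2) by auto
qed

lemma padic_integers_01: "\<one>\<^bsub>padic_field p\<^esub> \<in> padic_integers p" "\<zero>\<^bsub>padic_field p\<^esub> \<in> padic_integers p"
  unfolding padic_integers_iff padic_class_one padic_class_zero using padic_cauchy_const by (auto intro!: bexI)

end

lemma UNIV_three: "(UNIV :: 3 set) = {1, 2, 3}" "(1::3) \<noteq> 2" "(1::3) \<noteq> 3" "(2::3) \<noteq> 3"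
  using exhaust_3 by auto

lemma (in abelian_monoid) finsum_three:
  fixes f :: "3 \<Rightarrow> 'a"
  assumes "\<And>i. f i \<in> carrier G"
  shows "(\<Oplus>i\<in>UNIV. f i) = f 1 \<oplus> (f 2 \<oplus> f 3)"
  unfolding UNIV_three(1) using assms UNIV_three(2-4) by (subst finsum_insert, auto)+

section \<open>The adele ring through its components\<close>

lemma finite_adeles_sel:
  "f \<in> carrier finite_adeles \<longleftrightarrow> f \<in> (\<Pi>\<^sub>E p\<in>{p. prime p}. carrier (padic_field p)) \<and> finite {p. prime p \<and> f p \<notin> padic_integers p}"
  "f \<otimes>\<^bsub>finite_adeles\<^esub> g = (\<lambda>p\<in>{p. prime p}. f p \<otimes>\<^bsub>padic_field p\<^esub> g p)"
  "f \<oplus>\<^bsub>finite_adeles\<^esub> g = (\<lambda>p\<in>{p. prime p}. f p \<oplus>\<^bsub>padic_field p\<^esub> g p)"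
  "\<one>\<^bsub>finite_adeles\<^esub> = (\<lambda>p\<in>{p. prime p}. \<one>\<^bsub>padic_field p\<^esub>)"
  "\<zero>\<^bsub>finite_adeles\<^esub> = (\<lambda>p\<in>{p. prime p}. \<zero>\<^bsub>padic_field p\<^esub>)"
  by (simp_all add: finite_adeles_def)

lemma finite_adeles_comp:
  assumes "f \<in> carrier finite_adeles" "prime p" shows "f p \<in> carrier (padic_field p)"
  using assms by (auto simp: finite_adeles_sel)

lemma finite_adeles_closed:
  assumes "f \<in> carrier finite_adeles" "g \<in> carrier finite_adeles"
  shows "f \<otimes>\<^bsub>finite_adeles\<^esub> g \<in> carrier finite_adeles" "f \<oplus>\<^bsub>finite_adeles\<^esub> g \<in> carrier finite_adeles"
proof -
  note K = padic_field_cring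
  let ?B = "{p. prime p \<and> f p \<notin> padic_integers p} \<union> {p. prime p \<and> g p \<notin> padic_integers p}"
  have fin: "finite ?B" using assms by (simp add: finite_adeles_sel)
  have "f p \<otimes>\<^bsub>padic_field p\<^esub> g p \<in> carrier (padic_field p)" "f p \<oplus>\<^bsub>padic_field p\<^esub> g p \<in> carrier (padic_field p)" if "prime p" for p
    using finite_adeles_comp[OF assms(1) that] finite_adeles_comp[OF assms(2) that] cring.cring_simprules(1,5)[OF K[OF that]] by auto
  moreover have "finite {p. prime p \<and> f p \<otimes>\<^bsub>padic_field p\<^esub> g p \<notin> padic_integers p}"
    "finite {p. prime p \<and> f p \<oplus>\<^bsub>padic_field p\<^esub> g p \<notin> padic_integers p}"
    by (rule finite_subset[OF _ fin], use padic_integers_closed in blast)+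
  ultimately show "f \<otimes>\<^bsub>finite_adeles\<^esub> g \<in> carrier finite_adeles" "f \<oplus>\<^bsub>finite_adeles\<^esub> g \<in> carrier finite_adeles"
    unfolding finite_adeles_sel by (auto cong: conj_cong)
qed

lemma finite_adeles_01: "\<one>\<^bsub>finite_adeles\<^esub> \<in> carrier finite_adeles" "\<zero>\<^bsub>finite_adeles\<^esub> \<in> carrier finite_adeles"
proof -
  have "{p. prime p \<and> \<one>\<^bsub>padic_field p\<^esub> \<notin> padic_integers p} = {}" "{p. prime p \<and> \<zero>\<^bsub>padic_field p\<^esub> \<notin> padic_integers p} = {}"
    using padic_integers_01 by auto
  moreover have "\<one>\<^bsub>padic_field p\<^esub> \<in> carrier (padic_field p)" "\<zero>\<^bsub>padic_field p\<^esub> \<in> carrier (padic_field p)" if "prime p" for p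
    using cring.cring_simprules(2,6)[OF padic_field_cring[OF that]] by auto
  ultimately show "\<one>\<^bsub>finite_adeles\<^esub> \<in> carrier finite_adeles" "\<zero>\<^bsub>finite_adeles\<^esub> \<in> carrier finite_adeles"
    unfolding finite_adeles_sel by (auto cong: conj_cong)
qed

lemma finite_adeles_eqI:
  assumes "f \<in> carrier finite_adeles" "g \<in> carrier finite_adeles" "\<And>p. prime p \<Longrightarrow> f p = g p"
  shows "f = g"
proof
  fix p show "f p = g p"
    using assms unfolding finite_adeles_sel by (cases "prime p") (auto simp: PiE_def extensional_def)
qed

lemma adeles_sel:
  "z \<in> carrier adeles \<longleftrightarrow> snd z \<in> carrier finite_adeles"
  "z \<otimes>\<^bsub>adeles\<^esub> w = (fst z * fst w, snd z \<otimes>\<^bsub>finite_adeles\<^esub> snd w)"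
  "z \<oplus>\<^bsub>adeles\<^esub> w = (fst z + fst w, snd z \<oplus>\<^bsub>finite_adeles\<^esub> snd w)"
  "\<one>\<^bsub>adeles\<^esub> = (1, \<one>\<^bsub>finite_adeles\<^esub>)" "\<zero>\<^bsub>adeles\<^esub> = (0, \<zero>\<^bsub>finite_adeles\<^esub>)"
  by (cases z; cases w; simp add: adeles_def RDirProd_def DirProd_def monoid.defs ring_of_type_algebra_def)+

lemma adeles_comp:
  assumes "z \<in> carrier adeles" "w \<in> carrier adeles" "prime p"
  shows "snd z p \<in> carrier (padic_field p)"
    "snd (z \<otimes>\<^bsub>adeles\<^esub> w) p = snd z p \<otimes>\<^bsub>padic_field p\<^esub> snd w p"
    "snd (z \<oplus>\<^bsub>adeles\<^esub> w) p = snd z p \<oplus>\<^bsub>padic_field p\<^esub> snd w p"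
    "snd \<one>\<^bsub>adeles\<^esub> p = \<one>\<^bsub>padic_field p\<^esub>" "snd \<zero>\<^bsub>adeles\<^esub> p = \<zero>\<^bsub>padic_field p\<^esub>"
    "snd (z [^]\<^bsub>adeles\<^esub> (k::nat)) p = snd z p [^]\<^bsub>padic_field p\<^esub> k"
proof -
  show one: "snd \<one>\<^bsub>adeles\<^esub> p = \<one>\<^bsub>padic_field p\<^esub>" using assms by (simp add: adeles_sel finite_adeles_sel)
  show "snd (z [^]\<^bsub>adeles\<^esub> (k::nat)) p = snd z p [^]\<^bsub>padic_field p\<^esub> k"
    using one assms(3) by (induction k) (auto simp: adeles_sel(2) finite_adeles_sel(2))
qed (use assms finite_adeles_comp in \<open>auto simp: adeles_sel finite_adeles_sel(2-5)\<close>)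

lemma adeles_01: "\<one>\<^bsub>adeles\<^esub> \<in> carrier adeles" "\<zero>\<^bsub>adeles\<^esub> \<in> carrier adeles"
  using finite_adeles_01 by (auto simp: adeles_sel)

lemma adeles_closed:
  assumes "z \<in> carrier adeles" "w \<in> carrier adeles"
  shows "z \<otimes>\<^bsub>adeles\<^esub> w \<in> carrier adeles" "z \<oplus>\<^bsub>adeles\<^esub> w \<in> carrier adeles" "z [^]\<^bsub>adeles\<^esub> (k::nat) \<in> carrier adeles"
proof -
  have m: "a \<otimes>\<^bsub>adeles\<^esub> b \<in> carrier adeles" if "a \<in> carrier adeles" "b \<in> carrier adeles" for a b
    using that finite_adeles_closed by (auto simp: adeles_sel)
  show "z [^]\<^bsub>adeles\<^esub> (k::nat) \<in> carrier adeles" using adeles_01(1) m assms by (induction k) auto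
qed (use assms finite_adeles_closed in \<open>auto simp: adeles_sel\<close>)

lemma adeles_eqI:
  assumes "z \<in> carrier adeles" "w \<in> carrier adeles" "fst z = fst w" "\<And>p. prime p \<Longrightarrow> snd z p = snd w p"
  shows "z = w"
  using assms finite_adeles_eqI[of "snd z" "snd w"] by (auto simp: adeles_sel prod_eq_iff)

text \<open>The sums over three coordinates in \<open>unimodular\<close> and \<open>X_points\<close>
  are \<open>finsum\<close>s over the adeles; they unfold in an abelian monoid and can then be
  evaluated at one prime, inside the commutative ring \<open>padic_field p\<close>.\<close>

lemma abelian_monoid_adeles: "abelian_monoid adeles"
proof (rule abelian_monoidI)
  fix x y z assume c: "x \<in> carrier adeles" "y \<in> carrier adeles" "z \<in> carrier adeles"
  note K = cring.cring_simprules[OF padic_field_cring]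
  note cl = adeles_closed(2)
  show "x \<oplus>\<^bsub>adeles\<^esub> y \<oplus>\<^bsub>adeles\<^esub> z = x \<oplus>\<^bsub>adeles\<^esub> (y \<oplus>\<^bsub>adeles\<^esub> z)"
  proof (rule adeles_eqI)
    show "snd (x \<oplus>\<^bsub>adeles\<^esub> y \<oplus>\<^bsub>adeles\<^esub> z) p = snd (x \<oplus>\<^bsub>adeles\<^esub> (y \<oplus>\<^bsub>adeles\<^esub> z)) p" if q: "prime p" for p
      using adeles_comp(1)[OF c(1) c(1) q] adeles_comp(1)[OF c(2) c(2) q] adeles_comp(1)[OF c(3) c(3) q] K(7)[OF q]
      by (simp only: adeles_comp(3)[OF cl[OF c(1,2)] c(3) q] adeles_comp(3)[OF c(1) cl[OF c(2,3)] q]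
        adeles_comp(3)[OF c(1,2) q] adeles_comp(3)[OF c(2,3) q])
    show "fst (x \<oplus>\<^bsub>adeles\<^esub> y \<oplus>\<^bsub>adeles\<^esub> z) = fst (x \<oplus>\<^bsub>adeles\<^esub> (y \<oplus>\<^bsub>adeles\<^esub> z))" by (simp add: adeles_sel(3))
  qed (intro cl c)+
next
  fix x y assume c: "x \<in> carrier adeles" "y \<in> carrier adeles"
  show "x \<oplus>\<^bsub>adeles\<^esub> y \<in> carrier adeles" using adeles_closed[OF c] by simp
  show "x \<oplus>\<^bsub>adeles\<^esub> y = y \<oplus>\<^bsub>adeles\<^esub> x"
  proof (rule adeles_eqI)
    show "snd (x \<oplus>\<^bsub>adeles\<^esub> y) p = snd (y \<oplus>\<^bsub>adeles\<^esub> x) p" if "prime p" for p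
      using adeles_comp[OF c that] adeles_comp[OF c(2,1) that] cring.cring_simprules(10)[OF padic_field_cring[OF that]] by simp
    show "fst (x \<oplus>\<^bsub>adeles\<^esub> y) = fst (y \<oplus>\<^bsub>adeles\<^esub> x)" by (simp add: adeles_sel(3))
  qed (intro adeles_closed(2) c)+
next
  fix x assume c: "x \<in> carrier adeles"
  note z = adeles_01(2)
  show "\<zero>\<^bsub>adeles\<^esub> \<oplus>\<^bsub>adeles\<^esub> x = x"
  proof (rule adeles_eqI)
    show "snd (\<zero>\<^bsub>adeles\<^esub> \<oplus>\<^bsub>adeles\<^esub> x) p = snd x p" if "prime p" for p
      using adeles_comp[OF z c that] adeles_comp[OF c c that] cring.cring_simprules(8)[OF padic_field_cring[OF that]] by simp
    show "fst (\<zero>\<^bsub>adeles\<^esub> \<oplus>\<^bsub>adeles\<^esub> x) = fst x" by (simp add: adeles_sel(3,5))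
  qed (intro adeles_closed(2) c z)+
next
  show "\<zero>\<^bsub>adeles\<^esub> \<in> carrier adeles" by (rule adeles_01)
qed

text \<open>The component at \<open>p\<close> of an adelic point, written in Cauchy sequences. The
  coefficients are \<open>b\<close> only up to a rational scalar \<open>r\<close> and an adelic
  unit, because both the class of \<open>b\<close> and its image are taken up to scaling.
  Unimodularity becomes a combination of the coordinates tending to 1, which replaces the statement
  that they are not all zero by a uniform one.\<close>

lemma X_point_sequences:
  fixes b :: "rat ^ 3"
  assumes X: "proj_map adeles adele_of_rat (proj_class rats b) \<in> fst ` X_points d adeles" and p: "prime p"
  shows "\<exists>r \<xi> \<gamma>. r \<noteq> (0::rat) \<and> (\<forall>i. \<xi> i \<in> carrier (padic_cauchy p)) \<and> (\<forall>i. \<gamma> i \<in> carrier (padic_cauchy p)) \<and>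
     (\<lambda>n. \<Sum>i\<in>UNIV. r * b $ i * \<xi> i n ^ d) \<in> padic_null p \<and> (\<lambda>n. (\<Sum>i\<in>UNIV. \<gamma> i n * \<xi> i n) - 1) \<in> padic_null p"
proof -
  interpret A: abelian_monoid adeles by (rule abelian_monoid_adeles)
  interpret K: cring "padic_field p" by (rule padic_field_cring[OF p])
  obtain \<alpha> x where ax: "\<alpha> \<in> unimodular adeles" "x \<in> unimodular adeles"
    "(\<Oplus>\<^bsub>adeles\<^esub>i\<in>UNIV. \<alpha> $ i \<otimes>\<^bsub>adeles\<^esub> (x $ i [^]\<^bsub>adeles\<^esub> d)) = \<zero>\<^bsub>adeles\<^esub>"
    "proj_map adeles adele_of_rat (proj_class rats b) = proj_class adeles \<alpha>"
    using X by (auto simp: X_points_def)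
  have c\<alpha>: "\<And>i. \<alpha> $ i \<in> carrier adeles" and cx: "\<And>i. x $ i \<in> carrier adeles" using ax by (auto simp: unimodular_def)
  obtain c :: "(real \<times> (nat \<Rightarrow> (nat \<Rightarrow> rat) set)) ^ 3"
    where c: "\<And>i. c $ i \<in> carrier adeles" "(\<Oplus>\<^bsub>adeles\<^esub>i\<in>UNIV. c $ i \<otimes>\<^bsub>adeles\<^esub> x $ i) = \<one>\<^bsub>adeles\<^esub>"
    using ax(2) by (auto simp: unimodular_def)
  note one = adeles_01(1)
  \<comment> \<open>This puts 1 among the units, so \<open>1 * \<alpha>\<close> lies in the class of
    \<open>\<alpha>\<close> and gives an element through which the equality of classes can be
    opened.\<close>
  have "\<one>\<^bsub>adeles\<^esub> \<otimes>\<^bsub>adeles\<^esub> \<one>\<^bsub>adeles\<^esub> = \<one>\<^bsub>adeles\<^esub>"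
  proof (rule adeles_eqI)
    show "snd (\<one>\<^bsub>adeles\<^esub> \<otimes>\<^bsub>adeles\<^esub> \<one>\<^bsub>adeles\<^esub>) q = snd \<one>\<^bsub>adeles\<^esub> q" if "prime q" for q
      using adeles_comp[OF one one that] cring.cring_simprules(6,12)[OF padic_field_cring[OF that]] by simp
    show "fst (\<one>\<^bsub>adeles\<^esub> \<otimes>\<^bsub>adeles\<^esub> \<one>\<^bsub>adeles\<^esub>) = fst \<one>\<^bsub>adeles\<^esub>" by (simp add: adeles_sel(2,4))
  qed (intro adeles_closed(1) one)+
  then have "\<one>\<^bsub>adeles\<^esub> \<in> Units adeles" using one unfolding Units_def by blast
  then have "(\<chi> i. \<one>\<^bsub>adeles\<^esub> \<otimes>\<^bsub>adeles\<^esub> \<alpha> $ i) \<in> proj_class adeles \<alpha>"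
    unfolding proj_class_def by blast
  then have "(\<chi> i. \<one>\<^bsub>adeles\<^esub> \<otimes>\<^bsub>adeles\<^esub> \<alpha> $ i) \<in> proj_map adeles adele_of_rat (proj_class rats b)"
    by (simp only: ax(4))
  then obtain a where a: "a \<in> proj_class rats b" "(\<chi> i. \<one>\<^bsub>adeles\<^esub> \<otimes>\<^bsub>adeles\<^esub> \<alpha> $ i) \<in> proj_class adeles (\<chi> i. adele_of_rat (a $ i))"
    unfolding proj_map_def by blast
  from a(2) obtain u where u: "u \<in> Units adeles"
    "(\<chi> i. \<one>\<^bsub>adeles\<^esub> \<otimes>\<^bsub>adeles\<^esub> \<alpha> $ i) = (\<chi> i. u \<otimes>\<^bsub>adeles\<^esub> (\<chi> i. adele_of_rat (a $ i)) $ i)" unfolding proj_class_def by blast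
  from a(1) obtain r where r: "r \<in> Units rats" "a = (\<chi> i. r \<otimes>\<^bsub>rats\<^esub> b $ i)" unfolding proj_class_def by blast
  have r0: "r \<noteq> 0" using r(1) by (auto simp: Units_def ring_of_type_algebra_def)
  have ai: "a $ i = r * b $ i" for i unfolding r(2) by (simp add: ring_of_type_algebra_def)
  have \<alpha>u: "\<one>\<^bsub>adeles\<^esub> \<otimes>\<^bsub>adeles\<^esub> \<alpha> $ i = u \<otimes>\<^bsub>adeles\<^esub> adele_of_rat (r * b $ i)" for i
    using arg_cong[OF u(2), of "\<lambda>v. v $ i"] by (simp add: ai)
  obtain v where v: "v \<in> carrier adeles" "v \<otimes>\<^bsub>adeles\<^esub> u = \<one>\<^bsub>adeles\<^esub>" "u \<in> carrier adeles" using u(1) unfolding Units_def by blast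
  define k where "k i = padic_class p (\<lambda>_. r * b $ i)" for i
  have kc: "k i \<in> carrier (padic_field p)" for i
    unfolding k_def using padic_class_simps(1)[OF p padic_cauchy_const[OF p] padic_cauchy_const[OF p]] .
  have kr: "snd (adele_of_rat (r * b $ i)) p = k i" for i
    using p by (simp add: adele_of_rat_def padic_of_rat_def k_def padic_class_def[OF p])
  let ?U = "snd u p" and ?V = "snd v p" and ?x = "\<lambda>i. snd (x $ i) p"
  have UV: "?U \<in> carrier (padic_field p)" "?V \<in> carrier (padic_field p)" "?V \<otimes>\<^bsub>padic_field p\<^esub> ?U = \<one>\<^bsub>padic_field p\<^esub>"
    using adeles_comp[OF v(1) v(3) p] adeles_comp(1)[OF v(3) v(3) p] v(2) by auto
  have xc: "?x i \<in> carrier (padic_field p)" for i using adeles_comp(1)[OF cx cx p] .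
  have \<alpha>p: "snd (\<alpha> $ i) p = ?U \<otimes>\<^bsub>padic_field p\<^esub> k i" for i
  proof -
    have "snd (\<one>\<^bsub>adeles\<^esub> \<otimes>\<^bsub>adeles\<^esub> \<alpha> $ i) p = snd (\<alpha> $ i) p"
      using adeles_comp[OF one c\<alpha>[of i] p] adeles_comp(1)[OF c\<alpha>[of i] c\<alpha>[of i] p] by simp
    moreover have "snd (u \<otimes>\<^bsub>adeles\<^esub> adele_of_rat (r * b $ i)) p = ?U \<otimes>\<^bsub>padic_field p\<^esub> k i"
      using p kr by (simp add: adeles_sel(2) finite_adeles_sel(2))
    ultimately show ?thesis using \<alpha>u[of i] by simp
  qed
  define y where "y i = ?x i [^]\<^bsub>padic_field p\<^esub> d" for i
  have yc: "y i \<in> carrier (padic_field p)" for i using xc by (simp add: y_def)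
  define S where "S = k 1 \<otimes>\<^bsub>padic_field p\<^esub> y 1 \<oplus>\<^bsub>padic_field p\<^esub> (k 2 \<otimes>\<^bsub>padic_field p\<^esub> y 2 \<oplus>\<^bsub>padic_field p\<^esub> k 3 \<otimes>\<^bsub>padic_field p\<^esub> y 3)"
  have Sc: "S \<in> carrier (padic_field p)" using kc yc by (simp add: S_def)
  have tc: "\<alpha> $ i \<otimes>\<^bsub>adeles\<^esub> (x $ i [^]\<^bsub>adeles\<^esub> d) \<in> carrier adeles" for i
    using adeles_closed(1)[OF c\<alpha> adeles_closed(3)[OF cx cx]] .
  have tp: "snd (\<alpha> $ i \<otimes>\<^bsub>adeles\<^esub> (x $ i [^]\<^bsub>adeles\<^esub> d)) p = ?U \<otimes>\<^bsub>padic_field p\<^esub> (k i \<otimes>\<^bsub>padic_field p\<^esub> y i)" for i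
    using adeles_comp(2)[OF c\<alpha>[of i] adeles_closed(3)[OF cx cx] p] adeles_comp(6)[OF cx cx p] \<alpha>p UV kc yc
    by (simp add: y_def K.m_assoc)
  have "snd (\<Oplus>\<^bsub>adeles\<^esub>i\<in>UNIV. \<alpha> $ i \<otimes>\<^bsub>adeles\<^esub> (x $ i [^]\<^bsub>adeles\<^esub> d)) p = ?U \<otimes>\<^bsub>padic_field p\<^esub> S"
    using A.finsum_three[of "\<lambda>i. \<alpha> $ i \<otimes>\<^bsub>adeles\<^esub> (x $ i [^]\<^bsub>adeles\<^esub> d)", OF tc] UV kc yc
    by (simp add: adeles_comp(3)[OF tc adeles_closed(2)[OF tc tc] p] adeles_comp(3)[OF tc tc p] tp S_def K.r_distr)
  then have "?U \<otimes>\<^bsub>padic_field p\<^esub> S = \<zero>\<^bsub>padic_field p\<^esub>" using ax(3) adeles_comp(5)[OF one one p] by simp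
  \<comment> \<open>The adelic unit scales the whole equation and is cancelled by its inverse at
    \<open>p\<close>; the rational scalar \<open>r\<close> is kept.\<close>
  then have "?V \<otimes>\<^bsub>padic_field p\<^esub> (?U \<otimes>\<^bsub>padic_field p\<^esub> S) = \<zero>\<^bsub>padic_field p\<^esub>" using UV by simp
  then have S0: "S = \<zero>\<^bsub>padic_field p\<^esub>" using UV Sc by (simp flip: K.m_assoc)
  have uc: "c $ i \<otimes>\<^bsub>adeles\<^esub> x $ i \<in> carrier adeles" for i using adeles_closed(1)[OF c(1) cx] .
  let ?c = "\<lambda>i. snd (c $ i) p"
  have cc: "?c i \<in> carrier (padic_field p)" for i using adeles_comp(1)[OF c(1) c(1) p] .
  have S1: "?c 1 \<otimes>\<^bsub>padic_field p\<^esub> ?x 1 \<oplus>\<^bsub>padic_field p\<^esub> (?c 2 \<otimes>\<^bsub>padic_field p\<^esub> ?x 2 \<oplus>\<^bsub>padic_field p\<^esub> ?c 3 \<otimes>\<^bsub>padic_field p\<^esub> ?x 3) = \<one>\<^bsub>padic_field p\<^esub>"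
    using A.finsum_three[of "\<lambda>i. c $ i \<otimes>\<^bsub>adeles\<^esub> x $ i", OF uc] c(2)
      adeles_comp(3)[OF uc[of 1] adeles_closed(2)[OF uc uc] p] adeles_comp(3)[OF uc uc p] adeles_comp(2)[OF c(1) cx p] adeles_comp(4)[OF one one p]
    by metis
  have "\<forall>i. \<exists>\<xi>. \<xi> \<in> carrier (padic_cauchy p) \<and> ?x i = padic_class p \<xi>" using padic_field_rep[OF p xc] by metis
  then obtain \<xi> where \<xi>: "\<And>i. \<xi> i \<in> carrier (padic_cauchy p)" "\<And>i. ?x i = padic_class p (\<xi> i)" by metis
  have "\<forall>i. \<exists>\<xi>. \<xi> \<in> carrier (padic_cauchy p) \<and> ?c i = padic_class p \<xi>" using padic_field_rep[OF p cc] by metis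
  then obtain \<gamma> where \<gamma>: "\<And>i. \<gamma> i \<in> carrier (padic_cauchy p)" "\<And>i. ?c i = padic_class p (\<gamma> i)" by metis
  note const = padic_cauchy_const[OF p] and add = padic_cauchy_add[OF p] and mult = padic_cauchy_mult[OF p]
  have pw: "(\<lambda>n. \<xi> i n ^ d) \<in> carrier (padic_cauchy p)" for i using padic_class_power(2)[OF p \<xi>(1)] .
  have ky: "k i \<otimes>\<^bsub>padic_field p\<^esub> y i = padic_class p (\<lambda>n. r * b $ i * \<xi> i n ^ d)" for i
    unfolding k_def y_def \<xi>(2) padic_class_power(1)[OF p \<xi>(1)] by (rule padic_class_simps(2)[OF p const pw])
  have m1: "(\<lambda>n. r * b $ i * \<xi> i n ^ d) \<in> carrier (padic_cauchy p)" for i using mult[OF const pw] .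
  have "S = padic_class p (\<lambda>n. r * b $ 1 * \<xi> 1 n ^ d + (r * b $ 2 * \<xi> 2 n ^ d + r * b $ 3 * \<xi> 3 n ^ d))"
    unfolding S_def ky padic_class_simps(3)[OF p m1 m1] padic_class_simps(3)[OF p m1 add[OF m1 m1]] ..
  then have "padic_class p (\<lambda>n. r * b $ 1 * \<xi> 1 n ^ d + (r * b $ 2 * \<xi> 2 n ^ d + r * b $ 3 * \<xi> 3 n ^ d)) = padic_class p (\<lambda>_. 0)"
    using S0 unfolding padic_class_zero[OF p] by simp
  then have "(\<lambda>n. r * b $ 1 * \<xi> 1 n ^ d + (r * b $ 2 * \<xi> 2 n ^ d + r * b $ 3 * \<xi> 3 n ^ d) - 0) \<in> padic_null p"
    unfolding padic_class_eq[OF p add[OF m1[of 1] add[OF m1[of 2] m1[of 3]]] const] .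
  then have n1: "(\<lambda>n. \<Sum>i\<in>UNIV. r * b $ i * \<xi> i n ^ d) \<in> padic_null p" by (simp add: sum_3 add.assoc)
  have cx': "?c i \<otimes>\<^bsub>padic_field p\<^esub> ?x i = padic_class p (\<lambda>n. \<gamma> i n * \<xi> i n)" for i
    unfolding \<gamma>(2) \<xi>(2) by (rule padic_class_simps(2)[OF p \<gamma>(1) \<xi>(1)])
  have m2: "(\<lambda>n. \<gamma> i n * \<xi> i n) \<in> carrier (padic_cauchy p)" for i using mult[OF \<gamma>(1) \<xi>(1)] .
  have "padic_class p (\<lambda>n. \<gamma> 1 n * \<xi> 1 n + (\<gamma> 2 n * \<xi> 2 n + \<gamma> 3 n * \<xi> 3 n)) = padic_class p (\<lambda>_. 1)"
    using S1 unfolding cx' padic_class_simps(3)[OF p m2 m2] padic_class_simps(3)[OF p m2 add[OF m2 m2]] padic_class_one[OF p] .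
  then have "(\<lambda>n. \<gamma> 1 n * \<xi> 1 n + (\<gamma> 2 n * \<xi> 2 n + \<gamma> 3 n * \<xi> 3 n) - 1) \<in> padic_null p"
    unfolding padic_class_eq[OF p add[OF m2[of 1] add[OF m2[of 2] m2[of 3]]] const] .
  then have n2: "(\<lambda>n. (\<Sum>i\<in>UNIV. \<gamma> i n * \<xi> i n) - 1) \<in> padic_null p" by (simp add: sum_3 add.assoc)
  show ?thesis using r0 \<xi>(1) \<gamma>(1) n1 n2 by blast
qed

lemma finite_type_max: fixes h :: "'a::finite \<Rightarrow> real" shows "\<exists>j. \<forall>i. h i \<le> h j"
proof -
  have "Max (range h) \<in> range h" by (intro Max_in) auto
  then obtain j where "Max (range h) = h j" by (rule rangeE)
  then show ?thesis by (metis Max_ge finite finite_imageI rangeI)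
qed

text \<open>The solution is read off a late term of the Cauchy sequences, divided by its largest coordinate.\<close>

theorem X_point_local_solution:
  fixes a :: "3 \<Rightarrow> int"
  assumes X: "proj_map adeles adele_of_rat (proj_class rats (\<chi> i. of_int (a i))) \<in> fst ` X_points d adeles" and p: "prime p"
  shows "\<exists>y :: 3 \<Rightarrow> int. (\<exists>i. \<not> int p dvd y i) \<and> int p ^ 2 dvd (\<Sum>i\<in>UNIV. a i * y i ^ d)"
proof -
  obtain r \<xi> \<gamma> where r: "r \<noteq> (0::rat)" and \<xi>: "\<And>i. \<xi> i \<in> carrier (padic_cauchy p)" and \<gamma>: "\<And>i. \<gamma> i \<in> carrier (padic_cauchy p)"
    and f: "(\<lambda>n. \<Sum>i\<in>UNIV. r * of_int (a i) * \<xi> i n ^ d) \<in> padic_null p" and g: "(\<lambda>n. (\<Sum>i\<in>UNIV. \<gamma> i n * \<xi> i n) - 1) \<in> padic_null p"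
    using X_point_sequences[OF X p] by auto
  have pp: "real p > 0" using prime_gt_0_nat[OF p] by simp
  note abs_mult = padic_abs_mult[OF p] and abs_power = padic_abs_power[OF p]
  have "\<forall>i. \<exists>B>0. \<forall>n. padic_abs p (\<gamma> i n) \<le> B" using padic_cauchy_bounded[OF p \<gamma>] by metis
  then obtain Bf where Bf: "\<And>i. Bf i > 0" "\<And>i n. padic_abs p (\<gamma> i n) \<le> Bf i" by metis
  obtain j0 where j0: "\<And>i. Bf i \<le> Bf j0" using finite_type_max[of Bf] by blast
  define B where "B = Bf j0"
  have B: "B > 0" "\<And>i n. padic_abs p (\<gamma> i n) \<le> B" unfolding B_def using Bf j0 order_trans by blast+
  \<comment> \<open>The largest coordinate will have absolute value at least \<open>1 / B\<close>.
    Dividing the form by \<open>r\<close> and its \<open>d\<close>-th power therefore multiplies the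
    size by at most \<open>B^d / \<bar>r\<bar>\<close>, with the p-adic absolute value of
    \<open>r\<close>, and \<open>e\<close> is chosen so that less than \<open>1 / p^2\<close>
    remains.\<close>
  define e where "e = padic_abs p r / (real p ^ 2 * B ^ d)"
  have cpos: "real p ^ 2 * B ^ d > 0" using pp B by simp
  have e: "e > 0" unfolding e_def using padic_abs_pos[OF p r] pp B by simp
  obtain N where N: "\<And>n. n \<ge> N \<Longrightarrow> padic_abs p (\<Sum>i\<in>UNIV. r * of_int (a i) * \<xi> i n ^ d) < e"
    using f e unfolding padic_null_iff[OF p] by metis
  obtain M where M: "\<And>n. n \<ge> M \<Longrightarrow> padic_abs p ((\<Sum>i\<in>UNIV. \<gamma> i n * \<xi> i n) - 1) < 1"
    using g unfolding padic_null_iff[OF p] by (metis zero_less_one)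
  define n where "n = max N M"
  obtain j where j: "\<And>i. padic_abs p (\<xi> i n) \<le> padic_abs p (\<xi> j n)" using finite_type_max[of "\<lambda>i. padic_abs p (\<xi> i n)"] by blast
  let ?s = "\<Sum>i\<in>UNIV. \<gamma> i n * \<xi> i n"
  \<comment> \<open>By the ultrametric inequality a sum at distance less than 1 from 1 has absolute
    value at least 1. This bounds the largest coordinate away from zero.\<close>
  have "1 \<le> max (padic_abs p ?s) (padic_abs p (?s - 1))" using padic_abs_diff_le[OF p, of ?s "?s - 1"] padic_abs_1[OF p] by simp
  moreover have "padic_abs p (?s - 1) < 1" by (rule M) (simp add: n_def)
  ultimately have "1 \<le> padic_abs p ?s" by (simp add: max_def split: if_splits)
  also have "padic_abs p ?s \<le> B * padic_abs p (\<xi> j n)"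
  proof -
    have t: "padic_abs p (\<gamma> i n * \<xi> i n) \<le> B * padic_abs p (\<xi> j n)" for i
      unfolding abs_mult using B j padic_abs_nonneg[OF p] by (intro mult_mono) auto
    have s3: "?s = \<gamma> 1 n * \<xi> 1 n + (\<gamma> 2 n * \<xi> 2 n + \<gamma> 3 n * \<xi> 3 n)" by (simp add: sum_3 add.assoc)
    show ?thesis unfolding s3
      using padic_abs_add_le[OF p, of "\<gamma> 1 n * \<xi> 1 n" "\<gamma> 2 n * \<xi> 2 n + \<gamma> 3 n * \<xi> 3 n"]
        padic_abs_add_le[OF p, of "\<gamma> 2 n * \<xi> 2 n" "\<gamma> 3 n * \<xi> 3 n"] t[of 1] t[of 2] t[of 3] by linarith
  qed
  finally have xj: "1 \<le> B * padic_abs p (\<xi> j n)" .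
  then have xj0: "\<xi> j n \<noteq> 0" using padic_abs_0[OF p] by auto
  define z where "z i = \<xi> i n / \<xi> j n" for i
  have zj: "z j = 1" using xj0 by (simp add: z_def)
  have zx: "\<xi> i n = z i * \<xi> j n" for i using xj0 by (simp add: z_def)
  have "padic_abs p (z i) \<le> 1" for i
    using j[of i] padic_abs_pos[OF p xj0] unfolding zx[of i] abs_mult by simp
  then have "\<forall>i. \<exists>A D. z i = of_int A / of_int D \<and> D > 0 \<and> \<not> int p dvd D" using padic_abs_le_1_denominator[OF p] by metis
  then obtain A D where AD: "\<And>i. z i = of_int (A i) / of_int (D i)" "\<And>i. D i > 0" "\<And>i. \<not> int p dvd D i" by metis
  \<comment> \<open>All denominators are prime to \<open>p\<close>, so clearing them leaves the
    local sizes unchanged. Since \<open>z j = 1\<close>, the coordinate \<open>y j\<close> equals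
    \<open>E\<close> and witnesses primitivity.\<close>
  define E where "E = (\<Prod>i\<in>UNIV. D i)"
  have pE: "\<not> int p dvd E" unfolding E_def using AD(3) p by (subst prime_dvd_prod_iff) auto
  define y where "y i = A i * (\<Prod>k\<in>UNIV - {i}. D k)" for i
  have y: "of_int (y i) = of_int E * z i" for i
  proof -
    have "E = D i * (\<Prod>k\<in>UNIV - {i}. D k)" unfolding E_def by (rule prod.remove) auto
    then show ?thesis unfolding y_def AD(1) using AD(2)[of i] by simp
  qed
  have "of_int (y j) = (of_int E :: rat)" using y[of j] zj by simp
  then have "y j = E" by simp
  then have nd: "\<not> int p dvd y j" using pE by simp
  let ?t = "\<Sum>i\<in>UNIV. of_int (a i) * z i ^ d"
  have "(\<Sum>i\<in>UNIV. r * of_int (a i) * \<xi> i n ^ d) = r * \<xi> j n ^ d * ?t"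
    unfolding sum_distrib_left
  proof (intro sum.cong refl)
    fix i show "r * of_int (a i) * \<xi> i n ^ d = r * \<xi> j n ^ d * (of_int (a i) * z i ^ d)"
      unfolding zx[of i] power_mult_distrib by (simp only: mult_ac)
  qed
  then have "padic_abs p r * padic_abs p (\<xi> j n) ^ d * padic_abs p ?t < e"
    using N[of n] by (simp add: n_def abs_mult abs_power)
  then have "padic_abs p r * padic_abs p (\<xi> j n) ^ d * padic_abs p ?t * (real p ^ 2 * B ^ d) < padic_abs p r"
    unfolding e_def pos_less_divide_eq[OF cpos] .
  then have "padic_abs p r * (padic_abs p ?t * real p ^ 2 * (B * padic_abs p (\<xi> j n)) ^ d) < padic_abs p r * 1"
    by (simp add: power_mult_distrib mult_ac)
  then have "padic_abs p ?t * real p ^ 2 * (B * padic_abs p (\<xi> j n)) ^ d < 1"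
    using padic_abs_pos[OF p r] by (subst (asm) mult_less_cancel_left_pos)
  moreover have "padic_abs p ?t * real p ^ 2 * 1 \<le> padic_abs p ?t * real p ^ 2 * (B * padic_abs p (\<xi> j n)) ^ d"
    using xj padic_abs_nonneg[OF p] by (intro mult_left_mono one_le_power) auto
  ultimately have "padic_abs p ?t * real p ^ 2 < 1" by simp
  then have t: "padic_abs p ?t \<le> 1 / real p ^ 2" using pp by (simp add: pos_le_divide_eq)
  have "of_int (\<Sum>i\<in>UNIV. a i * y i ^ d) = of_int E ^ d * ?t"
    unfolding sum_distrib_left of_int_sum by (intro sum.cong refl) (simp add: y power_mult_distrib)
  then have "padic_abs p (of_int (\<Sum>i\<in>UNIV. a i * y i ^ d)) = padic_abs p (of_int E) ^ d * padic_abs p ?t"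
    by (simp only: abs_mult abs_power)
  also have "\<dots> \<le> 1 * padic_abs p ?t"
    using padic_abs_int_le_1[OF p] padic_abs_nonneg[OF p] by (intro mult_right_mono power_le_one) auto
  also have "\<dots> \<le> 1 / real p ^ 2" using t by simp
  finally have "int p ^ 2 dvd (\<Sum>i\<in>UNIV. a i * y i ^ d)" using padic_abs_int_le_iff[OF p] by blast
  then show ?thesis using nd by blast
qed

section \<open>Heights\<close>

lemma rational_point_nonzero:
  fixes b :: "rat ^ 3"
  assumes "b \<in> unimodular rats" shows "\<exists>i. b $ i \<noteq> 0"
proof (rule ccontr)
  interpret cring rats by (rule cring_from_type_algebra)
  assume "\<nexists>i. b $ i \<noteq> 0"
  then have b: "b $ i = 0" for i by blast
  obtain c :: "rat ^ 3" where c: "(\<Oplus>\<^bsub>rats\<^esub>i\<in>UNIV. c $ i \<otimes>\<^bsub>rats\<^esub> b $ i) = \<one>\<^bsub>rats\<^esub>" using assms by (auto simp: unimodular_def)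
  have "(\<Oplus>\<^bsub>rats\<^esub>i\<in>UNIV. c $ i \<otimes>\<^bsub>rats\<^esub> b $ i) = c $ 1 \<otimes>\<^bsub>rats\<^esub> b $ 1 \<oplus>\<^bsub>rats\<^esub> (c $ 2 \<otimes>\<^bsub>rats\<^esub> b $ 2 \<oplus>\<^bsub>rats\<^esub> c $ 3 \<otimes>\<^bsub>rats\<^esub> b $ 3)"
    by (rule finsum_three) (simp add: ring_of_type_algebra_def)
  with c b show False by (simp add: ring_of_type_algebra_def)
qed

lemma primitive_multiple:
  fixes b :: "rat ^ 3"
  assumes "b $ i0 \<noteq> 0"
  shows "\<exists>\<mu> (a :: 3 \<Rightarrow> int). \<mu> \<noteq> 0 \<and> (\<forall>i. b $ i = \<mu> * of_int (a i)) \<and> (\<forall>p. prime p \<longrightarrow> (\<exists>i. \<not> int p dvd a i))"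
proof -
  have "\<forall>i. \<exists>n m. b $ i = of_int n / of_int m \<and> m > 0" by (metis rat_fraction)
  then obtain n m where nm: "\<And>i. b $ i = of_int (n i) / of_int (m i)" "\<And>i. m i > 0" by metis
  define D where "D = (\<Prod>i\<in>UNIV. m i)"
  define A where "A i = n i * (\<Prod>k\<in>UNIV - {i}. m k)" for i
  have D0: "D > 0" unfolding D_def using nm(2) by (intro prod_pos) auto
  have bA: "b $ i = of_int (A i) / of_int D" for i
  proof -
    define R where "R = (\<Prod>k\<in>UNIV - {i}. m k)"
    have "D = m i * R" unfolding D_def R_def by (rule prod.remove) auto
    moreover have "R > 0" unfolding R_def using nm(2) by (intro prod_pos) auto
    ultimately show ?thesis unfolding nm(1) A_def R_def[symmetric] by simp
  qed
  define g where "g = Gcd (range A)"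
  have A0: "A i0 \<noteq> 0" using assms bA by auto
  then have g0: "g \<noteq> 0" unfolding g_def by auto
  define a where "a i = A i div g" for i
  have Aa: "A i = g * a i" for i unfolding a_def g_def by (simp add: Gcd_dvd)
  have "\<exists>i. \<not> int p dvd a i" if "prime p" for p
  proof (rule ccontr)
    assume "\<not> (\<exists>i. \<not> int p dvd a i)"
    then have "g * int p dvd A i" for i unfolding Aa by (intro mult_dvd_mono) auto
    then have "g * int p dvd g" unfolding g_def by (intro Gcd_greatest) auto
    then have "int p dvd 1" using g0 by simp
    then show False using that by (simp add: prime_nat_iff)
  qed
  moreover have "b $ i = of_int g / of_int D * of_int (a i)" for i unfolding bA Aa by simp
  moreover have "of_int g / of_int D \<noteq> (0 :: rat)" using g0 D0 by simp
  ultimately show ?thesis by blast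
qed

lemma multiplicity_int_int: "prime p \<Longrightarrow> n > 0 \<Longrightarrow> multiplicity (int p) (int n) = multiplicity p n"
proof (rule antisym)
  assume p: "prime p" and n: "n > 0"
  have "int (p ^ multiplicity (int p) (int n)) dvd int n" using multiplicity_dvd[of "int p" "int n"] by simp
  then have "p ^ multiplicity (int p) (int n) dvd n" by (simp only: int_dvd_int_iff)
  then show "multiplicity (int p) (int n) \<le> multiplicity p n"
    using n prime_gt_1_nat[OF p] by (intro multiplicity_geI) auto
  have "int (p ^ multiplicity p n) dvd int n" by (simp only: int_dvd_int_iff multiplicity_dvd)
  then show "multiplicity p n \<le> multiplicity (int p) (int n)"
    using n prime_gt_1_nat[OF p] by (intro multiplicity_geI) auto
qed

text \<open>The product formula; the relevant primes are those dividing the numerator or the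
  denominator, and their powers reassemble by unique factorisation.\<close>

lemma prod_padic_abs:
  assumes "u \<noteq> 0"
  shows "(\<Prod>p | prime p \<and> padic_abs p u \<noteq> 1. padic_abs p u) = 1 / real_of_rat \<bar>u\<bar>"
proof -
  obtain n m where nm: "m > 0" "u = of_int n / of_int m" by (metis rat_fraction)
  have n0: "n \<noteq> 0" using assms nm by auto
  define N where "N = nat \<bar>n\<bar>"
  define M where "M = nat m"
  have NM: "N > 0" "M > 0" "\<bar>n\<bar> = int N" "m = int M" using n0 nm(1) by (auto simp: N_def M_def)
  have pa: "padic_abs p u = real p ^ multiplicity p M / real p ^ multiplicity p N" if p: "prime p" for p
  proof -
    have "multiplicity (int p) n = multiplicity p N"
      using multiplicity_int_int[OF p NM(1)] multiplicity_normalize_right[of "int p" n] unfolding NM(3)[symmetric] by simp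
    moreover have "multiplicity (int p) m = multiplicity p M"
      using multiplicity_int_int[OF p NM(2)] unfolding NM(4)[symmetric] by simp
    ultimately show ?thesis
      using padic_abs_frac[OF p n0, of m] nm prime_gt_0_nat[OF p] by (simp add: power_int_diff)
  qed
  let ?S = "prime_factors N \<union> prime_factors M"
  have prod: "(\<Prod>p\<in>?S. real p ^ multiplicity p k) = real k" if "k > 0" "prime_factors k \<subseteq> ?S" for k
  proof -
    have "(\<Prod>p\<in>?S. p ^ multiplicity p k) = (\<Prod>p\<in>prime_factors k. p ^ multiplicity p k)"
    proof (rule prod.mono_neutral_right)
      show "\<forall>p\<in>?S - prime_factors k. p ^ multiplicity p k = 1"
      proof
        fix p assume p: "p \<in> ?S - prime_factors k"
        then have "prime p" by auto
        then have "multiplicity p k = 0" using p prime_factors_multiplicity[of k] by auto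
        then show "p ^ multiplicity p k = 1" by simp
      qed
    qed (use that in auto)
    also have "\<dots> = k" using prod_prime_factors[of k] that by simp
    finally have "real (\<Prod>p\<in>?S. p ^ multiplicity p k) = real k" by (simp only:)
    then show ?thesis by simp
  qed
  have "(\<Prod>p | prime p \<and> padic_abs p u \<noteq> 1. padic_abs p u) = (\<Prod>p\<in>?S. padic_abs p u)"
  proof (rule prod.mono_neutral_left)
    show "{p. prime p \<and> padic_abs p u \<noteq> 1} \<subseteq> ?S"
    proof
      fix p assume "p \<in> {p. prime p \<and> padic_abs p u \<noteq> 1}"
      then have p: "prime p" "padic_abs p u \<noteq> 1" by auto
      show "p \<in> ?S"
      proof (rule ccontr)
        assume "p \<notin> ?S"
        then have "multiplicity p M = 0" "multiplicity p N = 0"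
          using p(1) prime_factors_multiplicity[of M] prime_factors_multiplicity[of N] by auto
        then show False using pa[OF p(1)] p(2) by simp
      qed
    qed
  qed auto
  also have "\<dots> = (\<Prod>p\<in>?S. real p ^ multiplicity p M / real p ^ multiplicity p N)"
    by (intro prod.cong refl pa) auto
  also have "\<dots> = real M / real N" unfolding prod_dividef using prod NM by simp
  also have "\<dots> = 1 / real_of_rat \<bar>u\<bar>"
  proof -
    have "\<bar>u\<bar> = of_nat N / of_nat M" unfolding nm(2) using NM by (metis abs_divide abs_of_nat of_int_abs of_int_of_nat_eq)
    then show ?thesis by (simp add: of_rat_divide)
  qed
  finally show ?thesis .
qed

text \<open>At each prime some \<open>a i\<close> is a unit, so the local maximum is that of the
  scalar \<open>\<mu>\<close>; by the product formula the scalar cancels against the real place,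
  leaving the maximum of \<open>\<bar>a i\<bar>\<close>. An arbitrary scalar is allowed because
  \<open>height\<close> evaluates an unspecified representative.\<close>

lemma abs_le_height:
  fixes x :: "rat ^ 3"
  assumes "\<mu> \<noteq> 0" and prim: "\<And>p. prime p \<Longrightarrow> \<exists>i. \<not> int p dvd a i" and x: "x = (\<chi> i. \<mu> * of_int (a i))"
  shows "real_of_int \<bar>a i\<bar> \<le> height_triple x"
proof -
  have M: "(MAX i. padic_abs p (x $ i)) = padic_abs p \<mu>" if p: "prime p" for p
  proof (rule Max_eqI)
    show "padic_abs p \<mu> \<in> range (\<lambda>i. padic_abs p (x $ i))"
    proof -
      obtain i where i: "\<not> int p dvd a i" using prim[OF p] by blast
      then have "multiplicity (int p) (a i) = 0" by (simp add: not_dvd_imp_multiplicity_0)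
      moreover have "a i \<noteq> 0" using i by auto
      ultimately have "padic_abs p (of_int (a i)) = 1" using padic_abs_frac[OF p, of "a i" 1] by simp
      then have "padic_abs p (x $ i) = padic_abs p \<mu>" unfolding x by (simp add: padic_abs_mult[OF p])
      then show ?thesis by (metis rangeI)
    qed
    show "y \<le> padic_abs p \<mu>" if "y \<in> range (\<lambda>i. padic_abs p (x $ i))" for y
      using that padic_abs_int_le_1[OF p] padic_abs_nonneg[OF p] unfolding x
      by (auto simp: padic_abs_mult[OF p] intro!: mult_right_le_one_le)
  qed simp
  have "{p. prime p \<and> (MAX i. padic_abs p (x $ i)) \<noteq> 1} = {p. prime p \<and> padic_abs p \<mu> \<noteq> 1}" using M by auto
  then have "(\<Prod>p | prime p \<and> (MAX i. padic_abs p (x $ i)) \<noteq> 1. MAX i. padic_abs p (x $ i)) = (\<Prod>p | prime p \<and> padic_abs p \<mu> \<noteq> 1. padic_abs p \<mu>)"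
    using M by (intro prod.cong) auto
  also have "\<dots> = 1 / real_of_rat \<bar>\<mu>\<bar>" by (rule prod_padic_abs[OF assms(1)])
  finally have h: "height_triple x = (MAX i. real_of_rat \<bar>x $ i\<bar>) * (1 / real_of_rat \<bar>\<mu>\<bar>)" by (simp add: height_triple_def)
  have "real_of_rat \<bar>x $ i\<bar> \<le> (MAX i. real_of_rat \<bar>x $ i\<bar>)" by (intro Max_ge) auto
  moreover have "real_of_rat \<bar>x $ i\<bar> = real_of_rat \<bar>\<mu>\<bar> * real_of_int \<bar>a i\<bar>"
    unfolding x by (simp add: abs_mult of_rat_mult flip: of_int_abs)
  moreover have "real_of_rat \<bar>\<mu>\<bar> > 0" using assms(1) by simp
  ultimately show ?thesis unfolding h by (simp add: pos_le_divide_eq mult.commute)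
qed

lemma proj_point_representative:
  assumes "P \<in> proj_plane rats"
  shows "\<exists>a :: 3 \<Rightarrow> int. P = proj_class rats (\<chi> i. of_int (a i)) \<and> (\<forall>i. real_of_int \<bar>a i\<bar> \<le> height P)"
proof -
  obtain b where b: "b \<in> unimodular rats" "P = proj_class rats b" using assms by (auto simp: proj_plane_def)
  obtain i0 where i0: "b $ i0 \<noteq> 0" using rational_point_nonzero[OF b(1)] by blast
  obtain \<mu> and a :: "3 \<Rightarrow> int" where a: "\<mu> \<noteq> 0" "\<And>i. b $ i = \<mu> * of_int (a i)" "\<And>p. prime p \<Longrightarrow> \<exists>i. \<not> int p dvd a i"
    using primitive_multiple[OF i0] by blast
  have U: "Units rats = {u. u \<noteq> 0}"
  proof -
    have "\<exists>y. y * u = 1 \<and> u * y = 1" if "u \<noteq> 0" for u :: rat using that by (intro exI[of _ "1 / u"]) auto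
    then show ?thesis by (auto simp: Units_def ring_of_type_algebra_def)
  qed
  have cls: "proj_class rats c = {(\<chi> i. u * c $ i) | u. u \<noteq> 0}" for c
    unfolding proj_class_def U by (simp add: ring_of_type_algebra_def)
  have b': "b = (\<chi> i. \<mu> * of_int (a i))" using a(2) by (simp add: vec_eq_iff)
  have P: "P = proj_class rats (\<chi> i. of_int (a i))"
    unfolding b(2) cls
  proof (intro equalityI subsetI)
    fix x assume "x \<in> {(\<chi> i. u * b $ i) | u. u \<noteq> 0}"
    then obtain u where u: "u \<noteq> 0" "x = (\<chi> i. u * b $ i)" by blast
    have "x = (\<chi> i. (u * \<mu>) * (\<chi> i. of_int (a i)) $ i)" unfolding u(2) by (simp add: vec_eq_iff a(2))
    moreover have "u * \<mu> \<noteq> 0" using u(1) a(1) by simp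
    ultimately show "x \<in> {(\<chi> i. u * (\<chi> i. of_int (a i)) $ i) | u. u \<noteq> 0}" by blast
  next
    fix x assume "x \<in> {(\<chi> i. u * (\<chi> i. of_int (a i)) $ i) | u. u \<noteq> (0::rat)}"
    then obtain u where u: "u \<noteq> 0" "x = (\<chi> i. u * (\<chi> i. of_int (a i)) $ i)" by blast
    have "x = (\<chi> i. (u / \<mu>) * b $ i)" unfolding u(2) using a(1) by (simp add: vec_eq_iff a(2))
    moreover have "u / \<mu> \<noteq> 0" using u(1) a(1) by simp
    ultimately show "x \<in> {(\<chi> i. u * b $ i) | u. u \<noteq> 0}" by blast
  qed
  have "(SOME x. x \<in> P) \<in> P"
  proof (rule someI_ex)
    have "(\<chi> i. 1 * b $ i) \<in> P" unfolding b(2) cls by (intro CollectI exI[of _ 1]) simp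
    then show "\<exists>x. x \<in> P" by blast
  qed
  then obtain u where u: "u \<noteq> 0" "(SOME x. x \<in> P) = (\<chi> i. u * of_int (a i))"
    unfolding P cls by auto
  have "real_of_int \<bar>a i\<bar> \<le> height P" for i
    unfolding height_def by (rule abs_le_height[OF u(1) a(3) u(2)])
  then show ?thesis using P by blast
qed

section \<open>The upper bound\<close>

definition unobstructed_triples :: "nat \<Rightarrow> nat \<Rightarrow> (int \<times> int \<times> int) set" where
  "unobstructed_triples d N = {(x, y, z). x \<in> {- int N..int N} \<and> y \<in> {- int N..int N} \<and> z \<in> {- int N..int N} \<and>
     (\<forall>p. prime p \<longrightarrow> \<not> bad d p x y z)}"

text \<open>A chosen integral representative determines its class, so points inject into triples. A
  bad prime would force every coordinate of the local solution to be divisible by it, against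
  primitivity.\<close>

lemma N_loc_le_unobstructed:
  assumes "d \<ge> 2" shows "N_loc d B \<le> card (unobstructed_triples d (nat \<lfloor>B\<rfloor>))"
proof -
  let ?X = "{P \<in> proj_plane rats. proj_map adeles adele_of_rat P \<in> fst ` X_points d adeles \<and> height P \<le> B}"
  let ?N = "nat \<lfloor>B\<rfloor>"
  have "\<forall>P\<in>?X. \<exists>a :: 3 \<Rightarrow> int. P = proj_class rats (\<chi> i. of_int (a i)) \<and> (\<forall>i. real_of_int \<bar>a i\<bar> \<le> height P)"
    using proj_point_representative by blast
  from bchoice[OF this] obtain a :: "(rat ^ 3) set \<Rightarrow> 3 \<Rightarrow> int"
    where A: "\<forall>P\<in>?X. P = proj_class rats (\<chi> i. of_int (a P i)) \<and> (\<forall>i. real_of_int \<bar>a P i\<bar> \<le> height P)" by (elim exE)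
  have a: "P = proj_class rats (\<chi> i. of_int (a P i))" "real_of_int \<bar>a P i\<bar> \<le> height P" if "P \<in> ?X" for P i
    using bspec[OF A that] by blast+
  let ?f = "\<lambda>P. (a P 1, a P 2, a P 3)"
  have "inj_on ?f ?X"
  proof (rule inj_onI)
    fix P Q assume PQ: "P \<in> ?X" "Q \<in> ?X" "?f P = ?f Q"
    then have "a P i = a Q i" for i using exhaust_3[of i] by auto
    then have "a P = a Q" by auto
    then show "P = Q" using a(1)[OF PQ(1)] a(1)[OF PQ(2)] by simp
  qed
  moreover have "?f ` ?X \<subseteq> unobstructed_triples d ?N"
  proof
    fix t assume "t \<in> ?f ` ?X"
    then obtain P where P: "P \<in> ?X" "t = ?f P" by blast
    have box: "a P i \<in> {- int ?N..int ?N}" for i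
    proof -
      have "real_of_int \<bar>a P i\<bar> \<le> B" using a(2)[OF P(1), of i] P(1) by simp
      then have "\<bar>a P i\<bar> \<le> \<lfloor>B\<rfloor>" by (simp add: le_floor_iff)
      moreover from this have "0 \<le> \<lfloor>B\<rfloor>" using abs_ge_zero order_trans by blast
      ultimately show ?thesis by auto
    qed
    have "\<not> bad d p (a P 1) (a P 2) (a P 3)" if p: "prime p" for p
    proof
      assume bad: "bad d p (a P 1) (a P 2) (a P 3)"
      have "proj_map adeles adele_of_rat (proj_class rats (\<chi> i. of_int (a P i))) \<in> fst ` X_points d adeles"
        using P(1) unfolding a(1)[OF P(1), symmetric] by simp
      from X_point_local_solution[OF this p] obtain y :: "3 \<Rightarrow> int"
        where y: "\<exists>i. \<not> int p dvd y i" "int p ^ 2 dvd (\<Sum>i\<in>UNIV. a P i * y i ^ d)" by blast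
      have "int p dvd y 1 \<and> int p dvd y 2 \<and> int p dvd y 3"
        using y(2) by (intro bad_imp_insoluble[OF p assms bad]) (simp add: sum_3)
      then have "int p dvd y i" for i using exhaust_3[of i] by auto
      with y(1) show False by blast
    qed
    then show "t \<in> unobstructed_triples d ?N" unfolding P(2) unobstructed_triples_def using box by blast
  qed
  moreover have "finite (unobstructed_triples d ?N)"
    by (rule finite_subset[of _ "{- int ?N..int ?N} \<times> {- int ?N..int ?N} \<times> {- int ?N..int ?N}"])
       (auto simp: unobstructed_triples_def)
  ultimately show ?thesis unfolding N_loc_def by (rule card_inj_on_le)
qed

lemma cube_one_minus_ge: "(p - 1) ^ 3 / p ^ 4 \<ge> 1 / p - 3 / p ^ 2" if "p \<ge> 1" for p :: real
proof -
  have "(1 / p - 3 / p ^ 2) * p ^ 4 = p ^ 3 - 3 * p ^ 2" using that by (simp add: field_simps eval_nat_numeral)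
  also have "\<dots> \<le> (p - 1) ^ 3" using that by (simp add: power3_eq_cube power2_eq_square algebra_simps)
  finally show ?thesis using that by (simp add: pos_le_divide_eq)
qed

text \<open>\<open>Z\<close> bounds the sifting primes and \<open>2 * N + 1\<close> is the side of
  the box. The relation between them makes the sieve error \<open>3 * R^6 * M^2\<close> at most
  three times the volume of the box.\<close>

lemma card_unobstructed_le:
  assumes d: "d > 0"
  shows "\<exists>C>0. \<forall>Z N. Z \<ge> 2 \<longrightarrow> real Z ^ 72 * exp 288 \<le> real (2 * N + 1) \<longrightarrow>
    real (card (unobstructed_triples d N)) \<le> C * real (2 * N + 1) ^ 3 / ln (real Z) powr (3 * (1 - delta d))"
proof -
  obtain C0 where C0: "\<And>Z. Z \<ge> 2 \<Longrightarrow> (\<Sum>p | prime p \<and> p \<le> Z. gcd_weight d p / real p) \<ge> (1 - delta d) * ln (ln (real Z)) - C0"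
    using sum_gcd_weight_primes_ge[OF d] by blast
  have sq: "summable (\<lambda>n::nat. 1 / real n ^ 2)" using inverse_power_summable[of 2, where ?'a=real] by (simp add: field_simps)
  define K where "K = (\<Sum>n. 1 / real n ^ 2)"
  \<comment> \<open>\<open>C0\<close> comes from the weighted prime sum, 6 bounds the contribution
    of the integers up to 6, where no sifting takes place, and \<open>9 * K\<close> collects the
    errors \<open>9 / p^2\<close> in the densities. The factor 3 counts the positions of the
    divisible coefficient.\<close>
  define C1 where "C1 = 3 * (C0 + 6) + 9 * K"
  have "real (card (unobstructed_triples d N)) \<le> 8 * exp C1 * real (2 * N + 1) ^ 3 / ln (real Z) powr (3 * (1 - delta d))"
    if Z: "Z \<ge> 2" and ZN: "real Z ^ 72 * exp 288 \<le> real (2 * N + 1)" for Z N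
  proof -
    \<comment> \<open>Starting beyond 6 makes the densities, at most \<open>3 / p\<close>, stay
      below one half as the sieve demands.\<close>
    define P where "P = {p. prime p \<and> 6 < p \<and> p \<le> Z}"
    interpret square_sieve P "bad d"
      by unfold_locales (auto simp: P_def periodic3_bad)
    have dens: "density p \<le> 3 / real p" "density p \<ge> 3 * gcd_weight d p / real p - 9 / real p ^ 2" if "p \<in> P" for p
    proof -
      have p: "prime p" "real p > 1" using that prime_gt_1_nat by (auto simp: P_def)
      note W = box_sum_bad_bounds[OF p(1) d]
      have "density p \<le> 3 * real p ^ 5 / real p ^ 6" unfolding density_def using W(2) by (intro divide_right_mono) auto
      also have "\<dots> = 3 / real p" using p by (simp add: eval_nat_numeral)
      finally show "density p \<le> 3 / real p" .
      have g: "0 \<le> gcd_weight d p" "gcd_weight d p \<le> 1" using gcd_weight_bounds[OF d] by auto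
      have "3 * gcd_weight d p / real p - 9 / real p ^ 2 \<le> 3 * gcd_weight d p / real p - 9 * gcd_weight d p / real p ^ 2"
        using g by (intro diff_left_mono divide_right_mono) auto
      also have "\<dots> = 3 * gcd_weight d p * (1 / real p - 3 / real p ^ 2)" by (simp add: algebra_simps)
      also have "\<dots> \<le> 3 * gcd_weight d p * ((real p - 1) ^ 3 / real p ^ 4)"
        using g cube_one_minus_ge[of "real p"] p by (intro mult_left_mono) auto
      also have "\<dots> = 3 * (real p ^ 2 * (real p - 1) ^ 3 * gcd_weight d p) / real p ^ 6"
        using p by (simp add: eval_nat_numeral)
      also have "\<dots> \<le> density p" unfolding density_def using W(1) by (intro divide_right_mono) auto
      finally show "density p \<ge> 3 * gcd_weight d p / real p - 9 / real p ^ 2" .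
    qed
    have half: "density p \<le> 1 / 2" if "p \<in> P" for p
    proof -
      have "3 / real p \<le> 1 / 2" using that by (simp add: P_def field_simps)
      then show ?thesis using dens(1)[OF that] by simp
    qed
    have finP: "finite P" by (rule finite_P)
    have sumd: "(\<Sum>p\<in>P. density p) \<ge> 3 * (1 - delta d) * ln (ln (real Z)) - C1"
    proof -
      have "(\<Sum>p | prime p \<and> p \<le> Z. gcd_weight d p / real p) \<le> (\<Sum>p\<in>P \<union> {1..6}. gcd_weight d p / real p)"
        by (rule sum_mono2) (use finP gcd_weight_bounds[OF d] prime_ge_1_nat in \<open>auto simp: P_def not_less\<close>)
      also have "\<dots> \<le> (\<Sum>p\<in>P. gcd_weight d p / real p) + (\<Sum>p\<in>{1..6::nat}. 1)"
      proof -
        have "(\<Sum>p\<in>P \<union> {1..6}. gcd_weight d p / real p) = (\<Sum>p\<in>P. gcd_weight d p / real p) + (\<Sum>p\<in>{1..6}. gcd_weight d p / real p)"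
          by (rule sum.union_disjoint) (use finP in \<open>auto simp: P_def\<close>)
        moreover have "gcd_weight d p / real p \<le> 1" if "p \<in> {1..6}" for p
          using gcd_weight_bounds[OF d, of p] that by (auto simp: divide_le_eq_1)
        then have "(\<Sum>p\<in>{1..6}. gcd_weight d p / real p) \<le> (\<Sum>p\<in>{1..6::nat}. 1)" by (rule sum_mono)
        ultimately show ?thesis by simp
      qed
      finally have 1: "(\<Sum>p\<in>P. gcd_weight d p / real p) \<ge> (1 - delta d) * ln (ln (real Z)) - C0 - 6" using C0[OF Z] by simp
      have 2: "(\<Sum>p\<in>P. 1 / real p ^ 2) \<le> K" unfolding K_def by (rule sum_le_suminf[OF sq finP]) auto
      have "(\<Sum>p\<in>P. density p) \<ge> (\<Sum>p\<in>P. 3 * (gcd_weight d p / real p) - 9 * (1 / real p ^ 2))"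
        using dens(2) by (intro sum_mono) simp
      moreover have "(\<Sum>p\<in>P. 3 * (gcd_weight d p / real p) - 9 * (1 / real p ^ 2)) = 3 * (\<Sum>p\<in>P. gcd_weight d p / real p) - 9 * (\<Sum>p\<in>P. 1 / real p ^ 2)"
        by (simp add: sum_subtractf sum_distrib_left)
      ultimately have "(\<Sum>p\<in>P. density p) \<ge> 3 * ((1 - delta d) * ln (ln (real Z)) - C0 - 6) - 9 * K"
        using mult_left_mono[OF 1, of 3] mult_left_mono[OF 2, of 9] by linarith
      then show ?thesis by (simp add: C1_def algebra_simps)
    qed
    \<comment> \<open>With this level \<open>R ^ 6\<close> is at most the side of the box, and \<open>ln R\<close> dominates \<open>\<Sum>p\<in>P. odds p * ln p\<close>.\<close>
    define R where "R = real Z ^ 12 * exp 48"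
    have R1: "R > 1" unfolding R_def using Z one_le_power[of "real Z" 12] by (intro less_1_mult'[of _ _] ) auto
    have lnR: "ln R = 12 * ln (real Z) + 48" unfolding R_def using Z by (simp add: ln_mult ln_realpow)
    \<comment> \<open>Here \<open>odds p \<le> 2 * density p \<le> 6 / p\<close>, so Mertens bounds
      the sum by \<open>6 * (ln Z + 4)\<close>, which is exactly half of \<open>ln R\<close>. This
      fixes the constants 12 and 48.\<close>
    have small: "(\<Sum>p\<in>P. odds p * ln (real p)) \<le> ln R / 2"
    proof -
      have "(\<Sum>p\<in>P. odds p * ln (real p)) \<le> (\<Sum>p\<in>P. 6 * (mangoldt p / real p))"
      proof (rule sum_mono)
        fix p assume p: "p \<in> P"
        have pp: "prime p" "p > 1" using p prime_gt_1_nat by (auto simp: P_def)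
        have "odds p \<le> 2 * density p" using odds_bounds(3)[OF half p] by simp
        also have "\<dots> \<le> 6 / real p" using dens(1)[OF p] by simp
        finally have "odds p * ln (real p) \<le> 6 / real p * ln (real p)" using pp by (intro mult_right_mono) auto
        then show "odds p * ln (real p) \<le> 6 * (mangoldt p / real p)" using pp by simp
      qed
      also have "\<dots> = 6 * (\<Sum>p\<in>P. mangoldt p / real p)" by (simp add: sum_distrib_left)
      also have "(\<Sum>p\<in>P. mangoldt p / real p :: real) \<le> (\<Sum>n=1..Z. mangoldt n / real n)"
        by (rule sum_mono2) (auto simp: P_def mangoldt_nonneg)
      also have "\<dots> \<le> ln (real Z) + 4" using Z by (intro sum_mangoldt_over_le) auto
      finally show ?thesis unfolding lnR by simp
    qed
    define G where "G = sieve_sum R"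
    have G1: "G \<ge> 1" unfolding G_def using R1 sieve_sum_ge_1[OF half] by simp
    have "G \<ge> exp (\<Sum>p\<in>P. density p) / 2" unfolding G_def by (rule sieve_sum_ge[OF half R1 small])
    moreover have "exp (\<Sum>p\<in>P. density p) \<ge> exp (3 * (1 - delta d) * ln (ln (real Z)) - C1)" using sumd by simp
    moreover have "exp (3 * (1 - delta d) * ln (ln (real Z)) - C1) = ln (real Z) powr (3 * (1 - delta d)) / exp C1"
      using Z by (simp add: powr_def exp_diff)
    ultimately have "ln (real Z) powr (3 * (1 - delta d)) / exp C1 \<le> 2 * G" by linarith
    then have Gge: "G \<ge> ln (real Z) powr (3 * (1 - delta d)) / (2 * exp C1)" by (simp add: field_simps)
    let ?M = "2 * N + 1"
    let ?S = "unobstructed_triples d N"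
    have "real (card ?S) * G ^ 2 \<le> real ?M ^ 3 * G + 3 * R ^ 6 * real ?M ^ 2"
      unfolding G_def
    proof (rule sieve_bound[OF half])
      show "?S \<subseteq> {- int N..<- int N + int ?M} \<times> {- int N..<- int N + int ?M} \<times> {- int N..<- int N + int ?M}"
        by (auto simp: unobstructed_triples_def)
      show "\<not> bad d p x y z" if "(x, y, z) \<in> ?S" "p \<in> P" for x y z p
        using that by (auto simp: unobstructed_triples_def P_def)
    qed (use R1 in auto)
    also have "3 * R ^ 6 * real ?M ^ 2 \<le> 3 * real ?M * real ?M ^ 2"
    proof -
      have "R ^ 6 = real Z ^ 72 * exp 288" unfolding R_def by (simp add: power_mult_distrib power_mult[symmetric] flip: exp_of_nat_mult)
      then have "R ^ 6 \<le> real ?M" using ZN by simp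
      then show ?thesis by (intro mult_right_mono mult_left_mono) auto
    qed
    also have "3 * real ?M * real ?M ^ 2 = 3 * real ?M ^ 3" by (simp add: power2_eq_square power3_eq_cube)
    also have "3 * real ?M ^ 3 \<le> 3 * real ?M ^ 3 * G" using G1 by (simp add: mult_le_cancel_left1)
    finally have "real (card ?S) * G * G \<le> (4 * real ?M ^ 3) * G" by (simp add: power2_eq_square mult.assoc algebra_simps)
    then have cG: "real (card ?S) * G \<le> 4 * real ?M ^ 3" using G1 by (subst (asm) mult_le_cancel_right_pos) auto
    have L0: "ln (real Z) powr (3 * (1 - delta d)) > 0" using Z by simp
    have "real (card ?S) * (ln (real Z) powr (3 * (1 - delta d)) / (2 * exp C1)) \<le> real (card ?S) * G"
      using Gge by (intro mult_left_mono) auto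
    also note cG
    finally show ?thesis using L0 by (simp add: field_simps)
  qed
  \<comment> \<open>The factor 8 is 4, from volume plus three times the volume as error, times the 2
    lost in \<open>sieve_sum_ge\<close>.\<close>
  then show ?thesis by (intro exI[of _ "8 * exp C1"] conjI) auto
qed

theorem theorem5p11:
  fixes d :: nat
  assumes "d \<ge> 2"
  shows "(\<lambda>B::real. real (N_loc d B)) \<in> O[at_top](\<lambda>B. B ^ 3 / ln B powr (3 * (1 - delta d)))"
proof -
  let ?k = "3 * (1 - delta d)"
  have k0: "?k \<ge> 0" using delta_le_1[of d] assms by simp
  obtain C where C: "C > 0" "\<And>Z N. Z \<ge> 2 \<Longrightarrow> real Z ^ 72 * exp 288 \<le> real (2 * N + 1) \<Longrightarrow>
      real (card (unobstructed_triples d N)) \<le> C * real (2 * N + 1) ^ 3 / ln (real Z) powr ?k"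
    using card_unobstructed_le[of d] assms by auto
  \<comment> \<open>The largest \<open>Z\<close> permitted by \<open>Z^72 * exp 288 \<le> B\<close>
    is about \<open>B powr (1/72) * exp (-4)\<close>. Weakening this to
    \<open>B powr (1/144)\<close> absorbs the rounding and the constant, at the price of
    \<open>ln Z \<ge> ln B / 144\<close>.\<close>
  have ev1: "eventually (\<lambda>B::real. B powr (1/144) \<le> B powr (1/72) * exp (-4) - 1) at_top" by real_asymp
  have ev2: "eventually (\<lambda>B::real. B powr (1/144) \<ge> 2) at_top" by real_asymp
  show ?thesis
  \<comment> \<open>27 is the cube of 3 from \<open>2 * N + 1 \<le> 3 * B\<close>, and the power of
    144 comes from replacing \<open>ln Z\<close> by \<open>ln B / 144\<close>.\<close>
  proof (rule bigoI[where c="27 * C * 144 powr ?k"])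
    show "\<forall>\<^sub>F B in at_top. norm (real (N_loc d B)) \<le> 27 * C * 144 powr ?k * norm (B ^ 3 / ln B powr ?k)"
      using ev1 ev2 eventually_gt_at_top[of 1]
    proof eventually_elim
      case (elim B)
      define Z where "Z = nat \<lfloor>B powr (1/72) * exp (-4)\<rfloor>"
      define N where "N = nat \<lfloor>B\<rfloor>"
      have Zle: "real Z \<le> B powr (1/72) * exp (-4)" unfolding Z_def by simp
      have "B powr (1/72) * exp (-4) - 1 \<le> real Z" unfolding Z_def by linarith
      then have Zge: "B powr (1/144) \<le> real Z" using elim by linarith
      then have Z2: "Z \<ge> 2" using elim by linarith
      have N: "real (2 * N + 1) \<ge> B" "real (2 * N + 1) \<le> 3 * B" using elim unfolding N_def by linarith+
      have "real Z ^ 72 * exp 288 \<le> (B powr (1/72) * exp (-4)) ^ 72 * exp 288"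
        using Zle by (intro mult_right_mono power_mono) auto
      also have "\<dots> = B"
        using elim by (simp add: power_mult_distrib powr_power flip: exp_of_nat_mult exp_add)
      finally have "real (card (unobstructed_triples d N)) \<le> C * real (2 * N + 1) ^ 3 / ln (real Z) powr ?k"
        using N by (intro C Z2) linarith
      also have "\<dots> \<le> C * (3 * B) ^ 3 / (ln B / 144) powr ?k"
      proof (intro frac_le mult_left_mono power_mono powr_mono2 k0 N)
        have "ln B / 144 = ln (B powr (1/144))" using elim by (simp add: ln_powr)
        also have "\<dots> \<le> ln (real Z)" using Zge elim by (subst ln_le_cancel_iff) auto
        finally show "ln B / 144 \<le> ln (real Z)" .
      qed (use C elim in auto)
      also have "\<dots> = 27 * C * 144 powr ?k * (B ^ 3 / ln B powr ?k)"
        using elim by (simp add: powr_divide power_mult_distrib)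
      finally have "real (card (unobstructed_triples d N)) \<le> 27 * C * 144 powr ?k * (B ^ 3 / ln B powr ?k)" .
      moreover have "real (N_loc d B) \<le> real (card (unobstructed_triples d N))"
        using N_loc_le_unobstructed[OF assms, of B] unfolding N_def by simp
      ultimately show ?case using elim by simp
    qed
  qed
qed

end
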